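(* Fix $\delta>0$, and let $X_H(\mathbf L)$ be the number of nondegenerate cuboctahedra in a uniformly random order-$n$ Latin square $\mathbf L$. Then \[\Pr\left[X_H(\mathbf L)\le(1-\delta)n^4\right]\le\exp(-\Omega_\delta(n^2)),\] i.e., there is $c=c(\delta)>0$ such that for all sufficiently large $n$ this probability is at most $e^{-cn^2}$.
   Context: A Latin square of order $n$ is an $n\times n$ array $L$ filled with symbols $1,\dots,n$ such that every symbol appears exactly once in each row and column. A (labeled) cuboctahedron in $L$ is a tuple of two ordered pairs of rows $(r_1,r_2),(r_1',r_2')$ and two ordered pairs of columns $(c_1,c_2),(c_1',c_2')$ such that $L_{r_i,c_j}=L_{r_i',c_j'}$ for all $i,j\in\{1,2\}$. It is nondegenerate if $r_1,r_2,r_1',r_2'$ are distinct, $c_1,c_2,c_1',c_2'$ are distinct, and the four symbols $L_{r_i,c_j}$ ($i,j\in\{1,2\}$) are distinct. *)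

theory Defs
  imports "HOL-Probability.Probability"
begin

text \<open>An order-\<open>n\<close> array is a curried function, extensional outside \<open>{1..n}\<close> in both arguments,
  so that distinct functions represent distinct arrays and the set of Latin squares is finite.\<close>

definition latin_squares :: "nat \<Rightarrow> (nat \<Rightarrow> nat \<Rightarrow> nat) set" where
  "latin_squares n =
     {L \<in> {1..n} \<rightarrow>\<^sub>E ({1..n} \<rightarrow>\<^sub>E {1..n}).
        (\<forall>r\<in>{1..n}. \<forall>s\<in>{1..n}. \<exists>!c. c \<in> {1..n} \<and> L r c = s) \<and>
        (\<forall>c\<in>{1..n}. \<forall>s\<in>{1..n}. \<exists>!r. r \<in> {1..n} \<and> L r c = s)}"

text \<open>A tuple \<open>((r1, r2), (r1', r2'), (c1, c2), (c1', c2'))\<close> of two ordered pairs of rows and two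
  ordered pairs of columns.\<close>

type_synonym row_col_pairs = "(nat \<times> nat) \<times> (nat \<times> nat) \<times> (nat \<times> nat) \<times> (nat \<times> nat)"

definition cuboctahedra :: "nat \<Rightarrow> (nat \<Rightarrow> nat \<Rightarrow> nat) \<Rightarrow> row_col_pairs set" where
  "cuboctahedra n L =
     {((r1, r2), (r1', r2'), (c1, c2), (c1', c2')) | r1 r2 r1' r2' c1 c2 c1' c2'.
        {r1, r2, r1', r2'} \<subseteq> {1..n} \<and> {c1, c2, c1', c2'} \<subseteq> {1..n} \<and>
        L r1 c1 = L r1' c1' \<and> L r1 c2 = L r1' c2' \<and>
        L r2 c1 = L r2' c1' \<and> L r2 c2 = L r2' c2'}"

fun nondegenerate :: "(nat \<Rightarrow> nat \<Rightarrow> nat) \<Rightarrow> row_col_pairs \<Rightarrow> bool" where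
  "nondegenerate L ((r1, r2), (r1', r2'), (c1, c2), (c1', c2')) \<longleftrightarrow>
     distinct [r1, r2, r1', r2'] \<and> distinct [c1, c2, c1', c2'] \<and>
     distinct [L r1 c1, L r1 c2, L r2 c1, L r2 c2]"

definition X_H :: "nat \<Rightarrow> (nat \<Rightarrow> nat \<Rightarrow> nat) \<Rightarrow> nat" where
  "X_H n L = card {q \<in> cuboctahedra n L. nondegenerate L q}"

text \<open>\<open>pmf_of_set\<close> is unspecified on empty and on infinite sets, and \<open>card\<close> is \<open>0\<close> on infinite
  sets; the following facts exclude these cases.\<close>

lemma finite_latin_squares: "finite (latin_squares n)"
proof -
  have "finite ({1..n} \<rightarrow>\<^sub>E ({1..n} \<rightarrow>\<^sub>E {1..n}))"
    by (intro finite_PiE finite_atLeastAtMost)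
  then show ?thesis unfolding latin_squares_def by (rule finite_subset[OF Collect_restrict])
qed

lemma finite_cuboctahedra: "finite (cuboctahedra n L)"
proof -
  let ?P = "{1..n} \<times> {1..n}"
  have "cuboctahedra n L \<subseteq> ?P \<times> ?P \<times> ?P \<times> ?P" unfolding cuboctahedra_def by blast
  then show ?thesis by (rule finite_subset) (intro finite_cartesian_product finite_atLeastAtMost)
qed

lemma cyclic_ex1:
  fixes n a s :: nat
  assumes "s \<in> {1..n}"
  shows "\<exists>!c. c \<in> {1..n} \<and> (a + c) mod n + 1 = s"
proof -
  let ?f = "\<lambda>c. (a + c) mod n + 1"
  have n: "n > 0" using assms by simp
  have le: "y \<le> x" if "x \<in> {1..n}" "y \<in> {1..n}" "?f x = ?f y" for x y
  proof (rule ccontr)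
    assume "\<not> y \<le> x"
    then have lt: "x < y" by simp
    have "(a + y) mod n = (a + x) mod n" using that(3) by simp
    then have "n dvd (a + y) - (a + x)"
      by (rule mod_eq_dvd_iff_nat[THEN iffD1, rotated]) (use lt in simp)
    then have "n dvd y - x" by simp
    then have "n \<le> y - x" using lt by (intro dvd_imp_le) simp_all
    with that(1,2) lt show False by simp
  qed
  have inj: "inj_on ?f {1..n}"
  proof (rule inj_onI)
    fix x y assume xy: "x \<in> {1..n}" "y \<in> {1..n}" and eq: "?f x = ?f y"
    show "x = y" using le[OF xy(2,1) eq[symmetric]] le[OF xy eq] by (rule order.antisym)
  qed
  have "?f ` {1..n} \<subseteq> {1..n}"
    using n by (intro image_subsetI) (simp add: Suc_le_eq)
  then have "?f ` {1..n} = {1..n}"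
    using inj by (rule endo_inj_surj[OF finite_atLeastAtMost])
  then have "s \<in> ?f ` {1..n}" using assms by simp
  then obtain c where c: "s = ?f c" "c \<in> {1..n}" by (rule imageE)
  show ?thesis
  proof (rule ex1I[of _ c])
    show "c \<in> {1..n} \<and> ?f c = s" using c by simp
    fix d assume "d \<in> {1..n} \<and> ?f d = s"
    then show "d = c" using inj_onD[OF inj, of d c] c by simp
  qed
qed

lemma latin_squares_nonempty: "latin_squares n \<noteq> {}"
proof -
  define L where "L = (\<lambda>r\<in>{1..n}. \<lambda>c\<in>{1..n}. (r + c) mod n + 1)"
  have L: "L r c = (r + c) mod n + 1" if "r \<in> {1..n}" "c \<in> {1..n}" for r c
    using that by (simp add: L_def)
  have "L \<in> {1..n} \<rightarrow>\<^sub>E ({1..n} \<rightarrow>\<^sub>E {1..n})"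
    unfolding L_def restrict_PiE_iff by (simp add: Suc_le_eq)
  moreover have "\<exists>!c. c \<in> {1..n} \<and> L r c = s" if "r \<in> {1..n}" "s \<in> {1..n}" for r s
  proof -
    have "(\<lambda>c. c \<in> {1..n} \<and> L r c = s) = (\<lambda>c. c \<in> {1..n} \<and> (r + c) mod n + 1 = s)"
      by (intro ext conj_cong refl) (simp only: L that)
    then show ?thesis using cyclic_ex1[OF that(2), of r] by (simp only:)
  qed
  moreover have "\<exists>!r. r \<in> {1..n} \<and> L r c = s" if "c \<in> {1..n}" "s \<in> {1..n}" for c s
  proof -
    have "(\<lambda>r. r \<in> {1..n} \<and> L r c = s) = (\<lambda>r. r \<in> {1..n} \<and> (c + r) mod n + 1 = s)"
      by (intro ext conj_cong refl) (simp only: L that add.commute[of c])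
    then show ?thesis using cyclic_ex1[OF that(2), of c] by (simp only:)
  qed
  ultimately have "L \<in> latin_squares n"
    unfolding latin_squares_def by (intro CollectI conjI ballI)
  then show ?thesis by blast
qed

end

theory Submission
  imports Defs "HOL-Combinatorics.Permutations" "HOL-Computational_Algebra.Fundamental_Theorem_Algebra"
    "HOL-Real_Asymp.Real_Asymp"
begin

text \<open>The number of extensions of a Latin rectangle by one row is the permanent of a regular
  \<open>0/1\<close> matrix, and such permanents are known up to a subexponential factor: Bregman's bound from above,
  Gurvits' capacity bound from below. Hence the first \<open>m = \<Theta>(\<eta> n)\<close> rows of a uniform Latin square have
  density at most \<open>exp (O(\<eta>) m n)\<close> with respect to \<open>m\<close> independent uniform permutations, and it is enough
  to find a lower tail of order \<open>exp (- c m n)\<close>, with \<open>c\<close> independent of \<open>\<eta>\<close>, for independent permutations.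

  Rows \<open>a, b', a', d\<close> and columns \<open>c\<^sub>1, c\<^sub>2\<close> give a cuboctahedron iff \<open>d\<close> and \<open>b' a'\<^sup>-\<^sup>1 a\<close> agree at
  \<open>c\<^sub>1\<close> and \<open>c\<^sub>2\<close>. With \<open>a'\<close> in a fixed block of constantly many rows and \<open>a\<close>, \<open>b'\<close>, \<open>d\<close> in random blocks of
  linearly many rows, the pairs \<open>a'\<^sup>-\<^sup>1 a (c\<^sub>1, c\<^sub>2)\<close>, then the pairs \<open>b' a'\<^sup>-\<^sup>1 a (c\<^sub>1, c\<^sub>2)\<close>, and finally the
  hits \<open>d (c\<^sub>1, c\<^sub>2)\<close> are counted in turn. Counting distinct pairs makes each count Lipschitz under
  transpositions, so that an exponential moment bound applies, and the constant density of the pairs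
  of the second stage makes the final tail strong enough. Averaging over permutations of the rows
  passes from the blocks to all of \<open>X_H\<close>.\<close>

section \<open>Permanents\<close>

text \<open>Gain and cost are both exponential in \<open>n^2\<close>, so the constants decide.
  Replacing the first \<open>m\<close> rows by independent permutations costs essentially a factor
  \<open>exp (2 * m^2)\<close>: a free row has \<open>n!\<close> options, at most about
  \<open>exp (2 * i)\<close> times Gurvits' lower bound \<open>((n - i) / e)^n\<close> for a row
  that extends \<open>i\<close> given ones. With \<open>l\<close> about \<open>\<eta> * n\<close>
  and \<open>m \<le> 4 * l\<close> the cost exponent is at most \<open>32 * \<eta> * l * n\<close>.
  The weakest tail is that of the last stage: a transposition in one row \<open>d\<close> may alter
  \<open>4 * n\<close> hits however sparse the targets are, whereas the mean is about
  \<open>K * l^3\<close>, so the exponent is of order \<open>\<rho>\<^sup>2 * l * n\<close>, where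
  \<open>\<rho> = K * l\<^sup>2 / n\<^sup>2\<close> is the density of the targets. For a
  \<open>K\<close> independent of \<eta> this would be of order \<open>\<eta>^4 * l * n\<close> and
  lose against the cost; hence \<open>K\<close> is about \<open>\<tau> / \<eta>\<^sup>2\<close>,
  still constant in \<open>n\<close>, which keeps \<rho> between \<open>\<tau> / 8\<close> and
  \<tau>. The upper bound is wanted too: it makes coincidences among the second-stage pairs a
  negligible fraction, so that counting distinct pairs loses almost nothing.\<close>

definition perfect_matchings :: "'a set \<Rightarrow> 'b set \<Rightarrow> ('a \<Rightarrow> 'b set) \<Rightarrow> ('a \<Rightarrow> 'b) set" where
  "perfect_matchings I J E = {\<sigma> \<in> extensional I. bij_betw \<sigma> I J \<and> (\<forall>i\<in>I. \<sigma> i \<in> E i)}"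

lemma finite_perfect_matchings:
  assumes "finite I" "finite J"
  shows "finite (perfect_matchings I J E)"
proof (rule finite_subset)
  show "perfect_matchings I J E \<subseteq> I \<rightarrow>\<^sub>E J"
    by (auto simp: perfect_matchings_def PiE_def bij_betw_def)
  show "finite (I \<rightarrow>\<^sub>E J)" using assms by (intro finite_PiE) auto
qed

text \<open>Laplace expansion in combinatorial form. Passing to a minor shrinks only
  \<open>I\<close> and \<open>J\<close> and leaves \<open>E\<close> alone, so minors have the same
  shape and the degree of row \<open>i\<close> is read off as
  \<open>card (E i \<inter> J)\<close>.\<close>

lemma restrict_matching_bij:
  assumes i: "i \<in> I" and k: "k \<in> E i" "k \<in> J"
  shows "bij_betw (\<lambda>\<sigma>. restrict \<sigma> (I - {i})) {\<sigma> \<in> perfect_matchings I J E. \<sigma> i = k}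
           (perfect_matchings (I - {i}) (J - {k}) E)"
proof (rule bij_betw_byWitness[where f' = "\<lambda>\<tau>. \<tau>(i := k)"])
  show "\<forall>\<sigma>\<in>{\<sigma> \<in> perfect_matchings I J E. \<sigma> i = k}. (restrict \<sigma> (I - {i}))(i := k) = \<sigma>"
    by (auto simp: perfect_matchings_def extensional_def fun_eq_iff)
  show "\<forall>\<tau>\<in>perfect_matchings (I - {i}) (J - {k}) E. restrict (\<tau>(i := k)) (I - {i}) = \<tau>"
    by (auto simp: perfect_matchings_def extensional_def fun_eq_iff)
  have "bij_betw (restrict \<sigma> (I - {i})) (I - {i}) (J - {\<sigma> i})" if "bij_betw \<sigma> I J" for \<sigma>
    using that i by (auto simp: bij_betw_def inj_on_def)
  then show "(\<lambda>\<sigma>. restrict \<sigma> (I - {i})) ` {\<sigma> \<in> perfect_matchings I J E. \<sigma> i = k}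
     \<subseteq> perfect_matchings (I - {i}) (J - {k}) E"
    by (auto simp: perfect_matchings_def split: if_splits)
  have "bij_betw (\<tau>(i := k)) I J" if "bij_betw \<tau> (I - {i}) (J - {k})" for \<tau>
  proof -
    have "bij_betw (\<tau>(i := k)) (I - {i}) (J - {k})"
      using that by (subst bij_betw_cong[of _ _ \<tau>]) auto
    moreover have "bij_betw (\<tau>(i := k)) {i} {k}" by simp
    ultimately have "bij_betw (\<tau>(i := k)) ((I - {i}) \<union> {i}) ((J - {k}) \<union> {k})"
      by (rule bij_betw_combine) auto
    moreover have "(I - {i}) \<union> {i} = I" "(J - {k}) \<union> {k} = J" using i k by auto
    ultimately show ?thesis by simp
  qed
  then show "(\<lambda>\<tau>. \<tau>(i := k)) ` perfect_matchings (I - {i}) (J - {k}) E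
     \<subseteq> {\<sigma> \<in> perfect_matchings I J E. \<sigma> i = k}"
    using i k by (auto simp: perfect_matchings_def extensional_def)
qed

text \<open>Jensen's inequality for \<open>x ln x\<close>, obtained from
  \<open>ln y \<le> y - 1\<close> at \<open>y = (p / r) / f k\<close>. Terms with
  \<open>f k = 0\<close> are harmless because the logarithm is multiplied by 0.\<close>

lemma x_ln_x_sum_le:
  fixes f :: "'a \<Rightarrow> real"
  assumes "finite K" "\<And>k. k \<in> K \<Longrightarrow> f k \<ge> 0" "p = sum f K" "p > 0"
  shows "p * ln p \<le> p * ln (card K) + (\<Sum>k\<in>K. f k * ln (f k))"
proof -
  define r where "r = real (card K)"
  have "K \<noteq> {}" using assms by auto
  then have r: "r > 0" using assms(1) by (simp add: r_def card_gt_0_iff)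
  have "f k * ln (f k) \<ge> f k * ln (p / r) + (f k - p / r)" if "k \<in> K" for k
  proof (cases "f k = 0")
    case True
    then show ?thesis using r assms(4) by simp
  next
    case False
    then have pos: "f k > 0" using assms(2)[OF that] by simp
    have "ln ((p / r) / f k) \<le> (p / r) / f k - 1"
      using pos r assms(4) by (intro ln_le_minus_one) simp
    then have "f k * (ln (p / r) - ln (f k)) \<le> f k * ((p / r) / f k - 1)"
      using pos r assms(4) by (intro mult_left_mono) (auto simp: ln_div ln_mult)
    also have "\<dots> = p / r - f k" using pos by (simp add: field_simps)
    finally show ?thesis by (simp add: algebra_simps)
  qed
  then have "(\<Sum>k\<in>K. f k * ln (f k)) \<ge> (\<Sum>k\<in>K. f k * ln (p / r) + (f k - p / r))"
    by (rule sum_mono)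
  also have "(\<Sum>k\<in>K. f k * ln (p / r) + (f k - p / r)) = p * ln (p / r) + (p - r * (p / r))"
    by (simp add: sum.distrib sum_subtractf sum_distrib_right[symmetric] assms(3) r_def)
  also have "\<dots> = p * ln p - p * ln r"
    using r assms(4) by (simp add: ln_div algebra_simps)
  finally show ?thesis by (simp add: r_def)
qed

text \<open>Schrijver's proof of the Minc conjecture: by convexity of \<open>x ln x\<close>, expand along every row
  simultaneously and average the induction hypothesis over all perfect matchings.\<close>

theorem bregman:
  assumes "finite I" "finite J" "perfect_matchings I J E \<noteq> {}"
  shows "ln (card (perfect_matchings I J E))
     \<le> (\<Sum>i\<in>I. ln (fact (card (E i \<inter> J))) / card (E i \<inter> J))"
  using assms
proof (induction "card I" arbitrary: I J)
  case 0
  then have I: "I = {}" by simp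
  then have "perfect_matchings I J E \<subseteq> {\<lambda>_. undefined}"
    by (auto simp: perfect_matchings_def)
  from card_mono[OF _ this] have "card (perfect_matchings I J E) \<le> 1" by simp
  then have "ln (card (perfect_matchings I J E)) \<le> 0"
    by (cases "card (perfect_matchings I J E)") auto
  then show ?case by (simp add: I)
next
  case (Suc n)
  define S where "S = perfect_matchings I J E"
  define p where "p = real (card S)"
  define r where "r i = card (E i \<inter> J)" for i
  define L where "L m = ln (fact m) / real m" for m
  define pk where "pk i k = real (card (perfect_matchings (I - {i}) (J - {k}) E))" for i k
  have finS: "finite S" unfolding S_def using Suc by (intro finite_perfect_matchings) auto
  have Sne: "S \<noteq> {}" using Suc by (simp add: S_def)
  have p: "p > 0" using finS Sne by (simp add: p_def card_gt_0_iff)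
  have fibre: "real (card {\<sigma>\<in>S. \<sigma> i = k}) = pk i k" if "i \<in> I" "k \<in> E i \<inter> J" for i k
    unfolding pk_def S_def using bij_betw_same_card[OF restrict_matching_bij, of i I k E J] that by auto
  have mem: "\<sigma> i \<in> E i \<inter> J" if "\<sigma> \<in> S" "i \<in> I" for \<sigma> i
    using that by (auto simp: S_def perfect_matchings_def bij_betw_def)
  have sumS: "(\<Sum>k\<in>E i \<inter> J. pk i k * h k) = (\<Sum>\<sigma>\<in>S. h (\<sigma> i))" if "i \<in> I" for i and h :: "_ \<Rightarrow> real"
  proof -
    have "(\<Sum>\<sigma>\<in>S. h (\<sigma> i)) = (\<Sum>k\<in>E i \<inter> J. \<Sum>\<sigma>\<in>{\<sigma>\<in>S. \<sigma> i = k}. h (\<sigma> i))"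
      using mem that Suc.prems by (intro sum.group[symmetric] finS) auto
    also have "\<dots> = (\<Sum>k\<in>E i \<inter> J. pk i k * h k)"
      by (intro sum.cong refl) (simp add: fibre[symmetric] that)
    finally show ?thesis by simp
  qed
  \<comment> \<open>Jensen for the expansion along row \<open>i\<close>. A column \<open>k\<close>
    is the value at \<open>i\<close> of exactly \<open>pk i k\<close> matchings, so
    \<open>sumS\<close> turns the sum over columns into one over matchings; this puts the expansions
    along all rows over the same index set.\<close>
  have row: "p * ln p \<le> (\<Sum>\<sigma>\<in>S. ln (r i) + ln (pk i (\<sigma> i)))" if i: "i \<in> I" for i
  proof -
    have "p = (\<Sum>k\<in>E i \<inter> J. pk i k)" using sumS[OF i, of "\<lambda>_. 1"] by (simp add: p_def)
    then have "p * ln p \<le> p * ln (r i) + (\<Sum>k\<in>E i \<inter> J. pk i k * ln (pk i k))"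
      unfolding r_def using p Suc.prems by (intro x_ln_x_sum_le) (auto simp: pk_def)
    then show ?thesis by (simp add: sumS[OF i] sum.distrib p_def)
  qed
  have per_matching: "(\<Sum>i\<in>I. ln (r i) + ln (pk i (\<sigma> i))) \<le> real (Suc n) * (\<Sum>j\<in>I. L (r j))"
    if \<sigma>: "\<sigma> \<in> S" for \<sigma>
  proof -
    define d where "d j k = L (card (E j \<inter> (J - {k})))" for j k
    have bij: "bij_betw \<sigma> I J" using \<sigma> by (simp add: S_def perfect_matchings_def)
    have "ln (pk i (\<sigma> i)) \<le> (\<Sum>j\<in>I - {i}. d j (\<sigma> i))" if i: "i \<in> I" for i
    proof -
      have "card {\<sigma>'\<in>S. \<sigma>' i = \<sigma> i} > 0" using finS \<sigma> by (auto simp: card_gt_0_iff)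
      then have "pk i (\<sigma> i) > 0"
        using fibre[OF i mem[OF \<sigma> i]] by linarith
      then have "perfect_matchings (I - {i}) (J - {\<sigma> i}) E \<noteq> {}" by (auto simp: pk_def)
      then show ?thesis unfolding pk_def d_def L_def
        using Suc i by (intro Suc.hyps(1)) auto
    qed
    then have "(\<Sum>i\<in>I. ln (r i) + ln (pk i (\<sigma> i)))
        \<le> (\<Sum>i\<in>I. ln (r i) + (\<Sum>j\<in>I - {i}. d j (\<sigma> i)))"
      by (intro sum_mono add_left_mono)
    also have "\<dots> = (\<Sum>i\<in>I. ln (r i)) + (\<Sum>j\<in>I. \<Sum>i\<in>I - {j}. d j (\<sigma> i))"
    proof -
      have "(\<Sum>i\<in>I. \<Sum>j\<in>I - {i}. d j (\<sigma> i)) = (\<Sum>i\<in>I. \<Sum>j | j \<in> I \<and> i \<noteq> j. d j (\<sigma> i))"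
        by (intro sum.cong) auto
      also have "\<dots> = (\<Sum>j\<in>I. \<Sum>i | i \<in> I \<and> i \<noteq> j. d j (\<sigma> i))"
        using Suc.prems(1) by (rule sum.swap_restrict) fact
      also have "\<dots> = (\<Sum>j\<in>I. \<Sum>i\<in>I - {j}. d j (\<sigma> i))"
        by (intro sum.cong) auto
      finally show ?thesis by (simp add: sum.distrib)
    qed
    also have "\<dots> = (\<Sum>j\<in>I. ln (r j) + (\<Sum>i\<in>I - {j}. d j (\<sigma> i)))"
      by (simp add: sum.distrib)
    \<comment> \<open>As \<open>i\<close> runs over the rows other than \<open>j\<close>,
      \<open>\<sigma> i\<close> runs over all columns but \<open>\<sigma> j\<close>. Of these,
      \<open>r j - 1\<close> lie in \<open>E j\<close> and lower the degree of row \<open>j\<close>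
      by one; the other \<open>Suc n - r j\<close> leave it unchanged. Together with
      \<open>ln (r j)\<close> the former contribute \<open>ln ((r j)!) = r j * L (r j)\<close>,
      which completes the total to \<open>Suc n * L (r j)\<close>.\<close>
    also have "\<dots> = (\<Sum>j\<in>I. real (Suc n) * L (r j))"
    proof (intro sum.cong refl)
      fix j assume j: "j \<in> I"
      have fJ: "finite J" by fact
      have sj: "\<sigma> j \<in> E j \<inter> J" by (rule mem[OF \<sigma> j])
      then obtain m where m: "r j = Suc m"
        using fJ by (metis card_gt_0_iff finite_Int empty_iff r_def gr0_implies_Suc)
      have cJ: "card J = Suc n" using bij_betw_same_card[OF bij] Suc by simp
      have rle: "r j \<le> Suc n" unfolding r_def cJ[symmetric] by (intro card_mono fJ) auto
      have "(\<Sum>i\<in>I - {j}. d j (\<sigma> i)) = (\<Sum>k\<in>J - {\<sigma> j}. d j k)"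
        using bij_betw_DiffI[OF bij, of "{j}" "{\<sigma> j}"] j sj
        by (intro sum.reindex_bij_betw) (auto simp: bij_betw_def)
      also have "J - {\<sigma> j} = (E j \<inter> J - {\<sigma> j}) \<union> (J - E j)" using sj by auto
      also have "(\<Sum>k\<in>\<dots>. d j k) = (\<Sum>k\<in>E j \<inter> J - {\<sigma> j}. d j k) + (\<Sum>k\<in>J - E j. d j k)"
        using fJ by (intro sum.union_disjoint) auto
      also have "(\<Sum>k\<in>E j \<inter> J - {\<sigma> j}. d j k) = (\<Sum>k\<in>E j \<inter> J - {\<sigma> j}. L m)"
      proof (intro sum.cong refl)
        fix k assume k: "k \<in> E j \<inter> J - {\<sigma> j}"
        have "E j \<inter> (J - {k}) = (E j \<inter> J) - {k}" by auto
        then have "card (E j \<inter> (J - {k})) = m" using k m fJ by (simp add: r_def)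
        then show "d j k = L m" by (simp add: d_def)
      qed
      also have "\<dots> = real m * L m" using sj m fJ by (simp add: r_def)
      also have "real m * L m = ln (fact m)" by (cases "m = 0") (auto simp: L_def)
      also have "(\<Sum>k\<in>J - E j. d j k) = (\<Sum>k\<in>J - E j. L (r j))"
      proof (intro sum.cong refl)
        fix k assume k: "k \<in> J - E j"
        have "E j \<inter> (J - {k}) = (E j \<inter> J)" using k by auto
        then show "d j k = L (r j)" by (simp add: d_def r_def)
      qed
      also have "\<dots> = (real (Suc n) - real (r j)) * L (r j)"
      proof -
        have "card (J - E j) = Suc n - r j"
          using card_Diff_subset_Int[of J "E j"] fJ by (simp add: cJ r_def Int_commute)
        then show ?thesis using rle by (simp add: of_nat_diff)
      qed
      finally have "ln (r j) + (\<Sum>i\<in>I - {j}. d j (\<sigma> i))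
          = (ln (r j) + ln (fact m)) + (real (Suc n) - real (r j)) * L (r j)" by simp
      also have "ln (r j) + ln (fact m) = ln (real (Suc m) * fact m)"
        by (subst ln_mult) (simp_all add: m)
      also have "\<dots> = real (r j) * L (r j)" by (simp add: m L_def)
      finally show "ln (r j) + (\<Sum>i\<in>I - {j}. d j (\<sigma> i)) = real (Suc n) * L (r j)"
        by (simp add: algebra_simps)
    qed
    finally show ?thesis by (simp add: sum_distrib_left)
  qed
  have "real (Suc n) * (p * ln p) = (\<Sum>i\<in>I. p * ln p)" using Suc by simp
  also have "\<dots> \<le> (\<Sum>i\<in>I. \<Sum>\<sigma>\<in>S. ln (r i) + ln (pk i (\<sigma> i)))"
    by (intro sum_mono row)
  also have "\<dots> = (\<Sum>\<sigma>\<in>S. \<Sum>i\<in>I. ln (r i) + ln (pk i (\<sigma> i)))" by (rule sum.swap)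
  also have "\<dots> \<le> (\<Sum>\<sigma>\<in>S. real (Suc n) * (\<Sum>j\<in>I. L (r j)))" by (intro sum_mono per_matching)
  also have "\<dots> = real (Suc n) * (p * (\<Sum>j\<in>I. L (r j)))" by (simp add: p_def)
  finally have "p * ln p \<le> p * (\<Sum>j\<in>I. L (r j))" by (simp del: of_nat_Suc)
  then have "ln p \<le> (\<Sum>j\<in>I. L (r j))" using p by simp
  then show ?case by (simp add: p_def S_def L_def r_def)
qed

section \<open>Factorisation of complex polynomials and a log-concavity bound\<close>

lemma coeff_1_mult: "coeff (p * q) (Suc 0) = coeff p 0 * coeff q 1 + coeff p 1 * coeff q 0"
  for p q :: "'a::comm_semiring_1 poly"
  by (simp add: coeff_mult)

lemma coeff_prod_linear:
  fixes r :: "'b \<Rightarrow> 'a::comm_ring_1"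
  assumes "finite A"
  shows "coeff (\<Prod>k\<in>A. [:1, r k:]) 0 = 1" "coeff (\<Prod>k\<in>A. [:1, r k:]) 1 = (\<Sum>k\<in>A. r k)"
  using assms
proof (induction A rule: finite_induct)
  case (insert x F)
  { case 1 then show ?case using insert by (simp add: coeff_mult) }
  { case 2 then show ?case using insert by (simp add: coeff_1_mult del: mult_pCons_left mult_pCons_right) }
qed auto

text \<open>Normalising by \<open>p(0)\<close> exhibits the logarithmic derivative at 0 as minus the
  sum of the reciprocal roots. Both the capacity inequality and the preservation of stability use it
  to turn the location of the roots into information on the linear coefficient.\<close>

lemma complex_poly_normalized_decomp:
  fixes p :: "complex poly"
  assumes "poly p 0 \<noteq> 0"
  obtains root where "\<And>k. k < degree p \<Longrightarrow> poly p (root k) = 0" "\<And>k. k < degree p \<Longrightarrow> root k \<noteq> 0"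
    "\<And>t. poly p t = poly p 0 * (\<Prod>k<degree p. 1 - t / root k)"
    "coeff p 1 = poly p 0 * (\<Sum>k<degree p. - 1 / root k)"
proof -
  obtain root where root: "smult (lead_coeff p) (\<Prod>i<degree p. [:-root i, 1:]) = p"
    using complex_poly_decompose' by blast
  have p_eq: "poly p t = lead_coeff p * (\<Prod>i<degree p. t - root i)" for t
    by (subst root[symmetric]) (simp add: poly_prod)
  have zero: "poly p (root k) = 0" if "k < degree p" for k
    unfolding p_eq using that by (auto intro!: prod_zero)
  have nz: "root k \<noteq> 0" if "k < degree p" for k
    using zero[OF that] assms by metis
  have norm: "poly p t = poly p 0 * (\<Prod>k<degree p. 1 - t / root k)" for t
  proof -
    have "(\<Prod>k<degree p. t - root k) = (\<Prod>k<degree p. (0 - root k) * (1 - t / root k))"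
      using nz by (intro prod.cong) (auto simp: field_simps)
    then show ?thesis unfolding p_eq by (simp only: prod.distrib mult.assoc)
  qed
  have "p = smult (poly p 0) (\<Prod>k<degree p. [:1, - 1 / root k:])"
  proof (rule poly_ext)
    fix t show "poly p t = poly (smult (poly p 0) (\<Prod>k<degree p. [:1, - 1 / root k:])) t"
      by (subst norm) (simp add: poly_prod)
  qed
  then have "coeff p 1 = coeff (smult (poly p 0) (\<Prod>k<degree p. [:1, - 1 / root k:])) 1" by (rule arg_cong)
  also have "\<dots> = poly p 0 * (\<Sum>k<degree p. - 1 / root k)"
    by (simp only: coeff_smult coeff_prod_linear[OF finite_lessThan])
  finally show ?thesis using that zero nz norm by blast
qed

text \<open>The conjugate of the principal square root \<open>s\<close> of \<open>z\<close> works: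
  \<open>cnj s * z = |s|\<^sup>2 * s\<close>, and \<open>Re s > 0\<close> because \<open>z\<close>
  avoids the closed negative axis.\<close>

lemma rotate_to_right_half_plane:
  assumes "z \<notin> \<real>\<^sub>\<le>\<^sub>0"
  obtains c where "Re c > 0" "Re (c * z) > 0"
proof -
  define s where "s = csqrt z"
  have s: "Re s > 0"
  proof (rule ccontr)
    assume "\<not> Re s > 0"
    then have "Re s = 0" using Re_csqrt[of z] by (simp add: s_def)
    then have "s\<^sup>2 = of_real (- (Im s)\<^sup>2)"
      by (simp add: complex_eq_iff power2_eq_square)
    then have "z = of_real (- (Im s)\<^sup>2)" by (simp add: s_def)
    then show False using assms by (metis neg_le_0_iff_le nonpos_Reals_of_real_iff zero_le_power2)
  qed
  have "cnj s * z = cnj s * s\<^sup>2" by (simp add: s_def)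
  also have "\<dots> = (s * cnj s) * s" by (simp add: power2_eq_square)
  also have "s * cnj s = of_real ((cmod s)\<^sup>2)" using complex_norm_square[of s] by simp
  finally have "Re (cnj s * z) = (cmod s)\<^sup>2 * Re s" by simp
  also have "\<dots> > 0" using s by (intro mult_pos_pos) auto
  finally show ?thesis using s by (intro that[of "cnj s"]) auto
qed

text \<open>Nonpositive roots give \<open>G t = G 0 * (\<Prod>k. 1 + t / \<rho> k)\<close> with
  positive \<open>\<rho> k\<close>, and \<open>1 + x \<le> exp x\<close>. In other words
  \<open>ln G\<close> is concave and lies below its tangent at 0.\<close>

lemma real_rooted_log_concave:
  fixes p :: "complex poly"
  assumes pos: "\<And>t. t \<ge> 0 \<Longrightarrow> poly p (of_real t) = of_real (G t)" "\<And>t. t \<ge> 0 \<Longrightarrow> G t > 0"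
    and roots: "\<And>r. poly p r = 0 \<Longrightarrow> r \<in> \<real>\<^sub>\<le>\<^sub>0"
    and c1: "coeff p 1 = of_real G1" and t: "t \<ge> 0"
  shows "G t \<le> G 0 * exp (t * (G1 / G 0))"
proof -
  have p0: "poly p 0 = of_real (G 0)" using pos(1)[of 0] by simp
  have G0: "G 0 > 0" by (rule pos(2)) simp
  then have p0_nz: "poly p 0 \<noteq> 0" using p0 by simp
  obtain root where root: "\<And>k. k < degree p \<Longrightarrow> poly p (root k) = 0" "\<And>k. k < degree p \<Longrightarrow> root k \<noteq> 0"
    "\<And>t. poly p t = poly p 0 * (\<Prod>k<degree p. 1 - t / root k)"
    "coeff p 1 = poly p 0 * (\<Sum>k<degree p. - 1 / root k)"
    using complex_poly_normalized_decomp[OF p0_nz] by blast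
  have real: "\<exists>\<rho>>0. root k = - of_real \<rho>" if k: "k < degree p" for k
  proof -
    obtain x where x: "root k = of_real x" "x \<le> 0"
      using roots[OF root(1)[OF k]] by (auto elim: nonpos_Reals_cases)
    then have "- x > 0" using root(2)[OF k] by auto
    then show ?thesis using x by (intro exI[of _ "- x"]) auto
  qed
  then obtain \<rho> where \<rho>: "\<And>k. k < degree p \<Longrightarrow> \<rho> k > 0 \<and> root k = - of_real (\<rho> k)" by metis
  have "(\<Sum>k<degree p. - 1 / root k) = (\<Sum>k<degree p. of_real (1 / \<rho> k))"
    using \<rho> by (intro sum.cong) auto
  then have "of_real G1 = (of_real (G 0 * (\<Sum>k<degree p. 1 / \<rho> k)) :: complex)"
    using root(4) c1 p0 by simp
  then have G1: "G1 / G 0 = (\<Sum>k<degree p. 1 / \<rho> k)" using G0 unfolding of_real_eq_iff by simp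
  have "(\<Prod>k<degree p. 1 - of_real t / root k) = (\<Prod>k<degree p. of_real (1 + t / \<rho> k))"
    using \<rho> by (intro prod.cong) auto
  then have "of_real (G t) = (of_real (G 0 * (\<Prod>k<degree p. 1 + t / \<rho> k)) :: complex)"
    using root(3)[of "of_real t"] pos(1)[OF t] p0 by simp
  then have "G t = G 0 * (\<Prod>k<degree p. 1 + t / \<rho> k)" unfolding of_real_eq_iff .
  also have "\<dots> \<le> G 0 * (\<Prod>k<degree p. exp (t / \<rho> k))"
    using G0 \<rho> t by (intro mult_left_mono prod_mono) (auto intro!: add_nonneg_nonneg divide_nonneg_nonneg simp: less_imp_le)
  also have "(\<Prod>k<degree p. exp (t / \<rho> k)) = exp (t * (G1 / G 0))"
    by (simp add: G1 exp_sum sum_distrib_left)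
  finally show ?thesis .
qed

section \<open>Gurvits' capacity method for permanents\<close>

abbreviation bijections :: "'i set \<Rightarrow> nat \<Rightarrow> ('i \<Rightarrow> nat) set" where
  "bijections I n \<equiv> perfect_matchings I {1..n} (\<lambda>_. UNIV)"

text \<open>Strict positivity makes every linear form nonzero on the half-plane and every monomial
  coefficient positive, on which the stability and positivity arguments rest. Matrices with zero
  entries are reached by a limit in \<open>regular_matchings_ge\<close>.\<close>

locale positive_matrix =
  fixes I :: "'i set" and n :: nat and a :: "'i \<Rightarrow> nat \<Rightarrow> real"
  assumes finI: "finite I" and cardI: "card I = n"
    and a_pos: "\<And>i j. i \<in> I \<Longrightarrow> j \<in> {1..n} \<Longrightarrow> a i j > 0"
begin

text \<open>A choice of one variable from each linear form; the condition selects the monomials in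
  which \<open>z\<^sub>m\<^sub>+\<^sub>1, \<dots>, z\<^sub>n\<close> all have exponent one.\<close>

definition hits :: "nat \<Rightarrow> ('i \<Rightarrow> nat) set" where
  "hits m = {g \<in> I \<rightarrow>\<^sub>E {1..n}. \<forall>j\<in>{m<..n}. card {i\<in>I. g i = j} = 1}"

text \<open>\<open>Q m\<close> is the coefficient of \<open>z\<^sub>m\<^sub>+\<^sub>1 \<cdots> z\<^sub>n\<close> in \<open>\<Prod>\<^sub>i \<Sum>\<^sub>j a\<^sub>i\<^sub>j z\<^sub>j\<close>, as a polynomial in \<open>z\<^sub>1, \<dots>, z\<^sub>m\<close>.\<close>

definition Q :: "nat \<Rightarrow> (nat \<Rightarrow> 'c::real_normed_field) \<Rightarrow> 'c" where
  "Q m z = (\<Sum>g\<in>hits m. of_real (\<Prod>i\<in>I. a i (g i)) * (\<Prod>i | i \<in> I \<and> g i \<le> m. z (g i)))"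

lemma finite_hits: "finite (hits m)"
  unfolding hits_def using finI by (auto intro!: finite_subset[OF Collect_restrict] finite_PiE)

lemma hits_range: "g i \<in> {1..n}" if "g \<in> hits m" "i \<in> I"
  using that by (auto simp: hits_def PiE_def)

lemma card_hits:
  assumes "g \<in> hits m" "m \<le> n"
  shows "card {i \<in> I. g i \<le> m} = m"
proof -
  have "card I = card {i \<in> I. g i \<le> m} + card {i \<in> I. g i \<in> {m<..n}}"
    using finI hits_range[OF assms(1)]
    by (subst card_Un_disjoint[symmetric]) (auto intro!: arg_cong[where f = card])
  also have "{i \<in> I. g i \<in> {m<..n}} = (\<Union>j\<in>{m<..n}. {i \<in> I. g i = j})" by auto
  also have "card \<dots> = (\<Sum>j\<in>{m<..n}. card {i \<in> I. g i = j})"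
    using finI by (intro card_UN_disjoint) auto
  also have "\<dots> = n - m" using assms(1) by (simp add: hits_def)
  finally show ?thesis using cardI assms(2) by simp
qed

lemma Q_cong: "Q m z = Q m z'" if "\<And>j. j \<in> {1..m} \<Longrightarrow> z j = z' j"
  unfolding Q_def using hits_range that
  by (intro sum.cong arg_cong2[where f = "(*)"] prod.cong refl) (fastforce simp: Suc_le_eq)

lemma Q_of_real: "Q m (\<lambda>j. of_real (x j)) = of_real (Q m x)"
  unfolding Q_def by simp

lemma Q_homogeneous: "Q m (\<lambda>j. c * z j) = c ^ m * Q m z" if "m \<le> n"
  using that by (simp add: Q_def sum_distrib_left prod.distrib card_hits mult_ac)

lemma coeff_pos: "(\<Prod>i\<in>I. a i (g i)) > 0" if "g \<in> hits m"
  using hits_range[OF that] a_pos by (intro prod_pos) auto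

lemma Q_line_poly:
  assumes "m \<le> n"
  obtains p :: "'c::real_normed_field poly" where "degree p \<le> m" "coeff p m = Q m u" "\<And>s. poly p s = Q m (\<lambda>j. w j + s * u j)"
proof -
  define F where "F g = (\<Prod>i | i \<in> I \<and> g i \<le> m. [:w (g i), u (g i):])" for g :: "'i \<Rightarrow> nat"
  define p where "p = (\<Sum>g\<in>hits m. smult (of_real (\<Prod>i\<in>I. a i (g i))) (F g))"
  have F_aux: "degree (\<Prod>i\<in>A. [:w (g i), u (g i):]) \<le> card A
     \<and> coeff (\<Prod>i\<in>A. [:w (g i), u (g i):]) (card A) = (\<Prod>i\<in>A. u (g i))"
    if "finite A" for A and g :: "'i \<Rightarrow> nat"
    using that
  proof (induction A rule: finite_induct)
    case (insert x A)
    have "degree ([:w (g x), u (g x):] * (\<Prod>i\<in>A. [:w (g i), u (g i):])) \<le> 1 + card A"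
      using insert by (intro order.trans[OF degree_mult_le] add_mono) auto
    moreover have "coeff (\<Prod>i\<in>A. [:w (g i), u (g i):]) (Suc (card A)) = 0"
      using insert by (intro coeff_eq_0) auto
    ultimately show ?case using insert by simp
  qed auto
  have F: "degree (F g) \<le> m" "coeff (F g) m = (\<Prod>i | i \<in> I \<and> g i \<le> m. u (g i))" if "g \<in> hits m" for g
    using F_aux[of "{i. i \<in> I \<and> g i \<le> m}" g] finI card_hits[OF that assms] by (auto simp: F_def)
  show ?thesis
  proof (rule that[of p])
    show "degree p \<le> m" unfolding p_def
      using F(1) by (intro degree_sum_le finite_hits order.trans[OF degree_smult_le]) auto
    show "coeff p m = Q m u" unfolding p_def Q_def coeff_sum coeff_smult
      using F(2) by (intro sum.cong) auto
    show "poly p s = Q m (\<lambda>j. w j + s * u j)" for s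
      by (simp add: p_def F_def Q_def poly_sum poly_prod)
  qed
qed

text \<open>The engine of the descent: \<open>Q m\<close> is the derivative of
  \<open>Q (Suc m)\<close> in its last variable at 0. The exponent of that variable in the term of
  \<open>g\<close> is the number of rows choosing column \<open>Suc m\<close>, and exponent one is
  exactly what puts \<open>g\<close> into \<open>hits m\<close>.\<close>

lemma Q_last_variable:
  assumes "Suc m \<le> n"
  obtains p :: "'c::real_normed_field poly" where "\<And>t. poly p t = Q (Suc m) (z(Suc m := t))" "coeff p 1 = Q m z"
proof -
  define cnt where "cnt g = card {i \<in> I. g i = Suc m}" for g :: "'i \<Rightarrow> nat"
  define c where "c g = of_real (\<Prod>i\<in>I. a i (g i)) * (\<Prod>i | i \<in> I \<and> g i \<le> m. z (g i))" for g
  define p where "p = (\<Sum>g\<in>hits (Suc m). monom (c g) (cnt g))"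
  show ?thesis
  proof (rule that[of p])
    fix t
    have "(\<Prod>i | i \<in> I \<and> g i \<le> Suc m. (z(Suc m := t)) (g i)) = (\<Prod>i | i \<in> I \<and> g i \<le> m. z (g i)) * t ^ cnt g" for g
    proof -
      have "{i. i \<in> I \<and> g i \<le> Suc m} = {i. i \<in> I \<and> g i \<le> m} \<union> {i \<in> I. g i = Suc m}" by auto
      then have "(\<Prod>i | i \<in> I \<and> g i \<le> Suc m. (z(Suc m := t)) (g i))
          = (\<Prod>i | i \<in> I \<and> g i \<le> m. (z(Suc m := t)) (g i)) * (\<Prod>i | i \<in> I \<and> g i = Suc m. (z(Suc m := t)) (g i))"
        using finI by (simp only:) (intro prod.union_disjoint, auto)
      then show ?thesis by (simp add: cnt_def)
    qed
    then show "poly p t = Q (Suc m) (z(Suc m := t))"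
      by (simp add: p_def Q_def poly_sum poly_monom c_def mult.assoc)
  next
    have "hits m \<subseteq> hits (Suc m)" by (auto simp: hits_def)
    moreover have "cnt g = 1 \<longleftrightarrow> g \<in> hits m" if "g \<in> hits (Suc m)" for g
    proof -
      have "{m<..n} = insert (Suc m) {Suc m<..n}" using assms by auto
      then show ?thesis using that by (auto simp: hits_def cnt_def)
    qed
    ultimately have "{g \<in> hits (Suc m). cnt g = 1} = hits m" by auto
    then show "coeff p 1 = Q m z" 
      unfolding p_def Q_def coeff_sum coeff_monom c_def[symmetric]
      by (subst sum.inter_filter[symmetric]) (simp_all add: finite_hits)
  qed
qed

text \<open>H-stability, with the open right half-plane as reference region.\<close>

definition stable :: "nat \<Rightarrow> bool" where
  "stable m \<longleftrightarrow> (\<forall>z::nat \<Rightarrow> complex. (\<forall>j\<in>{1..m}. Re (z j) > 0) \<longrightarrow> Q m z \<noteq> 0)"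

text \<open>By homogeneity a common factor \<open>c\<close> changes the value only by
  \<open>c^m\<close>, so stability extends to all points whose coordinates lie in one open
  half-plane with 0 on its boundary.\<close>

lemma stable_rotate:
  assumes "stable m" "m \<le> n" "\<And>j. j \<in> {1..m} \<Longrightarrow> Re (c * z j) > 0"
  shows "Q m z \<noteq> (0::complex)"
proof
  assume "Q m z = 0"
  then have "Q m (\<lambda>j. c * z j) = 0" using assms(2) by (simp add: Q_homogeneous)
  moreover have "Q m (\<lambda>j. c * z j) \<noteq> 0"
    using assms(1,3) by (intro assms(1)[unfolded stable_def, rule_format])
  ultimately show False by simp
qed

text \<open>Along the line \<open>Im z + s * Re z\<close> all zeros are real: at a zero
  \<open>r\<close> with \<open>Im r \<noteq> 0\<close>, the factor \<open>- \<i> * Im r\<close>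
  would move the point into the right half-plane. The value at \<open>s = - \<i>\<close> is
  \<open>Q m z\<close> up to a unit, the leading coefficient is \<open>Q m (Re z)\<close>, and
  \<open>- \<i>\<close> has distance at least 1 from every real root.\<close>

lemma stable_norm_ge_interior:
  assumes m: "m \<le> n" and st: "stable m" and z: "\<And>j. j \<in> {1..m} \<Longrightarrow> Re (z j) > 0"
  shows "Q m (\<lambda>j. Re (z j)) \<le> norm (Q m z)"
proof -
  define X :: complex where "X = Q m (\<lambda>j. of_real (Re (z j)))"
  have X: "X = of_real (Q m (\<lambda>j. Re (z j)))" by (simp add: X_def Q_of_real)
  obtain p :: "complex poly" where p: "degree p \<le> m" "coeff p m = X"
    "\<And>s. poly p s = Q m (\<lambda>j. of_real (Im (z j)) + s * of_real (Re (z j)))"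
    unfolding X_def
    using Q_line_poly[OF m, of "\<lambda>j. of_real (Re (z j))" "\<lambda>j. of_real (Im (z j))"] by blast
  have "X \<noteq> 0" using st z unfolding stable_def X_def by simp
  then have deg: "degree p = m" using p by (metis le_antisym le_degree)
  have root: "Im r = 0" if "poly p r = 0" for r
  proof (rule ccontr)
    assume r: "Im r \<noteq> 0"
    have "Q m (\<lambda>j. of_real (Im (z j)) + r * of_real (Re (z j))) \<noteq> 0"
    proof (rule stable_rotate[OF st m, where c = "- \<i> * of_real (Im r)"])
      fix j assume j: "j \<in> {1..m}"
      have "Re (- \<i> * of_real (Im r) * (of_real (Im (z j)) + r * of_real (Re (z j)))) = (Im r)\<^sup>2 * Re (z j)"
        by (simp add: power2_eq_square)
      also have "\<dots> > 0" using z[OF j] r by (intro mult_pos_pos) auto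
      finally show "Re (- \<i> * of_real (Im r) * (of_real (Im (z j)) + r * of_real (Re (z j)))) > 0" .
    qed
    then show False using that p(3) by simp
  qed
  obtain \<rho> where \<rho>: "smult (lead_coeff p) (\<Prod>i<degree p. [:-\<rho> i, 1:]) = p"
    by (rule complex_poly_decompose')
  have p_eq: "poly p t = X * (\<Prod>i<m. t - \<rho> i)" for t
    by (subst \<rho>[symmetric]) (simp add: poly_prod deg p(2))
  have "norm (Q m z) = norm (Q m (\<lambda>j. \<i> * (of_real (Im (z j)) + (- \<i>) * of_real (Re (z j)))))"
    by (intro arg_cong[where f = norm] Q_cong) (simp add: complex_eq_iff)
  also have "\<dots> = norm (poly p (- \<i>))" unfolding Q_homogeneous[OF m] p(3) by (simp add: norm_mult norm_power)
  also have "\<dots> = norm X * (\<Prod>i<m. norm (- \<i> - \<rho> i))" by (simp add: p_eq norm_mult prod_norm)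
  also have "(\<Prod>i<m. norm (- \<i> - \<rho> i)) \<ge> (\<Prod>i<m. 1)"
  proof (intro prod_mono conjI)
    fix i assume i: "i \<in> {..<m}"
    have "poly p (\<rho> i) = 0" unfolding p_eq using i by (auto intro!: prod_zero)
    then have "Im (\<rho> i) = 0" by (rule root)
    then show "norm (- \<i> - \<rho> i) \<ge> 1" using abs_Im_le_cmod[of "- \<i> - \<rho> i"] by simp
  qed auto
  then have "norm X * (\<Prod>i<m. norm (- \<i> - \<rho> i)) \<ge> norm X * 1" by (intro mult_left_mono) auto
  finally show ?thesis by (simp add: X)
qed

lemma stable_norm_ge:
  assumes m: "m \<le> n" and st: "stable m" and z: "\<And>j. j \<in> {1..m} \<Longrightarrow> Re (z j) \<ge> 0"
  shows "Q m (\<lambda>j. Re (z j)) \<le> norm (Q m z)"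
proof (rule tendsto_le)
  have "((\<lambda>\<delta>::real. norm (Q m (\<lambda>j. z j + of_real \<delta>))) \<longlongrightarrow> norm (Q m (\<lambda>j. z j + of_real 0))) (at_right 0)"
    unfolding Q_def by (intro tendsto_intros)
  then show "((\<lambda>\<delta>::real. norm (Q m (\<lambda>j. z j + of_real \<delta>))) \<longlongrightarrow> norm (Q m z)) (at_right 0)" by simp
  have "((\<lambda>\<delta>::real. Q m (\<lambda>j. Re (z j) + \<delta>)) \<longlongrightarrow> Q m (\<lambda>j. Re (z j) + 0)) (at_right 0)"
    unfolding Q_def by (intro tendsto_intros)
  then show "((\<lambda>\<delta>::real. Q m (\<lambda>j. Re (z j) + \<delta>)) \<longlongrightarrow> Q m (\<lambda>j. Re (z j))) (at_right 0)" by simp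
  show "\<forall>\<^sub>F \<delta> in at_right 0. Q m (\<lambda>j. Re (z j) + \<delta>) \<le> norm (Q m (\<lambda>j. z j + of_real \<delta>))"
  proof (rule eventually_mono[OF eventually_at_right_less])
    fix \<delta> :: real assume "0 < \<delta>"
    then show "Q m (\<lambda>j. Re (z j) + \<delta>) \<le> norm (Q m (\<lambda>j. z j + of_real \<delta>))"
      using stable_norm_ge_interior[OF m st, of "\<lambda>j. z j + of_real \<delta>"] z by (simp add: add_nonneg_pos)
  qed
qed simp

lemma Q_pos_at_zero:
  assumes m: "m \<ge> 1" "Suc m \<le> n" and x: "\<And>j. j \<in> {1..m} \<Longrightarrow> x j > 0" "x (Suc m) = 0"
  shows "Q (Suc m) x > (0::real)"
proof -
  obtain h where h: "bij_betw h I {1..n}"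
    using finI cardI by (metis bij_betw_iff_card card_atLeastAtMost diff_Suc_1 finite_atLeastAtMost)
  \<comment> \<open>Only columns beyond \<open>Suc m\<close> must be hit exactly once, so the row
    that the bijection \<open>h\<close> sends to \<open>Suc m\<close> may be diverted to column 1,
    which is another column because \<open>m \<ge> 1\<close>. The monomial of \<open>g\<close> then
    avoids the variable that is set to 0.\<close>
  define g where "g = (\<lambda>i\<in>I. if h i = Suc m then 1 else h i)"
  have "card {i \<in> I. g i = j} = 1" if j: "j \<in> {Suc m<..n}" for j
  proof -
    have "j \<in> h ` I" using h j by (auto simp: bij_betw_def)
    then obtain i where i: "i \<in> I" "h i = j" by blast
    have "{i' \<in> I. g i' = j} = {i}"
      using h i j m by (auto simp: g_def bij_betw_def dest: inj_onD split: if_splits)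
    then show ?thesis by simp
  qed
  moreover have "g \<in> I \<rightarrow>\<^sub>E {1..n}"
    using bij_betwE[OF h] m by (auto simp: g_def)
  ultimately have g: "g \<in> hits (Suc m)" by (simp add: hits_def)
  let ?t = "\<lambda>g. of_real (\<Prod>i\<in>I. a i (g i)) * (\<Prod>i | i \<in> I \<and> g i \<le> Suc m. x (g i))"
  have "?t g > 0"
  proof (intro mult_pos_pos prod_pos)
    show "of_real (\<Prod>i\<in>I. a i (g i)) > (0::real)" using coeff_pos[OF g] by simp
    fix i assume "i \<in> {i. i \<in> I \<and> g i \<le> Suc m}"
    moreover from this have "g i \<noteq> Suc m" "g i \<ge> 1"
      using m hits_range[OF g, of i] by (auto simp: g_def split: if_splits)
    ultimately show "x (g i) > 0" by (intro x(1)) auto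
  qed
  moreover have "?t g' \<ge> 0" if g': "g' \<in> hits (Suc m)" for g'
  proof (intro mult_nonneg_nonneg prod_nonneg)
    show "of_real (\<Prod>i\<in>I. a i (g' i)) \<ge> (0::real)" using coeff_pos[OF g'] by simp
    fix i assume "i \<in> {i. i \<in> I \<and> g' i \<le> Suc m}"
    then show "x (g' i) \<ge> 0"
      using hits_range[OF g', of i] x by (cases "g' i = Suc m") (auto intro!: less_imp_le[OF x(1)])
  qed
  ultimately show ?thesis unfolding Q_def by (intro sum_pos2[OF finite_hits g]) auto
qed

text \<open>Gurvits' capacity is the infimum of
  \<open>Q m x / (x\<^sub>1 \<cdots> x\<^sub>m)\<close> over positive \<open>x\<close>; the
  predicate bounds it below without forming the infimum.\<close>

definition capacity_ge :: "nat \<Rightarrow> real \<Rightarrow> bool" where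
  "capacity_ge m C \<longleftrightarrow> (\<forall>x. (\<forall>j\<in>{1..m}. x j > 0) \<longrightarrow> Q m x \<ge> C * (\<Prod>j=1..m. x j))"

lemma Q_update_lower:
  assumes cap: "capacity_ge (Suc m) C" and x: "\<And>j. j \<in> {1..m} \<Longrightarrow> x j > 0" and t: "t > 0"
  shows "C * (\<Prod>j=1..m. x j) * t \<le> Q (Suc m) (x(Suc m := t))"
proof -
  have "\<forall>j\<in>{1..Suc m}. (x(Suc m := t)) j > 0" using x t by (auto simp: le_Suc_eq)
  then have "C * (\<Prod>j=1..Suc m. (x(Suc m := t)) j) \<le> Q (Suc m) (x(Suc m := t))"
    using cap unfolding capacity_ge_def by blast
  moreover have "(\<Prod>j=1..Suc m. (x(Suc m := t)) j) = (\<Prod>j=1..m. x j) * t"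
    by (simp add: prod.nat_ivl_Suc')
  ultimately show ?thesis by (simp add: mult.assoc)
qed

text \<open>Gurvits' capacity descent; the sharp constant \<open>((k-1)/k)\<^sup>k\<^sup>-\<^sup>1\<close> is replaced by \<open>1/e\<close>.\<close>

lemma capacity_descent:
  assumes m: "m \<ge> 1" "Suc m \<le> n" and st: "stable (Suc m)" and cap: "capacity_ge (Suc m) C" and C: "C > 0"
  shows "capacity_ge m (C / exp 1)"
  unfolding capacity_ge_def
proof (intro allI impI)
  fix x :: "nat \<Rightarrow> real" assume x: "\<forall>j\<in>{1..m}. x j > 0"
  define G where "G t = Q (Suc m) (x(Suc m := t))" for t
  define D where "D = C * (\<Prod>j=1..m. x j)"
  have D: "D > 0" unfolding D_def using C x by (intro mult_pos_pos prod_pos) auto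
  obtain p :: "complex poly" where p: "\<And>t. poly p t = Q (Suc m) ((\<lambda>j. of_real (x j))(Suc m := t))"
    "coeff p 1 = Q m (\<lambda>j. of_real (x j))"
    using Q_last_variable[OF m(2), of "\<lambda>j. of_real (x j)"] by blast
  have upd: "(\<lambda>j. of_real (x j))(Suc m := of_real t) = (\<lambda>j. of_real ((x(Suc m := t)) j) :: complex)" for t
    by auto
  have lower: "D * t \<le> G t" if "t > 0" for t
    unfolding D_def G_def using x that by (intro Q_update_lower[OF cap]) auto
  have pos: "G t > 0" if "t \<ge> 0" for t
  proof (cases "t = 0")
    case True
    then show ?thesis unfolding G_def using x m by (intro Q_pos_at_zero) auto
  next
    case False
    then show ?thesis using lower[of t] D that by (intro less_le_trans[OF _ lower]) auto
  qed
  \<comment> \<open>A root off the closed negative axis could be rotated, together with the positive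
    reals \<open>x j\<close>, into the right half-plane, against stability.\<close>
  have roots: "r \<in> \<real>\<^sub>\<le>\<^sub>0" if "poly p r = 0" for r
  proof (rule ccontr)
    assume "r \<notin> \<real>\<^sub>\<le>\<^sub>0"
    then obtain c where c: "Re c > 0" "Re (c * r) > 0" by (rule rotate_to_right_half_plane)
    have "Q (Suc m) ((\<lambda>j. of_real (x j))(Suc m := r)) \<noteq> 0"
      by (rule stable_rotate[OF st m(2), where c = c]) (use c x in \<open>auto simp: le_Suc_eq\<close>)
    then show False using that p(1) by simp
  qed
  have conc: "G t \<le> G 0 * exp (t * (Q m x / G 0))" if "t \<ge> 0" for t
  proof (rule real_rooted_log_concave[of p])
    show "poly p (of_real t) = of_real (G t)" for t
      by (simp only: p(1) upd Q_of_real G_def)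
    show "coeff p 1 = of_real (Q m x)" by (simp only: p(2) Q_of_real)
  qed (use pos roots that in auto)
  have G0: "G 0 > 0" using pos by simp
  \<comment> \<open>Were the linear coefficient not positive, \<open>G\<close> would never exceed
    \<open>G 0\<close>, while the capacity bound forces growth at least
    \<open>D * t\<close>.\<close>
  have Qm: "Q m x > 0"
  proof (rule ccontr)
    assume "\<not> Q m x > 0"
    define t where "t = 2 * G 0 / D"
    have t: "t > 0" using G0 D by (simp add: t_def)
    have "t * (Q m x / G 0) \<le> 0"
      using t G0 \<open>\<not> Q m x > 0\<close> by (intro mult_nonneg_nonpos divide_nonpos_pos) auto
    then have "G 0 * exp (t * (Q m x / G 0)) \<le> G 0 * 1"
      using G0 by (intro mult_left_mono) auto
    then have "G t \<le> G 0" using conc[of t] t by simp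
    moreover have "D * t = 2 * G 0" using D by (simp add: t_def)
    ultimately show False using lower[OF t] G0 by simp
  qed
  \<comment> \<open>The minimiser of \<open>exp (t * Q m x / G 0) / t\<close>, that is, the best
    choice in \<open>D * t \<le> G t\<close>; it produces the loss of a factor
    \<open>e\<close>.\<close>
  define t where "t = G 0 / Q m x"
  have t: "t > 0" using G0 Qm by (simp add: t_def)
  have "D * t \<le> G 0 * exp 1"
    using lower[OF t] conc[of t] t Qm G0 by (simp add: t_def)
  then have "D \<le> Q m x * exp 1" using G0 Qm by (simp add: t_def field_simps)
  then show "C / exp 1 * (\<Prod>j=1..m. x j) \<le> Q m x" by (simp add: D_def field_simps)
qed

text \<open>Works in the spirit of the Gauss-Lucas theorem. Seen as a polynomial \<open>p\<close> in
  the last variable, \<open>Q (Suc m)\<close> has all its zeros strictly to the left, since for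
  \<open>Re t \<ge> 0\<close> its modulus is bounded below by a positive value at real points. So
  every \<open>- 1 / \<rho> k\<close> has positive real part, and the linear coefficient,
  \<open>p(0)\<close> times the sum of these, can vanish only if \<open>p\<close> has no zeros. A
  constant \<open>p\<close> contradicts the linear growth forced by the capacity bound.\<close>

lemma stable_descent:
  assumes m: "m \<ge> 1" "Suc m \<le> n" and st: "stable (Suc m)" and cap: "capacity_ge (Suc m) C" and C: "C > 0"
  shows "stable m"
  unfolding stable_def
proof (intro allI impI notI)
  fix z :: "nat \<Rightarrow> complex" assume z: "\<forall>j\<in>{1..m}. Re (z j) > 0" and Qz: "Q m z = 0"
  define x where "x j = Re (z j)" for j
  define D where "D = C * (\<Prod>j=1..m. x j)"
  have D: "D > 0" unfolding D_def x_def using C z by (intro mult_pos_pos prod_pos) auto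
  obtain p :: "complex poly" where p: "\<And>t. poly p t = Q (Suc m) (z(Suc m := t))" "coeff p 1 = Q m z"
    using Q_last_variable[OF m(2), of z] by blast
  have ge: "Q (Suc m) (x(Suc m := Re t)) \<le> norm (poly p t)" if "Re t \<ge> 0" for t
  proof -
    have "(\<lambda>j. Re ((z(Suc m := t)) j)) = x(Suc m := Re t)" by (auto simp: x_def)
    moreover have "Re ((z(Suc m := t)) j) \<ge> 0" if "j \<in> {1..Suc m}" for j
      using z that \<open>Re t \<ge> 0\<close> by (auto simp: le_Suc_eq less_imp_le)
    ultimately show ?thesis
      using stable_norm_ge[OF m(2) st, of "z(Suc m := t)"] by (simp only: p(1))
  qed
  have "Q (Suc m) (x(Suc m := 0)) > 0"
    using z m by (intro Q_pos_at_zero) (auto simp: x_def)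
  then have nz: "poly p t \<noteq> 0" if "Re t = 0" for t using ge[of t] that by auto
  have root: "Re r < 0" if r: "poly p r = 0" for r
  proof (rule ccontr)
    assume "\<not> Re r < 0"
    then have "Re r > 0" using nz r by force
    moreover from this have "D * Re r \<le> Q (Suc m) (x(Suc m := Re r))"
      unfolding D_def using z by (intro Q_update_lower[OF cap]) (auto simp: x_def)
    ultimately have "norm (poly p r) \<ge> D * Re r" "D * Re r > 0" using ge[of r] D by auto
    then show False using r by simp
  qed
  have p0: "poly p 0 \<noteq> 0" by (rule nz) simp
  obtain \<rho> where \<rho>: "\<And>k. k < degree p \<Longrightarrow> poly p (\<rho> k) = 0" "\<And>k. k < degree p \<Longrightarrow> \<rho> k \<noteq> 0"
    "\<And>t. poly p t = poly p 0 * (\<Prod>k<degree p. 1 - t / \<rho> k)"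
    "coeff p 1 = poly p 0 * (\<Sum>k<degree p. - 1 / \<rho> k)"
    using complex_poly_normalized_decomp[OF p0] by blast
  have "(\<Sum>k<degree p. - 1 / \<rho> k) = 0" using \<rho>(4) p(2) Qz p0 by simp
  then have sum0: "(\<Sum>k<degree p. Re (- 1 / \<rho> k)) = 0" by (metis Re_sum zero_complex.simps(1))
  have "Re (- 1 / \<rho> k) > 0" if k: "k < degree p" for k
  proof -
    have "Re (- 1 / \<rho> k) = - Re (\<rho> k) / (cmod (\<rho> k))\<^sup>2"
      by (simp add: Re_divide cmod_power2)
    also have "\<dots> > 0" using root[OF \<rho>(1)[OF k]] \<rho>(2)[OF k] by (intro divide_pos_pos) auto
    finally show ?thesis .
  qed
  then have "degree p = 0"
    using sum_pos[of "{..<degree p}" "\<lambda>k. Re (- 1 / \<rho> k)"] sum0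
    by (cases "degree p = 0") auto
  then have const: "poly p t = poly p 0" for t using \<rho>(3)[of t] by simp
  define t where "t = (norm (poly p 0) + 1) / D"
  have t: "t > 0" using D by (simp add: t_def add_nonneg_pos)
  have "D * t \<le> Q (Suc m) (x(Suc m := t))"
    unfolding D_def using z t by (intro Q_update_lower[OF cap]) (auto simp: x_def)
  also have "\<dots> \<le> norm (poly p 0)" using ge[of "of_real t"] t const[of "of_real t"] by simp
  finally show False using D by (simp add: t_def)
qed

lemma Q_top: "Q n z = (\<Prod>i\<in>I. \<Sum>j=1..n. of_real (a i j) * z j)"
proof -
  have "hits n = I \<rightarrow>\<^sub>E {1..n}" by (simp add: hits_def)
  moreover have "{i \<in> I. g i \<le> n} = I" if "g \<in> I \<rightarrow>\<^sub>E {1..n}" for g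
    using PiE_mem[OF that] by auto
  ultimately have "Q n z = (\<Sum>g\<in>I \<rightarrow>\<^sub>E {1..n}. \<Prod>i\<in>I. of_real (a i (g i)) * z (g i))"
    unfolding Q_def by (simp add: prod.distrib)
  then show ?thesis using finI by (simp add: prod_sum_PiE)
qed

lemma stable_top:
  assumes "n \<ge> 1"
  shows "stable n"
  unfolding stable_def
proof (intro allI impI)
  fix z :: "nat \<Rightarrow> complex" assume z: "\<forall>j\<in>{1..n}. Re (z j) > 0"
  have "Re (\<Sum>j=1..n. of_real (a i j) * z j) > 0" if "i \<in> I" for i
    unfolding Re_sum using z a_pos[OF that] assms by (intro sum_pos) auto
  then have "(\<Sum>j=1..n. of_real (a i j) * z j) \<noteq> 0" if "i \<in> I" for i
    using that by (metis less_irrefl zero_complex.simps(1))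
  then show "Q n z \<noteq> 0" unfolding Q_top using finI by (simp add: prod_zero_iff)
qed

text \<open>Weighted AM-GM in each row: row sums 1 make the entries weights for the concavity of
  \<open>ln\<close>, and column sums 1 collect the logarithms of all rows into
  \<open>\<Prod>j. x j\<close>.\<close>

lemma capacity_top:
  assumes rows: "\<And>i. i \<in> I \<Longrightarrow> (\<Sum>j=1..n. a i j) = 1" and cols: "\<And>j. j \<in> {1..n} \<Longrightarrow> (\<Sum>i\<in>I. a i j) = 1"
    and n: "n \<ge> 1"
  shows "capacity_ge n 1"
  unfolding capacity_ge_def
proof (intro allI impI)
  fix x :: "nat \<Rightarrow> real" assume x: "\<forall>j\<in>{1..n}. x j > 0"
  have pos: "(\<Sum>j=1..n. a i j * x j) > 0" if "i \<in> I" for i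
    using x a_pos[OF that] n by (intro sum_pos) auto
  have "(\<Prod>j=1..n. x j) = exp (\<Sum>j=1..n. ln (x j))"
    using x by (simp add: exp_sum)
  also have "(\<Sum>j=1..n. ln (x j)) = (\<Sum>j=1..n. \<Sum>i\<in>I. a i j * ln (x j))"
    using cols by (simp flip: sum_distrib_right)
  also have "\<dots> = (\<Sum>i\<in>I. \<Sum>j=1..n. a i j * ln (x j))" by (rule sum.swap)
  also have "\<dots> \<le> (\<Sum>i\<in>I. ln (\<Sum>j=1..n. a i j * x j))"
  proof (rule sum_mono)
    fix i assume i: "i \<in> I"
    show "(\<Sum>j=1..n. a i j * ln (x j)) \<le> ln (\<Sum>j=1..n. a i j * x j)"
      using concave_on_sum[OF _ _ ln_concave, of "{1..n}" "a i" x] rows[OF i] a_pos[OF i] x n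
      by (auto simp: less_imp_le)
  qed
  also have "exp \<dots> = (\<Prod>i\<in>I. \<Sum>j=1..n. a i j * x j)"
    using finI pos by (simp add: exp_sum)
  finally show "1 * (\<Prod>j=1..n. x j) \<le> Q n x" by (simp add: Q_top)
qed

lemma permanent_ge:
  assumes rows: "\<And>i. i \<in> I \<Longrightarrow> (\<Sum>j=1..n. a i j) = 1" and cols: "\<And>j. j \<in> {1..n} \<Longrightarrow> (\<Sum>i\<in>I. a i j) = 1"
  shows "exp (- real n) \<le> (\<Sum>\<sigma>\<in>bijections I n. \<Prod>i\<in>I. a i (\<sigma> i))"
proof (cases "n = 0")
  case True
  then have "I = {}" using cardI finI by simp
  then have "bijections I n = {\<lambda>_. undefined}"
    using True by (auto simp: perfect_matchings_def bij_betw_def)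
  then show ?thesis using True \<open>I = {}\<close> by simp
next
  case False
  have desc: "stable (n - k) \<and> capacity_ge (n - k) (exp (- real k))" if "k < n" for k
    using that
  proof (induction k)
    case 0
    then show ?case using stable_top capacity_top[OF rows cols] by simp
  next
    case (Suc k)
    define m where "m = n - Suc k"
    have m: "n - k = Suc m" "m \<ge> 1" "Suc m \<le> n" using Suc.prems by (auto simp: m_def)
    have "stable (Suc m)" "capacity_ge (Suc m) (exp (- real k))" using Suc m by auto
    with stable_descent[OF m(2,3) this] capacity_descent[OF m(2,3) this]
    have "stable m \<and> capacity_ge m (exp (- real k) / exp 1)" by simp
    moreover have "exp (- real k) / exp 1 = exp (- real (Suc k))"
      by (simp add: algebra_simps flip: exp_diff)
    ultimately show ?case by (simp add: m_def)
  qed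
  \<comment> \<open>The descent stops at one variable because each step needs
    \<open>m \<ge> 1\<close>. By then columns 2 to \<open>n\<close> are hit once each, which leaves
    exactly one row for column 1, so \<open>Q 1\<close> at the point 1 is already the
    permanent.\<close>
  have hits1: "hits 1 = bijections I n"
  proof (intro equalityI subsetI)
    fix g assume g: "g \<in> hits 1"
    have "{1..n} \<subseteq> g ` I"
    proof
      fix j assume j: "j \<in> {1..n}"
      have "card {i \<in> I. g i = j} = 1"
      proof (cases "j = 1")
        case True
        have "{i \<in> I. g i = j} = {i \<in> I. g i \<le> 1}" using hits_range[OF g] True by force
        then show ?thesis using card_hits[OF g] False by simp
      next
        case False
        then show ?thesis using g j by (simp add: hits_def)
      qed
      then have "{i \<in> I. g i = j} \<noteq> {}" by (metis card.empty zero_neq_one)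
      then show "j \<in> g ` I" by auto
    qed
    then have im: "g ` I = {1..n}" using hits_range[OF g] by auto
    then have "inj_on g I" using finI cardI by (intro eq_card_imp_inj_on) auto
    then show "g \<in> bijections I n"
      using g im by (auto simp: perfect_matchings_def bij_betw_def hits_def PiE_def)
  next
    fix g assume "g \<in> bijections I n"
    then have g: "g \<in> extensional I" "bij_betw g I {1..n}" by (auto simp: perfect_matchings_def)
    have "card {i \<in> I. g i = j} = 1" if "j \<in> {1..n}" for j
    proof -
      have "j \<in> g ` I" using g(2) that by (auto simp: bij_betw_def)
      then obtain i where i: "i \<in> I" "g i = j" by blast
      then have "{i' \<in> I. g i' = j} = {i}" using g(2) by (auto simp: bij_betw_def dest: inj_onD)
      then show ?thesis by simp
    qed
    then show "g \<in> hits 1" using g bij_betwE[OF g(2)] by (auto simp: hits_def PiE_def)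
  qed
  have "capacity_ge 1 (exp (- real (n - 1)))" using desc[of "n - 1"] False by simp
  from this[unfolded capacity_ge_def, rule_format, of "\<lambda>_. 1"]
  have "exp (- real (n - 1)) \<le> Q 1 (\<lambda>_. 1::real)" by simp
  also have "\<dots> = (\<Sum>\<sigma>\<in>bijections I n. \<Prod>i\<in>I. a i (\<sigma> i))"
    by (simp add: Q_def hits1[unfolded One_nat_def])
  finally show ?thesis by (elim order.trans[rotated]) simp
qed

end

text \<open>The permanent bound for the 0/1 matrix divided by \<open>k\<close>. Adding \<epsilon>
  and dividing by \<open>k + n * \<epsilon>\<close> keeps row and column sums 1 while making all
  entries positive; then \<epsilon> tends to 0. Against the sharp constant \<open>n! / n^n\<close>
  only a polynomial factor is lost.\<close>

theorem regular_matchings_ge: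
  fixes E :: "'i \<Rightarrow> nat set"
  assumes I: "finite I" "card I = n" and k: "k \<ge> 1"
    and rows: "\<And>i. i \<in> I \<Longrightarrow> card (E i \<inter> {1..n}) = k"
    and cols: "\<And>j. j \<in> {1..n} \<Longrightarrow> card {i \<in> I. j \<in> E i} = k"
  shows "(k / exp 1) ^ n \<le> card (perfect_matchings I {1..n} E)"
proof -
  let ?M = "bijections I n"
  define b where "b i j = (if j \<in> E i then 1 else 0 :: real)" for i j
  define a where "a \<epsilon> i j = (b i j + \<epsilon>) / (real k + real n * \<epsilon>)" for \<epsilon> i j
  have finM: "finite ?M" using I by (intro finite_perfect_matchings) auto
  have ge: "exp (- real n) \<le> (\<Sum>\<sigma>\<in>?M. \<Prod>i\<in>I. a \<epsilon> i (\<sigma> i))" if \<epsilon>: "\<epsilon> > 0" for \<epsilon>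
  proof -
    have den: "real k + real n * \<epsilon> > 0" using k \<epsilon> by (intro add_pos_nonneg) auto
    interpret positive_matrix I n "a \<epsilon>"
      by standard (use I \<epsilon> den in \<open>auto simp: a_def b_def intro!: divide_pos_pos\<close>)
    show ?thesis
    proof (rule permanent_ge)
      fix i assume i: "i \<in> I"
      have "(\<Sum>j=1..n. b i j) = k"
        using rows[OF i] by (simp add: b_def sum.If_cases Int_commute)
      then show "(\<Sum>j=1..n. a \<epsilon> i j) = 1"
        using den by (simp add: a_def sum.distrib flip: sum_divide_distrib)
    next
      fix j assume j: "j \<in> {1..n}"
      have "(\<Sum>i\<in>I. b i j) = k"
        using cols[OF j] I by (simp add: b_def sum.If_cases Int_def conj_commute)
      then show "(\<Sum>i\<in>I. a \<epsilon> i j) = 1"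
        using den I by (simp add: a_def sum.distrib flip: sum_divide_distrib)
    qed
  qed
  have "((\<lambda>\<epsilon>. \<Sum>\<sigma>\<in>?M. \<Prod>i\<in>I. a \<epsilon> i (\<sigma> i)) \<longlongrightarrow> (\<Sum>\<sigma>\<in>?M. \<Prod>i\<in>I. a 0 i (\<sigma> i))) (at_right 0)"
    unfolding a_def using k by (intro tendsto_intros) auto
  moreover have "\<forall>\<^sub>F \<epsilon> in at_right 0. exp (- real n) \<le> (\<Sum>\<sigma>\<in>?M. \<Prod>i\<in>I. a \<epsilon> i (\<sigma> i))"
    by (rule eventually_mono[OF eventually_at_right_less]) (rule ge)
  ultimately have "exp (- real n) \<le> (\<Sum>\<sigma>\<in>?M. \<Prod>i\<in>I. a 0 i (\<sigma> i))"
    by (intro tendsto_lowerbound) auto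
  also have "\<dots> = (\<Sum>\<sigma>\<in>?M. if \<sigma> \<in> perfect_matchings I {1..n} E then 1 / real k ^ n else 0)"
  proof (intro sum.cong refl)
    fix \<sigma> assume \<sigma>: "\<sigma> \<in> ?M"
    show "(\<Prod>i\<in>I. a 0 i (\<sigma> i)) = (if \<sigma> \<in> perfect_matchings I {1..n} E then 1 / real k ^ n else 0)"
    proof (cases "\<forall>i\<in>I. \<sigma> i \<in> E i")
      case True
      then have "(\<Prod>i\<in>I. a 0 i (\<sigma> i)) = (\<Prod>i\<in>I. 1 / real k)"
        by (intro prod.cong) (auto simp: a_def b_def)
      then show ?thesis using True \<sigma> I by (simp add: perfect_matchings_def power_one_over)
    next
      case False
      then have "(\<Prod>i\<in>I. a 0 i (\<sigma> i)) = 0" using I by (intro prod_zero) (auto simp: a_def b_def)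
      then show ?thesis using False by (auto simp: perfect_matchings_def)
    qed
  qed
  also have "\<dots> = real (card (perfect_matchings I {1..n} E)) / real k ^ n"
  proof -
    have "?M \<inter> perfect_matchings I {1..n} E = perfect_matchings I {1..n} E"
      by (auto simp: perfect_matchings_def)
    then show ?thesis using finM by (simp add: sum.If_cases)
  qed
  finally have "real k ^ n * exp (- real n) \<le> card (perfect_matchings I {1..n} E)"
    using k by (simp add: field_simps)
  moreover have "exp (- real n) = 1 / exp 1 ^ n"
    using exp_of_nat_mult[of n "1::real"] by (simp add: exp_minus inverse_eq_divide)
  ultimately show ?thesis by (simp add: power_divide)
qed

section \<open>Lipschitz functions of independent permutations\<close>

hide_const (open) Finite_Cartesian_Product.transpose

definition average :: "'a set \<Rightarrow> ('a \<Rightarrow> real) \<Rightarrow> real" where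
  "average A f = (\<Sum>x\<in>A. f x) / card A"

lemma average_mono: "(\<And>x. x \<in> A \<Longrightarrow> f x \<le> g x) \<Longrightarrow> average A f \<le> average A g"
  unfolding average_def by (intro divide_right_mono sum_mono) auto

lemma average_cong: "(\<And>x. x \<in> A \<Longrightarrow> f x = g x) \<Longrightarrow> average A f = average A g"
  unfolding average_def by (auto intro!: sum.cong arg_cong2[where f = "(/)"])

lemma average_const: "finite A \<Longrightarrow> A \<noteq> {} \<Longrightarrow> average A (\<lambda>_. c) = c"
  by (simp add: average_def)

lemma average_add: "average A (\<lambda>x. f x + g x) = average A f + average A g"
  by (simp add: average_def sum.distrib add_divide_distrib)

lemma average_diff: "average A (\<lambda>x. f x - g x) = average A f - average A g"
  by (simp add: average_def sum_subtractf diff_divide_distrib)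

lemma average_cmult: "average A (\<lambda>x. c * f x) = c * average A f"
  by (simp add: average_def sum_distrib_left)

lemma average_multc: "average A (\<lambda>x. f x * c) = average A f * c"
  by (simp add: average_def sum_distrib_right)

lemma average_sum: "average A (\<lambda>x. \<Sum>i\<in>B. f i x) = (\<Sum>i\<in>B. average A (f i))"
  unfolding average_def by (subst sum.swap) (simp add: sum_divide_distrib)

lemma abs_average_diff_le:
  assumes "finite A" "A \<noteq> {}" "\<And>x. x \<in> A \<Longrightarrow> \<bar>f x - g x\<bar> \<le> c"
  shows "\<bar>average A f - average A g\<bar> \<le> c"
proof -
  have "average A (\<lambda>x. f x - g x) \<le> average A (\<lambda>_. c)" "average A (\<lambda>x. g x - f x) \<le> average A (\<lambda>_. c)"
    using assms(3) by (auto intro!: average_mono simp: abs_le_iff)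
  then show ?thesis using assms(1,2) by (simp add: average_const average_diff abs_le_iff)
qed

section \<open>Exponential moments over permutations and lists of permutations\<close>

lemma exp_le_quadratic:
  fixes x :: real
  assumes "\<bar>x\<bar> \<le> 1"
  shows "exp x \<le> 1 + x + x\<^sup>2"
proof (cases "x \<ge> 0")
  case True
  then show ?thesis using assms exp_bound by simp
next
  case False
  define y where "y = - x"
  have y: "y > 0" using False by (simp add: y_def)
  have q: "1 + y + y\<^sup>2 / 2 \<le> exp y" using exp_lower_Taylor_quadratic[of y] y by simp
  \<comment> \<open>The goal is \<open>exp (- y) \<le> 1 - y + y\<^sup>2\<close>; it suffices that
    the right side times the quadratic Taylor lower bound of \<open>exp y\<close> is at least
    1.\<close>
  have "1 \<le> (1 - y + y\<^sup>2) * (1 + y + y\<^sup>2 / 2)"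
  proof -
    have "(1 - y + y\<^sup>2) * (1 + y + y\<^sup>2 / 2) = 1 + y\<^sup>2 / 2 + y ^ 3 / 2 + y ^ 4 / 2"
      by (simp add: power2_eq_square power3_eq_cube power4_eq_xxxx field_simps)
    then show ?thesis using y by simp
  qed
  also have "\<dots> \<le> (1 - y + y\<^sup>2) * exp y"
  proof (rule mult_left_mono[OF q])
    have "1 - y + y\<^sup>2 = (y - 1)\<^sup>2 + y" by (simp add: power2_eq_square algebra_simps)
    also have "\<dots> \<ge> 0" using y by (intro add_nonneg_nonneg) auto
    finally show "0 \<le> 1 - y + y\<^sup>2" .
  qed
  finally have "exp (- y) \<le> 1 - y + y\<^sup>2" by (simp add: exp_minus field_simps)
  then show ?thesis by (simp add: y_def)
qed

lemma average_exp_le: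
  assumes A: "finite A" "A \<noteq> {}" and M: "M \<le> 1"
    and osc: "\<And>x y. x \<in> A \<Longrightarrow> y \<in> A \<Longrightarrow> \<bar>f x - f y\<bar> \<le> M"
  shows "average A (\<lambda>x. exp (f x)) \<le> exp (average A f + M\<^sup>2)"
proof -
  define \<mu> where "\<mu> = average A f"
  have dev: "\<bar>f x - \<mu>\<bar> \<le> M" if "x \<in> A" for x
    using abs_average_diff_le[OF A, of "\<lambda>_. f x" f M] osc[OF that] A by (simp add: average_const \<mu>_def)
  have "average A (\<lambda>x. exp (f x)) \<le> average A (\<lambda>x. exp \<mu> * (1 + (f x - \<mu>) + M\<^sup>2))"
  proof (rule average_mono)
    fix x assume x: "x \<in> A"
    have "(f x - \<mu>)\<^sup>2 \<le> M\<^sup>2" using power_mono[OF dev[OF x], of 2] by simp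
    then have "exp (f x - \<mu>) \<le> 1 + (f x - \<mu>) + M\<^sup>2"
      using exp_le_quadratic[of "f x - \<mu>"] dev[OF x] M by simp
    then have "exp \<mu> * exp (f x - \<mu>) \<le> exp \<mu> * (1 + (f x - \<mu>) + M\<^sup>2)" by (intro mult_left_mono) auto
    then show "exp (f x) \<le> exp \<mu> * (1 + (f x - \<mu>) + M\<^sup>2)" by (simp flip: exp_add)
  qed
  also have "\<dots> = exp \<mu> * (1 + M\<^sup>2)"
    using A by (simp add: average_cmult average_add average_diff average_const \<mu>_def)
  also have "\<dots> \<le> exp \<mu> * exp (M\<^sup>2)" by (intro mult_left_mono exp_ge_add_one_self) auto
  finally show ?thesis by (simp add: \<mu>_def exp_add)
qed

abbreviation perms :: "'a set \<Rightarrow> ('a \<Rightarrow> 'a) set" where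
  "perms S \<equiv> {\<pi>. \<pi> permutes S}"

lemma perms_nonempty: "perms S \<noteq> {}"
  using permutes_id by blast

lemma average_const_perms: "finite S \<Longrightarrow> average (perms S) (\<lambda>_. c) = c"
  by (rule average_const[OF finite_permutations perms_nonempty])

text \<open>As \<open>q\<close> fixes \<open>a\<close>, the index \<open>b\<close> is the image of
  \<open>a\<close>: this conditions a uniform permutation on one of its values.\<close>

lemma average_perms_insert:
  assumes "finite S" "a \<notin> S"
  shows "average (perms (insert a S)) f = average (insert a S) (\<lambda>b. average (perms S) (\<lambda>q. f (transpose a b \<circ> q)))"
proof -
  have "card (perms (insert a S)) = card (insert a S) * card (perms S)"
    using assms by (simp add: card_permutations)
  moreover have "(\<Sum>\<pi>\<in>perms (insert a S). f \<pi>) = (\<Sum>b\<in>insert a S. \<Sum>q\<in>perms S. f (transpose a b \<circ> q))"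
    using assms by (rule sum_over_permutations_insert)
  ultimately show ?thesis
    unfolding average_def by (simp only: of_nat_mult sum_divide_distrib[symmetric] divide_divide_eq_left mult.commute)
qed

lemma inj_transpose_apply: "inj f \<Longrightarrow> f (transpose x y z) = transpose (f x) (f y) (f z)"
  by (auto simp: Transposition.transpose_def dest: injD)

text \<open>A martingale argument exposing one value at a time. Given the image \<open>b\<close> of
  \<open>a\<close>, the rest is a uniform permutation of \<open>S\<close>, and conjugation by
  \<open>transpose a b\<close> turns a swap inside into a swap outside, so the Lipschitz bound is
  inherited. Different \<open>b\<close> are coupled through the same \<open>q\<close>, each one swap
  away from it, so conditional averages differ by at most \<open>2 * L\<close>.\<close>

lemma average_exp_perms_le:
  fixes L :: real
  assumes "finite S" and L: "0 \<le> L" "2 * L \<le> 1"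
    and lip: "\<And>\<pi> x y. \<pi> \<in> perms S \<Longrightarrow> x \<in> S \<Longrightarrow> y \<in> S \<Longrightarrow> \<bar>f (transpose x y \<circ> \<pi>) - f \<pi>\<bar> \<le> L"
  shows "average (perms S) (\<lambda>\<pi>. exp (f \<pi>)) \<le> exp (average (perms S) f + card S * (2 * L)\<^sup>2)"
  using assms(1) lip
proof (induction S arbitrary: f rule: finite_induct)
  case empty
  then show ?case by (simp add: average_def)
next
  case (insert a S)
  let ?S = "insert a S"
  have fin: "finite (perms S)" using insert.hyps by (simp add: finite_permutations)
  have ext: "q \<in> perms ?S" if "q \<in> perms S" for q
    using that permutes_subset[of q S ?S] by auto
  define m where "m b = average (perms S) (\<lambda>q. f (transpose a b \<circ> q))" for b
  have inner: "average (perms S) (\<lambda>q. exp (f (transpose a b \<circ> q))) \<le> exp (m b + card S * (2 * L)\<^sup>2)"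
    if b: "b \<in> ?S" for b
    unfolding m_def
  proof (rule insert.IH)
    fix q x y assume *: "q \<in> perms S" "x \<in> S" "y \<in> S"
    let ?t = "transpose a b"
    have "?t \<circ> (transpose x y \<circ> q) = transpose (?t x) (?t y) \<circ> (?t \<circ> q)"
    proof (rule HOL.ext)
      fix c show "(?t \<circ> (transpose x y \<circ> q)) c = (transpose (?t x) (?t y) \<circ> (?t \<circ> q)) c"
        using inj_transpose_apply[OF inj_transpose[of a b], of x y "q c"] by (simp only: o_apply)
    qed
    moreover have "?t x \<in> ?S" "?t y \<in> ?S" using * b by (auto simp: Transposition.transpose_def)
    moreover have "?t \<circ> q \<in> perms ?S"
      using permutes_compose[OF ext[OF *(1), simplified] permutes_swap_id[of a ?S b]] b by simp
    ultimately show "\<bar>f (?t \<circ> (transpose x y \<circ> q)) - f (?t \<circ> q)\<bar> \<le> L"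
      using insert.prems by metis
  qed
  have osc: "\<bar>m b - m b'\<bar> \<le> 2 * L" if "b \<in> ?S" "b' \<in> ?S" for b b'
    unfolding m_def
  proof (rule abs_average_diff_le[OF fin perms_nonempty])
    fix q assume q: "q \<in> perms S"
    have "\<bar>f (transpose a b \<circ> q) - f q\<bar> \<le> L" "\<bar>f (transpose a b' \<circ> q) - f q\<bar> \<le> L"
      using that ext[OF q] by (auto intro!: insert.prems)
    then show "\<bar>f (transpose a b \<circ> q) - f (transpose a b' \<circ> q)\<bar> \<le> 2 * L" by linarith
  qed
  have "average (perms ?S) (\<lambda>\<pi>. exp (f \<pi>)) = average ?S (\<lambda>b. average (perms S) (\<lambda>q. exp (f (transpose a b \<circ> q))))"
    by (rule average_perms_insert) (use insert in auto)
  also have "\<dots> \<le> average ?S (\<lambda>b. exp (m b + card S * (2 * L)\<^sup>2))"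
    by (intro average_mono inner)
  also have "\<dots> = average ?S (\<lambda>b. exp (m b)) * exp (card S * (2 * L)\<^sup>2)"
    by (simp add: exp_add average_multc)
  also have "\<dots> \<le> exp (average ?S m + (2 * L)\<^sup>2) * exp (card S * (2 * L)\<^sup>2)"
    using L insert.hyps osc by (intro mult_right_mono average_exp_le) auto
  also have "average ?S m = average (perms ?S) f"
    unfolding m_def by (rule average_perms_insert[symmetric]) (use insert in auto)
  finally show ?case using insert.hyps by (simp add: algebra_simps flip: exp_add)
qed

definition perm_lists :: "'a set \<Rightarrow> nat \<Rightarrow> ('a \<Rightarrow> 'a) list set" where
  "perm_lists S l = {xs. length xs = l \<and> set xs \<subseteq> perms S}"

lemma finite_perm_lists: "finite S \<Longrightarrow> finite (perm_lists S l)"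
  using finite_lists_length_eq[of "perms S" l] by (simp add: perm_lists_def finite_permutations conj_commute)

lemma card_perm_lists: "finite S \<Longrightarrow> card (perm_lists S l) = fact (card S) ^ l"
  using card_lists_length_eq[of "perms S" l]
  by (simp add: perm_lists_def finite_permutations card_permutations conj_commute)

lemma perm_lists_nonempty: "perm_lists S l \<noteq> {}"
proof -
  have "replicate l id \<in> perm_lists S l" by (auto simp: perm_lists_def permutes_id)
  then show ?thesis by blast
qed

lemma perm_lists_Suc: "perm_lists S (Suc l) = (\<lambda>(x, xs). x # xs) ` (perms S \<times> perm_lists S l)"
  by (force simp: perm_lists_def length_Suc_conv)

lemma average_perm_lists_Suc:
  assumes "finite S"
  shows "average (perm_lists S (Suc l)) f = average (perms S) (\<lambda>x. average (perm_lists S l) (\<lambda>xs. f (x # xs)))"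
proof -
  have "(\<Sum>xs\<in>perm_lists S (Suc l). f xs) = (\<Sum>x\<in>perms S. \<Sum>xs\<in>perm_lists S l. f (x # xs))"
    unfolding perm_lists_Suc by (subst sum.reindex) (auto simp: inj_on_def sum.cartesian_product case_prod_unfold)
  then show ?thesis
    using assms by (simp add: average_def card_perm_lists card_permutations sum_divide_distrib[symmetric])
qed

definition swap_lipschitz :: "'a set \<Rightarrow> nat \<Rightarrow> real \<Rightarrow> (('a \<Rightarrow> 'a) list \<Rightarrow> real) \<Rightarrow> bool" where
  "swap_lipschitz S l L f \<longleftrightarrow> (\<forall>xs\<in>perm_lists S l. \<forall>i<l. \<forall>x\<in>S. \<forall>y\<in>S.
     \<bar>f (xs[i := transpose x y \<circ> xs ! i]) - f xs\<bar> \<le> L)"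

text \<open>Tensorisation: averaging out the other permutations leaves a function \<open>m\<close>
  of the first with the same Lipschitz constant. The exponents add, one
  \<open>(2 * L)\<^sup>2\<close> for each of the \<open>l * card S\<close> exposed values.\<close>

lemma average_exp_perm_lists_le:
  fixes L :: real
  assumes "finite S" and L: "0 \<le> L" "2 * L \<le> 1" and "swap_lipschitz S l L f"
  shows "average (perm_lists S l) (\<lambda>xs. exp (f xs)) \<le> exp (average (perm_lists S l) f + real l * card S * (2 * L)\<^sup>2)"
  using assms(4)
proof (induction l arbitrary: f)
  case 0
  have "perm_lists S 0 = {[]}" by (auto simp: perm_lists_def)
  then show ?case by (simp add: average_def)
next
  case (Suc l)
  define m where "m x = average (perm_lists S l) (\<lambda>xs. f (x # xs))" for x
  note lip = Suc.prems[unfolded swap_lipschitz_def, rule_format]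
  have cons: "x # xs \<in> perm_lists S (Suc l)" if "x \<in> perms S" "xs \<in> perm_lists S l" for x xs
    using that by (auto simp: perm_lists_def)
  have inner: "average (perm_lists S l) (\<lambda>xs. exp (f (x # xs))) \<le> exp (m x + real l * card S * (2 * L)\<^sup>2)"
    if x: "x \<in> perms S" for x
    unfolding m_def
  proof (rule Suc.IH)
    show "swap_lipschitz S l L (\<lambda>xs. f (x # xs))"
      unfolding swap_lipschitz_def using lip[OF cons[OF x], of _ "Suc i" for i] by auto
  qed
  have "average (perm_lists S (Suc l)) (\<lambda>xs. exp (f xs)) = average (perms S) (\<lambda>x. average (perm_lists S l) (\<lambda>xs. exp (f (x # xs))))"
    using assms(1) by (rule average_perm_lists_Suc)
  also have "\<dots> \<le> average (perms S) (\<lambda>x. exp (m x + real l * card S * (2 * L)\<^sup>2))"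
    by (intro average_mono inner)
  also have "\<dots> = average (perms S) (\<lambda>x. exp (m x)) * exp (real l * card S * (2 * L)\<^sup>2)"
    by (simp add: exp_add average_multc)
  also have "\<dots> \<le> exp (average (perms S) m + card S * (2 * L)\<^sup>2) * exp (real l * card S * (2 * L)\<^sup>2)"
  proof (intro mult_right_mono average_exp_perms_le assms)
    fix \<pi> x y assume *: "\<pi> \<in> perms S" "x \<in> S" "y \<in> S"
    show "\<bar>m (transpose x y \<circ> \<pi>) - m \<pi>\<bar> \<le> L"
      unfolding m_def
    proof (rule abs_average_diff_le[OF finite_perm_lists[OF assms(1)] perm_lists_nonempty])
      fix xs assume "xs \<in> perm_lists S l"
      then show "\<bar>f ((transpose x y \<circ> \<pi>) # xs) - f (\<pi> # xs)\<bar> \<le> L"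
        using lip[OF cons[OF *(1)], of xs 0 x y] * by simp
    qed
  qed auto
  also have "average (perms S) m = average (perm_lists S (Suc l)) f"
    unfolding m_def using assms(1) by (rule average_perm_lists_Suc[symmetric])
  finally show ?case by (simp add: algebra_simps flip: exp_add)
qed

lemma perm_lists_lower_tail:
  fixes L t \<mu> :: real
  assumes S: "finite S" and L: "L > 0" and lip: "swap_lipschitz S l L f"
    and t: "t \<ge> 0" "t \<le> 4 * real l * card S * L" and l: "l > 0" "card S > 0"
    and \<mu>: "\<mu> \<le> average (perm_lists S l) f"
  shows "card {xs \<in> perm_lists S l. f xs \<le> \<mu> - t}
     \<le> fact (card S) ^ l * exp (- (t\<^sup>2 / (16 * real l * card S * L\<^sup>2)))"
proof -
  define N where "N = real l * real (card S)"
  have N: "N > 0" using l by (simp add: N_def)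
  \<comment> \<open>The minimiser of
    \<open>4 * N * L\<^sup>2 * \<theta>\<^sup>2 - t * \<theta>\<close>, the exponent of the Chernoff
    bound. The upper bound assumed for \<open>t\<close> is exactly
    \<open>2 * \<theta> * L \<le> 1\<close>, as the moment bound demands.\<close>
  define \<theta> where "\<theta> = t / (8 * N * L\<^sup>2)"
  define A where "A = perm_lists S l"
  define B where "B = {xs \<in> A. f xs \<le> \<mu> - t}"
  have \<theta>: "\<theta> \<ge> 0" using t N L by (simp add: \<theta>_def)
  have finA: "finite A" and A: "A \<noteq> {}" and cA: "real (card A) = fact (card S) ^ l"
    unfolding A_def using S by (auto simp: finite_perm_lists perm_lists_nonempty card_perm_lists)
  have "2 * (\<theta> * L) = t / (4 * N * L)" using L N by (simp add: \<theta>_def power2_eq_square field_simps)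
  also have "\<dots> \<le> 1" using t L N by (simp add: N_def field_simps)
  finally have small: "2 * (\<theta> * L) \<le> 1" .
  have lip': "swap_lipschitz S l (\<theta> * L) (\<lambda>xs. - \<theta> * f xs)"
    unfolding swap_lipschitz_def
  proof (intro ballI allI impI)
    fix xs i x y assume *: "xs \<in> perm_lists S l" "i < l" "x \<in> S" "y \<in> S"
    have "\<bar>- \<theta> * f (xs[i := transpose x y \<circ> xs ! i]) - - \<theta> * f xs\<bar> = \<theta> * \<bar>f (xs[i := transpose x y \<circ> xs ! i]) - f xs\<bar>"
      using \<theta> by (simp add: abs_mult flip: right_diff_distrib) (simp add: abs_minus_commute)
    also have "\<dots> \<le> \<theta> * L"
      using lip * \<theta> unfolding swap_lipschitz_def by (intro mult_left_mono) auto
    finally show "\<bar>- \<theta> * f (xs[i := transpose x y \<circ> xs ! i]) - - \<theta> * f xs\<bar> \<le> \<theta> * L" .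
  qed
  have "card B * exp (- \<theta> * (\<mu> - t)) \<le> (\<Sum>xs\<in>A. exp (- \<theta> * f xs))"
  proof -
    have "card B * exp (- \<theta> * (\<mu> - t)) = (\<Sum>xs\<in>B. exp (- \<theta> * (\<mu> - t)))" by simp
    also have "\<dots> \<le> (\<Sum>xs\<in>B. exp (- \<theta> * f xs))"
      unfolding B_def using \<theta> by (intro sum_mono) (auto intro: mult_left_mono)
    also have "\<dots> \<le> (\<Sum>xs\<in>A. exp (- \<theta> * f xs))"
      using finA by (intro sum_mono2) (auto simp: B_def)
    finally show ?thesis .
  qed
  also have "\<dots> = card A * average A (\<lambda>xs. exp (- \<theta> * f xs))" using finA A by (simp add: average_def)
  also have "\<dots> \<le> card A * exp (average A (\<lambda>xs. - \<theta> * f xs) + real l * card S * (2 * (\<theta> * L))\<^sup>2)"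
    unfolding A_def using \<theta> L small lip'
    by (intro mult_left_mono average_exp_perm_lists_le S) auto
  also have "\<dots> \<le> card A * exp (- \<theta> * \<mu> + N * (2 * (\<theta> * L))\<^sup>2)"
    using \<mu> \<theta> by (intro mult_left_mono) (auto simp: average_cmult[of _ "- \<theta>", simplified] N_def A_def intro: mult_left_mono)
  finally have "card B * exp (- \<theta> * (\<mu> - t)) * exp (\<theta> * (\<mu> - t))
     \<le> card A * exp (- \<theta> * \<mu> + N * (2 * (\<theta> * L))\<^sup>2) * exp (\<theta> * (\<mu> - t))"
    by (intro mult_right_mono) auto
  then have "card B \<le> card A * exp (- \<theta> * \<mu> + N * (2 * (\<theta> * L))\<^sup>2 + \<theta> * (\<mu> - t))"
    by (simp add: mult.assoc flip: exp_add)
  also have "- \<theta> * \<mu> + N * (2 * (\<theta> * L))\<^sup>2 + \<theta> * (\<mu> - t) = - (t\<^sup>2 / (16 * N * L\<^sup>2))"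
    using N L by (simp add: \<theta>_def power2_eq_square field_simps)
  finally show ?thesis by (simp add: B_def A_def[symmetric] cA N_def mult.assoc)
qed

section \<open>Tuples of distinct elements under a random permutation\<close>

definition dlists :: "'a set \<Rightarrow> nat \<Rightarrow> 'a list set" where
  "dlists S k = {xs. length xs = k \<and> distinct xs \<and> set xs \<subseteq> S}"

lemma finite_dlists: "finite S \<Longrightarrow> finite (dlists S k)"
  unfolding dlists_def by (rule finite_subset[OF _ finite_lists_length_eq[of S k]]) auto

lemma map_perm_dlists: "\<pi> permutes S \<Longrightarrow> xs \<in> dlists S k \<Longrightarrow> map \<pi> xs \<in> dlists S k"
  by (auto simp: dlists_def distinct_map permutes_in_image inj_on_def dest: permutes_inj injD)

lemma ex_perm_dlists:
  assumes "xs \<in> dlists S k" "ys \<in> dlists S k"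
  shows "\<exists>\<sigma>. \<sigma> permutes S \<and> map \<sigma> xs = ys"
  using assms
proof (induction k arbitrary: xs ys)
  case 0
  then show ?case by (auto simp: dlists_def intro: permutes_id)
next
  case (Suc k)
  obtain x xs' y ys' where xs: "xs = x # xs'" and ys: "ys = y # ys'"
    using Suc.prems by (auto simp: dlists_def length_Suc_conv)
  then have "xs' \<in> dlists S k" "ys' \<in> dlists S k" using Suc.prems by (auto simp: dlists_def)
  then obtain \<sigma> where \<sigma>: "\<sigma> permutes S" "map \<sigma> xs' = ys'" using Suc.IH by blast
  have xy: "x \<in> S" "y \<in> S" "x \<notin> set xs'" "y \<notin> set ys'" using Suc.prems by (auto simp: dlists_def xs ys)
  let ?\<tau> = "transpose (\<sigma> x) y \<circ> \<sigma>"
  have "?\<tau> permutes S"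
    using \<sigma>(1) xy by (intro permutes_compose permutes_swap_id) (auto simp: permutes_in_image)
  moreover have "?\<tau> z = \<sigma> z" if "z \<in> set xs'" for z
  proof -
    have "\<sigma> z \<noteq> \<sigma> x" using that xy permutes_inj[OF \<sigma>(1)] by (auto dest: injD)
    moreover have "\<sigma> z \<noteq> y" using that xy \<sigma>(2) by auto
    ultimately show ?thesis by (simp add: Transposition.transpose_def)
  qed
  then have "map ?\<tau> xs = ys" using \<sigma>(2) by (auto simp: xs ys)
  ultimately show ?case by blast
qed

lemma sum_perms_comp:
  assumes "\<sigma> permutes S"
  shows "(\<Sum>\<pi>\<in>perms S. f (\<sigma> \<circ> \<pi>)) = (\<Sum>\<pi>\<in>perms S. f \<pi>)"
  using setum_permutations_compose_left[OF assms, of f] by simp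

text \<open>Permutations act transitively on tuples of distinct elements, and composing with a fixed
  one preserves the uniform distribution, so all values of \<open>map \<pi> ps\<close> are equally
  likely.\<close>

lemma average_map_perm:
  assumes S: "finite S" and ps: "ps \<in> dlists S k" and Q: "Q \<subseteq> dlists S k"
  shows "average (perms S) (\<lambda>\<pi>. of_bool (map \<pi> ps \<in> Q)) = card Q / card (dlists S k)"
proof -
  define h where "h q = average (perms S) (\<lambda>\<pi>. of_bool (map \<pi> ps = q))" for q
  have h_eq: "h q = h ps" if q: "q \<in> dlists S k" for q
  proof -
    obtain \<sigma> where \<sigma>: "\<sigma> permutes S" "map \<sigma> ps = q" using ex_perm_dlists[OF ps q] by blast
    have "h q = average (perms S) (\<lambda>\<pi>. of_bool (map (\<sigma> \<circ> \<pi>) ps = q))"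
      unfolding h_def average_def by (subst sum_perms_comp[OF \<sigma>(1)]) simp
    also have "\<dots> = h ps"
    proof -
      have "map (\<sigma> \<circ> \<pi>) ps = q \<longleftrightarrow> map \<pi> ps = ps" for \<pi>
        using permutes_inj[OF \<sigma>(1)] by (simp flip: \<sigma>(2) map_map add: inj_map_eq_map)
      then show ?thesis by (simp add: h_def)
    qed
    finally show ?thesis .
  qed
  have sum_h: "average (perms S) (\<lambda>\<pi>. of_bool (map \<pi> ps \<in> Q)) = card Q * h ps" if "Q \<subseteq> dlists S k" for Q
  proof -
    have fin: "finite Q" using finite_subset[OF that finite_dlists[OF S]] .
    have "average (perms S) (\<lambda>\<pi>. of_bool (map \<pi> ps \<in> Q)) = average (perms S) (\<lambda>\<pi>. \<Sum>q\<in>Q. of_bool (map \<pi> ps = q))"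
      using fin by (intro average_cong) (simp add: of_bool_def)
    also have "\<dots> = (\<Sum>q\<in>Q. h q)" by (simp add: average_sum h_def)
    also have "\<dots> = (\<Sum>q\<in>Q. h ps)" using that by (intro sum.cong h_eq) auto
    finally show ?thesis by simp
  qed
  have "average (perms S) (\<lambda>\<pi>. of_bool (map \<pi> ps \<in> dlists S k)) = average (perms S) (\<lambda>_. 1)"
    by (intro average_cong) (simp add: map_perm_dlists ps)
  also have "\<dots> = 1" using S by (simp add: average_const_perms)
  finally have "card (dlists S k) * h ps = 1" using sum_h[of "dlists S k"] by simp
  moreover from this have "card (dlists S k) \<noteq> 0" by (intro notI) simp
  ultimately have "h ps = 1 / card (dlists S k)" by (simp add: field_simps)
  then show ?thesis by (simp add: sum_h[OF Q])
qed

text \<open>Common frame of the first two stages: every random permutation adds to each start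
  \<open>c\<close> an evenly spread set of known size, and the size of the union is to be
  controlled. \<open>lip\<close> bounds only the elements lost under a swap; since swaps are
  involutions, gains are losses of the reverse swap and a two-sided bound results.\<close>

locale random_growth =
  fixes S :: "'a set" and C :: "'c set" and \<Omega> :: "'d set"
    and \<Phi> :: "('a \<Rightarrow> 'a) \<Rightarrow> 'c \<Rightarrow> 'd set" and s :: "'c \<Rightarrow> nat" and L :: real
  assumes finS: "finite S" and finC: "finite C" and fin\<Omega>: "finite \<Omega>"
    and \<Phi>_sub: "\<And>\<pi> c. \<pi> \<in> perms S \<Longrightarrow> c \<in> C \<Longrightarrow> \<Phi> \<pi> c \<subseteq> \<Omega>"
    and card_\<Phi>: "\<And>\<pi> c. \<pi> \<in> perms S \<Longrightarrow> c \<in> C \<Longrightarrow> card (\<Phi> \<pi> c) = s c"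
    and uniform: "\<And>c Q. c \<in> C \<Longrightarrow> Q \<subseteq> \<Omega> \<Longrightarrow>
      average (perms S) (\<lambda>\<pi>. real (card (\<Phi> \<pi> c \<inter> Q))) = s c * card Q / card \<Omega>"
    and lip: "\<And>\<pi> x y. \<pi> \<in> perms S \<Longrightarrow> x \<in> S \<Longrightarrow> y \<in> S \<Longrightarrow>
      (\<Sum>c\<in>C. real (card (\<Phi> \<pi> c - \<Phi> (transpose x y \<circ> \<pi>) c))) \<le> L"
begin

definition U :: "('a \<Rightarrow> 'a) list \<Rightarrow> 'c \<Rightarrow> 'd set" where
  "U xs c = (\<Union>x\<in>set xs. \<Phi> x c)"

definition Z :: "('a \<Rightarrow> 'a) list \<Rightarrow> real" where
  "Z xs = (\<Sum>c\<in>C. real (card (U xs c)))"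

lemma U_sub: "xs \<in> perm_lists S l \<Longrightarrow> c \<in> C \<Longrightarrow> U xs c \<subseteq> \<Omega>"
  using \<Phi>_sub by (fastforce simp: U_def perm_lists_def)

lemma finite_U: "xs \<in> perm_lists S l \<Longrightarrow> c \<in> C \<Longrightarrow> finite (U xs c)"
  using finite_subset[OF U_sub fin\<Omega>] .

lemma card_U_le: "xs \<in> perm_lists S l \<Longrightarrow> c \<in> C \<Longrightarrow> card (U xs c) \<le> l * s c"
proof -
  assume *: "xs \<in> perm_lists S l" "c \<in> C"
  have "card (U xs c) \<le> (\<Sum>x\<in>set xs. card (\<Phi> x c))"
    unfolding U_def by (rule card_UN_le) simp
  also have "\<dots> = card (set xs) * s c" using * card_\<Phi> by (simp add: perm_lists_def subset_iff)
  also have "\<dots> \<le> l * s c" using card_length[of xs] * by (intro mult_right_mono) (auto simp: perm_lists_def)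
  finally show ?thesis .
qed

lemma Z_update_le:
  assumes xs: "xs \<in> perm_lists S l" and i: "i < l" and xy: "x \<in> S" "y \<in> S"
  shows "Z xs \<le> Z (xs[i := transpose x y \<circ> xs ! i]) + L"
proof -
  define \<pi> where "\<pi> = xs ! i"
  define \<pi>' where "\<pi>' = transpose x y \<circ> \<pi>"
  define xs' where "xs' = xs[i := \<pi>']"
  have len: "length xs = l" and \<pi>: "\<pi> permutes S"
    using xs i by (auto simp: perm_lists_def \<pi>_def subset_iff)
  have "\<pi>' permutes S"
    unfolding \<pi>'_def using \<pi> xy by (intro permutes_compose permutes_swap_id)
  then have xs': "xs' \<in> perm_lists S l"
    using xs set_update_subset_insert[of xs i \<pi>'] by (auto simp: perm_lists_def xs'_def)
  have "real (card (U xs c)) \<le> real (card (U xs' c)) + real (card (\<Phi> \<pi> c - \<Phi> \<pi>' c))" if c: "c \<in> C" for c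
  proof -
    have mem: "xs' ! j \<in> set xs'" if "j < l" for j using that len by (simp add: xs'_def)
    have "U xs c \<subseteq> U xs' c \<union> (\<Phi> \<pi> c - \<Phi> \<pi>' c)"
    proof
      fix z assume "z \<in> U xs c"
      then obtain j where j: "j < l" "z \<in> \<Phi> (xs ! j) c"
        using len by (auto simp: U_def in_set_conv_nth)
      show "z \<in> U xs' c \<union> (\<Phi> \<pi> c - \<Phi> \<pi>' c)"
      proof (cases "j = i")
        case True
        have "xs' ! i = \<pi>'" using i len by (simp add: xs'_def)
        then show ?thesis using j mem[of i] i True by (auto simp: U_def \<pi>_def)
      next
        case False
        then have "xs' ! j = xs ! j" by (simp add: xs'_def)
        then show ?thesis using j mem[of j] by (auto simp: U_def)
      qed
    qed
    then have "card (U xs c) \<le> card (U xs' c \<union> (\<Phi> \<pi> c - \<Phi> \<pi>' c))"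
      using finite_U[OF xs' c] finite_subset[OF \<Phi>_sub fin\<Omega>] \<pi> c by (intro card_mono) auto
    also have "\<dots> \<le> card (U xs' c) + card (\<Phi> \<pi> c - \<Phi> \<pi>' c)" by (rule card_Un_le)
    finally show ?thesis by simp
  qed
  then have "Z xs \<le> Z xs' + (\<Sum>c\<in>C. real (card (\<Phi> \<pi> c - \<Phi> \<pi>' c)))"
    unfolding Z_def sum.distrib[symmetric] by (rule sum_mono)
  also have "\<dots> \<le> Z xs' + L" using lip[of \<pi> x y] \<pi> xy by (simp add: \<pi>'_def)
  finally show ?thesis by (simp add: xs'_def \<pi>'_def \<pi>_def)
qed

lemma swap_lipschitz_Z: "swap_lipschitz S l L Z"
  unfolding swap_lipschitz_def
proof (intro ballI allI impI)
  fix xs i x y assume *: "xs \<in> perm_lists S l" "i < l" "x \<in> S" "y \<in> S"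
  let ?xs' = "xs[i := transpose x y \<circ> xs ! i]"
  have \<pi>: "xs ! i permutes S" and len: "length xs = l" using * by (auto simp: perm_lists_def subset_iff)
  have "transpose x y \<circ> xs ! i permutes S"
    using \<pi> * by (intro permutes_compose permutes_swap_id)
  then have xs': "?xs' \<in> perm_lists S l"
    using * set_update_subset_insert[of xs i] by (fastforce simp: perm_lists_def)
  have "transpose x y \<circ> ?xs' ! i = xs ! i" using * len by (simp add: fun_eq_iff)
  then have "?xs'[i := transpose x y \<circ> ?xs' ! i] = xs" by simp
  then show "\<bar>Z ?xs' - Z xs\<bar> \<le> L"
    using Z_update_le[OF *] Z_update_le[OF xs' *(2-4)] by (simp add: abs_le_iff)
qed

text \<open>By \<open>uniform\<close>, a fresh permutation is expected to repeat \<open>s c * card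
  (U xs c) / card \<Omega> \<le> l * (s c)\<^sup>2 / card \<Omega>\<close> of the elements already
  present. Summed over the steps this loss stays below
  \<open>(l * s c)\<^sup>2 / card \<Omega>\<close>.\<close>

lemma average_card_U_ge:
  assumes c: "c \<in> C"
  shows "real l * s c - (real l * s c)\<^sup>2 / card \<Omega> \<le> average (perm_lists S l) (\<lambda>xs. real (card (U xs c)))"
proof (induction l)
  case 0
  have "perm_lists S 0 = {[]}" by (auto simp: perm_lists_def)
  then show ?case by (simp add: average_def U_def)
next
  case (Suc l)
  let ?w = "real (card \<Omega>)"
  note fin = finite_perm_lists[OF finS] 
  have step: "real (card (U xs c)) + s c - card (\<Phi> x c \<inter> U xs c) = real (card (U (x # xs) c))"
    if "x \<in> perms S" "xs \<in> perm_lists S l" for x xs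
  proof -
    have fin\<Phi>: "finite (\<Phi> x c)" using finite_subset[OF \<Phi>_sub fin\<Omega>] that c by blast
    have "U (x # xs) c = \<Phi> x c \<union> U xs c" by (simp add: U_def)
    then show ?thesis
      using card_Un_Int[OF fin\<Phi> finite_U[OF that(2) c]] card_\<Phi>[OF that(1) c] by simp
  qed
  have "average (perms S) (\<lambda>x. average (perm_lists S l) (\<lambda>xs. real (card (\<Phi> x c \<inter> U xs c))))
      = average (perm_lists S l) (\<lambda>xs. average (perms S) (\<lambda>x. real (card (\<Phi> x c \<inter> U xs c))))"
    unfolding average_def by (simp add: sum_divide_distrib[symmetric]) (subst sum.swap, simp add: mult.commute)
  also have "\<dots> = average (perm_lists S l) (\<lambda>xs. s c * card (U xs c) / ?w)"
    using U_sub[OF _ c] by (intro average_cong uniform c) auto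
  also have "\<dots> \<le> average (perm_lists S l) (\<lambda>xs. s c * (l * s c) / ?w)"
    using card_U_le[OF _ c] by (intro average_mono divide_right_mono mult_left_mono) (auto simp flip: of_nat_mult)
  also have "\<dots> = l * (real (s c))\<^sup>2 / ?w"
    using finS by (simp add: average_const fin perm_lists_nonempty power2_eq_square)
  finally have ov: "average (perms S) (\<lambda>x. average (perm_lists S l) (\<lambda>xs. real (card (\<Phi> x c \<inter> U xs c))))
     \<le> l * (real (s c))\<^sup>2 / ?w" .
  have "average (perm_lists S (Suc l)) (\<lambda>xs. real (card (U xs c)))
      = average (perms S) (\<lambda>x. average (perm_lists S l) (\<lambda>xs. real (card (U (x # xs) c))))"
    by (rule average_perm_lists_Suc[OF finS])
  also have "\<dots> = average (perms S) (\<lambda>x. average (perm_lists S l)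
      (\<lambda>xs. real (card (U xs c)) + s c - card (\<Phi> x c \<inter> U xs c)))"
    by (intro average_cong step[symmetric])
  also have "\<dots> = average (perm_lists S l) (\<lambda>xs. real (card (U xs c))) + s c
      - average (perms S) (\<lambda>x. average (perm_lists S l) (\<lambda>xs. real (card (\<Phi> x c \<inter> U xs c))))"
    using finS by (simp add: average_diff average_add average_const average_const_perms fin perm_lists_nonempty)
  finally have main: "(real l * s c - (real l * s c)\<^sup>2 / ?w) + s c - l * (real (s c))\<^sup>2 / ?w
     \<le> average (perm_lists S (Suc l)) (\<lambda>xs. real (card (U xs c)))"
    using Suc.IH ov by linarith
  have sq: "(real (Suc l) * s c)\<^sup>2 / ?w = (real l * s c)\<^sup>2 / ?w + 2 * (l * (real (s c))\<^sup>2 / ?w) + (real (s c))\<^sup>2 / ?w"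
    by (simp add: power2_eq_square algebra_simps add_divide_distrib)
  have lin: "real (Suc l) * s c = real l * s c + s c" by (simp add: algebra_simps)
  have arith: "T + x - (X + 2 * Y + V) \<le> M" if "T - X + x - Y \<le> M" "Y \<ge> 0" "V \<ge> 0" for T x X Y V M :: real
    using that by linarith
  show ?case by (subst sq, subst lin, rule arith[OF main]) auto
qed

lemma average_Z_ge:
  "(\<Sum>c\<in>C. real l * s c - (real l * s c)\<^sup>2 / card \<Omega>) \<le> average (perm_lists S l) Z"
  unfolding Z_def average_sum by (intro sum_mono average_card_U_ge)

end

lemma card_touching_le:
  assumes S: "finite S" and \<phi>: "\<phi> permutes S" and T: "T \<subseteq> S"
  shows "card {c \<in> dlists S 2. set (map \<phi> c) \<inter> T \<noteq> {}} \<le> 2 * card T * card S"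
proof -
  have finT: "finite T" using S T by (rule rev_finite_subset)
  have "{c \<in> dlists S 2. set (map \<phi> c) \<inter> T \<noteq> {}}
      \<subseteq> (\<lambda>(t, u). [inv \<phi> t, u]) ` (T \<times> S) \<union> (\<lambda>(t, u). [u, inv \<phi> t]) ` (T \<times> S)"
  proof
    fix c assume "c \<in> {c \<in> dlists S 2. set (map \<phi> c) \<inter> T \<noteq> {}}"
    then obtain c1 c2 where c: "c = [c1, c2]" "c1 \<in> S" "c2 \<in> S" "\<phi> c1 \<in> T \<or> \<phi> c2 \<in> T"
      by (auto simp: dlists_def numeral_2_eq_2 length_Suc_conv)
    have "c = [inv \<phi> (\<phi> c1), c2]" "c = [c1, inv \<phi> (\<phi> c2)]"
      using permutes_inverses[OF \<phi>] c by auto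
    then show "c \<in> (\<lambda>(t, u). [inv \<phi> t, u]) ` (T \<times> S) \<union> (\<lambda>(t, u). [u, inv \<phi> t]) ` (T \<times> S)"
      using c(2-4) by (elim disjE) (force simp: image_iff)+
  qed
  then have "card {c \<in> dlists S 2. set (map \<phi> c) \<inter> T \<noteq> {}}
      \<le> card ((\<lambda>(t, u). [inv \<phi> t, u]) ` (T \<times> S) \<union> (\<lambda>(t, u). [u, inv \<phi> t]) ` (T \<times> S))"
    using finT S by (intro card_mono) auto
  also have "\<dots> \<le> card ((\<lambda>(t, u). [inv \<phi> t, u]) ` (T \<times> S)) + card ((\<lambda>(t, u). [u, inv \<phi> t]) ` (T \<times> S))"
    by (rule card_Un_le)
  also have "\<dots> \<le> card (T \<times> S) + card (T \<times> S)"
    using finT S by (intro add_mono card_image_le) auto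
  finally show ?thesis by (simp add: card_cartesian_product)
qed

section \<open>Agreements between random permutations\<close>

lemma card_dlists_2: "finite S \<Longrightarrow> card S \<ge> 2 \<Longrightarrow> card (dlists S 2) = card S * (card S - 1)"
proof -
  assume S: "finite S" "card S \<ge> 2"
  have "card (dlists S 2) = \<Prod>{card S - 2 + 1..card S}"
    unfolding dlists_def by (rule card_lists_distinct_length_eq) (use S in auto)
  also have "{card S - 2 + 1..card S} = {card S - 1, card S}" using S by auto
  finally show ?thesis using S by (simp add: mult.commute)
qed

lemma card_image_Int:
  assumes "inj_on f A" "finite A"
  shows "real (card (f ` A \<inter> Q)) = (\<Sum>a\<in>A. of_bool (f a \<in> Q))"
proof -
  have "f ` A \<inter> Q = f ` {a \<in> A. f a \<in> Q}" by auto
  moreover have "inj_on f {a \<in> A. f a \<in> Q}" using assms(1) by (rule inj_on_subset) auto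
  ultimately have "card (f ` A \<inter> Q) = card {a \<in> A. f a \<in> Q}" by (simp add: card_image)
  also have "{a \<in> A. f a \<in> Q} = A \<inter> {a. f a \<in> Q}" by auto
  finally show ?thesis using assms(2) by (simp add: of_bool_def sum.If_cases)
qed

lemma inj_on_map_perm: "\<pi> permutes S \<Longrightarrow> inj_on (map \<pi>) X"
  using permutes_inj by (metis inj_mapI inj_on_subset subset_UNIV)

text \<open>\<open>As\<close> is the block of rows \<open>a'\<close>, kept fixed while the others
  are random. Since its members disagree everywhere, so do their inverses, and the \<open>K\<close>
  pairs \<open>a'\<^sup>-\<^sup>1 a c\<close> are distinct; this gives \<open>\<Phi>1\<close> the
  constant size that \<open>random_growth\<close> asks for.\<close>

locale family =
  fixes S :: "'a set" and As :: "('a \<Rightarrow> 'a) list" and n K :: nat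
  assumes finS: "finite S" and cardS: "card S = n" and n2: "n \<ge> 2" and lenAs: "length As = K" and K: "K > 0"
    and As_perm: "\<And>a. a \<in> set As \<Longrightarrow> a permutes S"
    and As_disagree: "\<And>i j x. i < j \<Longrightarrow> j < K \<Longrightarrow> x \<in> S \<Longrightarrow> (As ! i) x \<noteq> (As ! j) x"
begin

abbreviation \<Omega> :: "'a list set" where "\<Omega> \<equiv> dlists S 2"

definition \<Phi>1 :: "('a \<Rightarrow> 'a) \<Rightarrow> 'a list \<Rightarrow> 'a list set" where
  "\<Phi>1 a c = (\<lambda>a'. map (inv a') (map a c)) ` set As"

definition P :: "('a \<Rightarrow> 'a) list \<Rightarrow> 'a list \<Rightarrow> 'a list set" where
  "P as c = (\<Union>a\<in>set as. \<Phi>1 a c)"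

lemma fin\<Omega>: "finite \<Omega>" by (rule finite_dlists[OF finS])

lemma card\<Omega>: "real (card \<Omega>) = real n * (real n - 1)"
  using card_dlists_2[OF finS] n2 by (simp add: cardS of_nat_diff)

lemma card\<Omega>_pos: "real (card \<Omega>) > 0"
  unfolding card\<Omega> using n2 by (intro mult_pos_pos) auto

lemma nth_As_inj: "a \<in> set As \<Longrightarrow> b \<in> set As \<Longrightarrow> x \<in> S \<Longrightarrow> a x = b x \<Longrightarrow> a = b"
  unfolding in_set_conv_nth using As_disagree lenAs by (metis linorder_neqE_nat)

lemma card_set_As: "card (set As) = K"
proof -
  obtain x where "x \<in> S" using cardS n2 by fastforce
  then have "distinct As"
    unfolding distinct_conv_nth using As_disagree lenAs by (metis linorder_neqE_nat)
  then show ?thesis by (simp add: distinct_card lenAs)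
qed

lemma touching_le:
  assumes "\<phi> permutes S" "T \<subseteq> S" "card T \<le> 2"
  shows "(\<Sum>c\<in>\<Omega>. of_bool (set (map \<phi> c) \<inter> T \<noteq> {})) \<le> 4 * real n"
proof -
  have "(\<Sum>c\<in>\<Omega>. of_bool (set (map \<phi> c) \<inter> T \<noteq> {})) = real (card {c \<in> \<Omega>. set (map \<phi> c) \<inter> T \<noteq> {}})"
    using fin\<Omega> by (simp add: of_bool_def sum.If_cases Int_def)
  also have "card {c \<in> \<Omega>. set (map \<phi> c) \<inter> T \<noteq> {}} \<le> 2 * card T * n"
    using card_touching_le[OF finS assms(1,2)] by (simp add: cardS)
  also have "\<dots> \<le> 2 * 2 * n" using assms(3) by (intro mult_le_mono) auto
  finally show ?thesis by simp
qed

lemma card_pair_le: "card {x, y} \<le> 2"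
  by (simp add: card_insert_if)

lemma inj_\<Phi>1:
  assumes "\<pi> permutes S" "c \<in> \<Omega>"
  shows "inj_on (\<lambda>a'. map (inv a') (map \<pi> c)) (set As)"
proof (rule inj_onI)
  fix a b assume ab: "a \<in> set As" "b \<in> set As" "map (inv a) (map \<pi> c) = map (inv b) (map \<pi> c)"
  obtain u v where c: "c = [u, v]" "u \<in> S"
    using assms(2) by (auto simp: dlists_def numeral_2_eq_2 length_Suc_conv)
  then have eq: "inv a (\<pi> u) = inv b (\<pi> u)" using ab(3) by simp
  have "inv a (\<pi> u) \<in> S"
    using c assms(1) permutes_inv[OF As_perm[OF ab(1)]] by (simp add: permutes_in_image)
  moreover have "a (inv a (\<pi> u)) = b (inv a (\<pi> u))"
    using eq ab permutes_inverses[OF As_perm] by metis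
  ultimately show "a = b" using ab nth_As_inj by blast
qed

sublocale G1: random_growth S \<Omega> \<Omega> \<Phi>1 "\<lambda>_. K" "4 * real n * K"
proof
  show "finite S" by (rule finS)
  show "finite \<Omega>" by (rule fin\<Omega>)
  show "\<Phi>1 \<pi> c \<subseteq> \<Omega>" if "\<pi> \<in> perms S" "c \<in> \<Omega>" for \<pi> c
    unfolding \<Phi>1_def using that map_perm_dlists[OF permutes_inv[OF As_perm] map_perm_dlists]
    by (auto simp del: map_map)
  show "card (\<Phi>1 \<pi> c) = K" if "\<pi> \<in> perms S" "c \<in> \<Omega>" for \<pi> c
    unfolding \<Phi>1_def using inj_\<Phi>1 that by (simp add: card_image card_set_As del: map_map)
next
  fix c Q assume c: "c \<in> \<Omega>" and Q: "Q \<subseteq> \<Omega>"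
  have "average (perms S) (\<lambda>\<pi>. real (card (\<Phi>1 \<pi> c \<inter> Q)))
      = average (perms S) (\<lambda>\<pi>. \<Sum>a\<in>set As. of_bool (map \<pi> c \<in> map a ` Q))"
  proof (intro average_cong)
    fix \<pi> assume \<pi>: "\<pi> \<in> perms S"
    \<comment> \<open>Moving \<open>a\<close> to the other side leaves an event about the uniform
      pair \<open>map \<pi> c\<close> alone, with a target of the same size as
      \<open>Q\<close>.\<close>
    have "map (inv a) (map \<pi> c) \<in> Q \<longleftrightarrow> map \<pi> c \<in> map a ` Q" if "a \<in> set As" for a
    proof -
      have inv: "map a (map (inv a) xs) = xs" "map (inv a) (map a xs) = xs" for xs
        using permutes_inverses[OF As_perm[OF that]] by (auto simp: map_idI)
      show ?thesis using inv by (metis (no_types, lifting) image_iff)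
    qed
    then show "real (card (\<Phi>1 \<pi> c \<inter> Q)) = (\<Sum>a\<in>set As. of_bool (map \<pi> c \<in> map a ` Q))"
      unfolding \<Phi>1_def using inj_\<Phi>1[OF _ c] \<pi> by (subst card_image_Int) (auto intro!: sum.cong simp del: map_map)
  qed
  also have "\<dots> = (\<Sum>a\<in>set As. card (map a ` Q) / card \<Omega>)"
    unfolding average_sum
    using Q map_perm_dlists[OF As_perm] by (intro sum.cong average_map_perm finS c) auto
  also have "\<dots> = (\<Sum>a\<in>set As. card Q / card \<Omega>)"
    using inj_on_map_perm[OF As_perm] by (intro sum.cong) (auto simp: card_image)
  finally show "average (perms S) (\<lambda>\<pi>. real (card (\<Phi>1 \<pi> c \<inter> Q))) = K * card Q / card \<Omega>"
    by (simp add: card_set_As)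
next
  fix \<pi> x y assume *: "\<pi> \<in> perms S" "x \<in> S" "y \<in> S"
  \<comment> \<open>Only starts whose image contains \<open>x\<close> or \<open>y\<close> notice the
    swap: at most \<open>4 * n\<close> of them, each losing at most \<open>K\<close> pairs.\<close>
  have "real (card (\<Phi>1 \<pi> c - \<Phi>1 (transpose x y \<circ> \<pi>) c)) \<le> real K * of_bool (set (map \<pi> c) \<inter> {x, y} \<noteq> {})" for c
  proof (cases "set (map \<pi> c) \<inter> {x, y} = {}")
    case True
    have eq: "map (transpose x y \<circ> \<pi>) c = map \<pi> c" using True by (auto simp: Transposition.transpose_def)
    show ?thesis unfolding \<Phi>1_def eq using True by simp
  next
    case False
    have "card (\<Phi>1 \<pi> c - \<Phi>1 (transpose x y \<circ> \<pi>) c) \<le> card (\<Phi>1 \<pi> c)"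
      by (intro card_mono) (auto simp: \<Phi>1_def)
    also have "\<dots> \<le> K" unfolding \<Phi>1_def card_set_As[symmetric] by (rule card_image_le) simp
    finally show ?thesis using False by simp
  qed
  then have "(\<Sum>c\<in>\<Omega>. real (card (\<Phi>1 \<pi> c - \<Phi>1 (transpose x y \<circ> \<pi>) c)))
      \<le> (\<Sum>c\<in>\<Omega>. real K * of_bool (set (map \<pi> c) \<inter> {x, y} \<noteq> {}))" by (intro sum_mono)
  also have "\<dots> = real K * (\<Sum>c\<in>\<Omega>. of_bool (set (map \<pi> c) \<inter> {x, y} \<noteq> {}))"
    by (simp only: sum_distrib_left)
  also have "\<dots> \<le> K * (4 * real n)"
    using * card_pair_le by (intro mult_left_mono touching_le) auto
  finally show "(\<Sum>c\<in>\<Omega>. real (card (\<Phi>1 \<pi> c - \<Phi>1 (transpose x y \<circ> \<pi>) c))) \<le> 4 * real n * K"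
    by (simp add: mult_ac)
qed

lemma P_eq: "P as c = G1.U as c"
  by (simp add: P_def G1.U_def)

lemma P_sub: "as \<in> perm_lists S l \<Longrightarrow> c \<in> \<Omega> \<Longrightarrow> P as c \<subseteq> \<Omega>"
  unfolding P_eq by (rule G1.U_sub)

definition \<Phi>2 :: "('a \<Rightarrow> 'a) list \<Rightarrow> ('a \<Rightarrow> 'a) \<Rightarrow> 'a list \<Rightarrow> 'a list set" where
  "\<Phi>2 as b c = map b ` P as c"

definition Q :: "('a \<Rightarrow> 'a) list \<Rightarrow> ('a \<Rightarrow> 'a) list \<Rightarrow> 'a list \<Rightarrow> 'a list set" where
  "Q as bs c = (\<Union>b\<in>set bs. \<Phi>2 as b c)"

text \<open>Every element of \<open>P as c\<close> has a witness \<open>(a, a')\<close>. For a fixed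
  witness \<open>inv a' \<circ> a\<close> permutes \<open>S\<close>, so at most \<open>4 * n\<close>
  starts lead to a pair meeting \<open>T\<close>, and there are at most \<open>l * K\<close>
  witnesses.\<close>

lemma touching_P_le:
  assumes as: "as \<in> perm_lists S l" and T: "T \<subseteq> S" "card T \<le> 2"
  shows "(\<Sum>c\<in>\<Omega>. real (card {p \<in> P as c. set p \<inter> T \<noteq> {}})) \<le> 4 * real n * K * l"
proof -
  let ?t = "\<lambda>a a' c. of_bool (set (map (inv a' \<circ> a) c) \<inter> T \<noteq> {}) :: real"
  have perm: "a permutes S" if "a \<in> set as" for a using as that by (auto simp: perm_lists_def)
  have "(\<Sum>c\<in>\<Omega>. real (card {p \<in> P as c. set p \<inter> T \<noteq> {}}))
      \<le> (\<Sum>c\<in>\<Omega>. \<Sum>(a, a')\<in>set as \<times> set As. ?t a a' c)"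
  proof (rule sum_mono)
    fix c
    let ?R = "{(a, a') \<in> set as \<times> set As. set (map (inv a' \<circ> a) c) \<inter> T \<noteq> {}}"
    have "{p \<in> P as c. set p \<inter> T \<noteq> {}} \<subseteq> (\<lambda>(a, a'). map (inv a' \<circ> a) c) ` ?R"
    proof
      fix p assume "p \<in> {p \<in> P as c. set p \<inter> T \<noteq> {}}"
      then have p: "p \<in> P as c" "set p \<inter> T \<noteq> {}" by auto
      from p(1) obtain a a' where "a \<in> set as" "a' \<in> set As" "p = map (inv a' \<circ> a) c"
        by (auto simp: P_def \<Phi>1_def)
      with p(2) show "p \<in> (\<lambda>(a, a'). map (inv a' \<circ> a) c) ` ?R"
        by (intro image_eqI[of _ _ "(a, a')"]) auto
    qed
    then have "card {p \<in> P as c. set p \<inter> T \<noteq> {}} \<le> card ?R"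
      by (rule surj_card_le[rotated]) (auto intro: finite_subset[of _ "set as \<times> set As"])
    also have "real (card ?R) = (\<Sum>z\<in>set as \<times> set As. of_bool (z \<in> ?R))"
      by (simp add: of_bool_def sum.If_cases Int_absorb1 subset_iff)
    also have "\<dots> = (\<Sum>(a, a')\<in>set as \<times> set As. ?t a a' c)"
    proof (rule sum.cong[OF refl])
      fix z assume "z \<in> set as \<times> set As"
      then show "of_bool (z \<in> ?R) = (case z of (a, a') \<Rightarrow> ?t a a' c)"
        by (cases z) simp
    qed
    finally show "real (card {p \<in> P as c. set p \<inter> T \<noteq> {}})
      \<le> (\<Sum>(a, a')\<in>set as \<times> set As. ?t a a' c)" by simp
  qed
  also have "\<dots> = (\<Sum>(a, a')\<in>set as \<times> set As. \<Sum>c\<in>\<Omega>. ?t a a' c)"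
    by (subst sum.swap) (simp add: case_prod_unfold)
  also have "\<dots> \<le> (\<Sum>(a, a')\<in>set as \<times> set As. 4 * real n)"
    using T perm As_perm
    by (intro sum_mono) (auto simp del: map_map o_apply set_map intro!: touching_le permutes_compose permutes_inv)
  also have "\<dots> = card (set as) * K * (4 * real n)" by (simp add: card_set_As card_cartesian_product)
  also have "\<dots> \<le> l * K * (4 * real n)"
    using card_length[of as] as by (intro mult_right_mono) (auto simp: perm_lists_def intro: mult_right_mono)
  finally show ?thesis by (simp add: mult_ac)
qed

text \<open>Swapping the values \<open>x\<close> and \<open>y\<close> of \<pi> affects only the
  pairs that contain a preimage of one of them, which \<open>touching_P_le\<close> counts over all
  starts at once. The constant is \<open>l\<close> times that of the first stage, as is the mean, so
  relative fluctuations do not grow.\<close>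

lemma random_growth2:
  assumes as: "as \<in> perm_lists S l"
  shows "random_growth S \<Omega> \<Omega> (\<Phi>2 as) (\<lambda>c. card (P as c)) (4 * real n * K * l)"
proof
  show "finite S" by (rule finS)
  show "finite \<Omega>" by (rule fin\<Omega>)
  show "\<Phi>2 as \<pi> c \<subseteq> \<Omega>" if "\<pi> \<in> perms S" "c \<in> \<Omega>" for \<pi> c
    unfolding \<Phi>2_def using that P_sub[OF as that(2)] map_perm_dlists by fastforce
  show "card (\<Phi>2 as \<pi> c) = card (P as c)" if "\<pi> \<in> perms S" "c \<in> \<Omega>" for \<pi> c
    unfolding \<Phi>2_def using inj_on_map_perm that by (intro card_image) auto
next
  fix c Q assume c: "c \<in> \<Omega>" and Q: "Q \<subseteq> \<Omega>"
  have fin: "finite (P as c)" using finite_subset[OF P_sub[OF as c] fin\<Omega>] .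
  have "average (perms S) (\<lambda>\<pi>. real (card (\<Phi>2 as \<pi> c \<inter> Q)))
      = average (perms S) (\<lambda>\<pi>. \<Sum>p\<in>P as c. of_bool (map \<pi> p \<in> Q))"
    unfolding \<Phi>2_def using inj_on_map_perm fin by (intro average_cong card_image_Int) auto
  also have "\<dots> = (\<Sum>p\<in>P as c. card Q / card \<Omega>)"
    unfolding average_sum using P_sub[OF as c] by (intro sum.cong average_map_perm finS Q) auto
  finally show "average (perms S) (\<lambda>\<pi>. real (card (\<Phi>2 as \<pi> c \<inter> Q))) = card (P as c) * card Q / card \<Omega>"
    by simp
next
  fix \<pi> x y assume *: "\<pi> \<in> perms S" "x \<in> S" "y \<in> S"
  let ?\<pi>' = "transpose x y \<circ> \<pi>" and ?T = "{inv \<pi> x, inv \<pi> y}"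
  let ?D = "\<lambda>c. \<Phi>2 as \<pi> c - \<Phi>2 as ?\<pi>' c"
  have T: "?T \<subseteq> S" using * permutes_inv[of \<pi> S] by (auto simp: permutes_in_image)
  have "real (card (?D c)) \<le> real (card {p \<in> P as c. set p \<inter> ?T \<noteq> {}})"
    if c: "c \<in> \<Omega>" for c
  proof -
    have fin: "finite (P as c)" using finite_subset[OF P_sub[OF as c] fin\<Omega>] .
    have "?D c \<subseteq> map \<pi> ` {p \<in> P as c. set p \<inter> ?T \<noteq> {}}"
    proof
      fix z assume z: "z \<in> ?D c"
      then obtain p where p: "p \<in> P as c" "z = map \<pi> p" by (auto simp: \<Phi>2_def)
      have "set p \<inter> ?T \<noteq> {}"
      proof
        assume "set p \<inter> ?T = {}"
        then have "\<pi> u \<noteq> x \<and> \<pi> u \<noteq> y" if "u \<in> set p" for u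
          using that permutes_inverses[of \<pi> S] * by auto
        then have "map ?\<pi>' p = z"
          unfolding p(2) by (intro map_cong) (auto simp: Transposition.transpose_def)
        then have "z \<in> \<Phi>2 as ?\<pi>' c" using p unfolding \<Phi>2_def by blast
        then show False using z by simp
      qed
      then show "z \<in> map \<pi> ` {p \<in> P as c. set p \<inter> ?T \<noteq> {}}" using p by blast
    qed
    then have "card (?D c) \<le> card {p \<in> P as c. set p \<inter> ?T \<noteq> {}}"
      by (rule surj_card_le[rotated]) (simp add: fin)
    then show ?thesis by simp
  qed
  then have "(\<Sum>c\<in>\<Omega>. real (card (?D c)))
      \<le> (\<Sum>c\<in>\<Omega>. real (card {p \<in> P as c. set p \<inter> ?T \<noteq> {}}))" by (intro sum_mono)
  also have "\<dots> \<le> 4 * real n * K * l" by (rule touching_P_le[OF as T card_pair_le])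
  finally show "(\<Sum>c\<in>\<Omega>. real (card (\<Phi>2 as \<pi> c - \<Phi>2 as (transpose x y \<circ> \<pi>) c))) \<le> 4 * real n * K * l" .
qed

end

section \<open>Nondegenerate triples and the hits of the last block\<close>

lemma sum_list_update_diff:
  fixes xs :: "'b::ab_group_add list"
  assumes "i < length xs"
  shows "sum_list (xs[i := v]) - sum_list xs = v - xs ! i"
  using assms by (induction xs arbitrary: i) (auto split: nat.split)

context family
begin

text \<open>With \<open>e\<^sub>i = a'\<^sup>-\<^sup>1 a c\<^sub>i\<close> as the new columns and
  \<open>d c\<^sub>i = b e\<^sub>i\<close>, these are the coincidences of columns and of symbols
  that must be excluded by hand. The other distinctness conditions hold because rows are injective
  and different rows of a Latin square disagree in every column.\<close>

definition nondeg :: "('a \<Rightarrow> 'a) \<Rightarrow> ('a \<Rightarrow> 'a) \<Rightarrow> ('a \<Rightarrow> 'a) \<Rightarrow> 'a list \<Rightarrow> bool" where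
  "nondeg a' a b c \<longleftrightarrow> (inv a' \<circ> a) (c ! 0) \<noteq> c ! 1 \<and> (inv a' \<circ> a) (c ! 1) \<noteq> c ! 0
     \<and> (b \<circ> inv a' \<circ> a) (c ! 0) \<noteq> a (c ! 1) \<and> (b \<circ> inv a' \<circ> a) (c ! 1) \<noteq> a (c ! 0)"

definition Qnd :: "('a \<Rightarrow> 'a) list \<Rightarrow> ('a \<Rightarrow> 'a) list \<Rightarrow> 'a list \<Rightarrow> 'a list set" where
  "Qnd as bs c = {map (b \<circ> inv a' \<circ> a) c | a' a b. a' \<in> set As \<and> a \<in> set as \<and> b \<in> set bs \<and> nondeg a' a b c}"

lemma diagonal_le:
  assumes \<phi>: "\<phi> permutes S" and \<psi>: "\<psi> permutes S"
  shows "(\<Sum>c\<in>\<Omega>. of_bool (\<phi> (c ! 0) = \<psi> (c ! 1))) \<le> real n"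
proof -
  have "{c \<in> \<Omega>. \<phi> (c ! 0) = \<psi> (c ! 1)} \<subseteq> (\<lambda>v. [inv \<phi> (\<psi> v), v]) ` S"
  proof
    fix c assume c: "c \<in> {c \<in> \<Omega>. \<phi> (c ! 0) = \<psi> (c ! 1)}"
    then obtain u v where uv: "c = [u, v]" "v \<in> S"
      by (auto simp: dlists_def numeral_2_eq_2 length_Suc_conv)
    then have "\<phi> u = \<psi> v" using c by simp
    then have "u = inv \<phi> (\<psi> v)" using permutes_inverses(2)[OF \<phi>] by metis
    then show "c \<in> (\<lambda>v. [inv \<phi> (\<psi> v), v]) ` S" using uv by blast
  qed
  then have "card {c \<in> \<Omega>. \<phi> (c ! 0) = \<psi> (c ! 1)} \<le> card S"
    by (rule surj_card_le[OF finS])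
  then show ?thesis using fin\<Omega> by (simp add: of_bool_def sum.If_cases Int_def cardS)
qed

lemma degenerate_le:
  assumes "a' permutes S" "a permutes S" "b permutes S"
  shows "(\<Sum>c\<in>\<Omega>. of_bool (\<not> nondeg a' a b c)) \<le> 4 * real n"
proof -
  have p: "inv a' \<circ> a permutes S" "b \<circ> inv a' \<circ> a permutes S"
    using assms by (simp_all add: permutes_compose permutes_inv)
  have "(\<Sum>c\<in>\<Omega>. of_bool (\<not> nondeg a' a b c)) \<le> (\<Sum>c\<in>\<Omega>. of_bool ((inv a' \<circ> a) (c ! 0) = id (c ! 1))
     + of_bool (id (c ! 0) = (inv a' \<circ> a) (c ! 1)) + of_bool ((b \<circ> inv a' \<circ> a) (c ! 0) = a (c ! 1))
     + of_bool (a (c ! 0) = (b \<circ> inv a' \<circ> a) (c ! 1)) :: real)"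
    unfolding nondeg_def by (intro sum_mono) (auto simp del: o_apply split: split_of_bool)
  also have "\<dots> \<le> real n + real n + real n + real n"
    unfolding sum.distrib using assms(2) p by (intro add_mono diagonal_le permutes_id)
  finally show ?thesis by simp
qed

text \<open>Each of at most \<open>K * l\<^sup>2\<close> triples is degenerate for at most
  \<open>4 * n\<close> starts, so the loss is of lower order than the main term
  \<open>K * l\<^sup>2 * n\<^sup>2\<close>.\<close>

lemma Q_le_Qnd:
  assumes as: "as \<in> perm_lists S l" and bs: "bs \<in> perm_lists S l"
  shows "(\<Sum>c\<in>\<Omega>. real (card (Q as bs c))) \<le> (\<Sum>c\<in>\<Omega>. real (card (Qnd as bs c))) + 4 * real n * K * l\<^sup>2"
proof -
  let ?X = "set As \<times> set as \<times> set bs"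
  let ?deg = "\<lambda>(a', a, b) c. \<not> nondeg a' a b c"
  have perm: "a \<in> set as \<Longrightarrow> a permutes S" "b \<in> set bs \<Longrightarrow> b permutes S" for a b
    using as bs by (auto simp: perm_lists_def)
  have "real (card (Q as bs c)) \<le> real (card (Qnd as bs c)) + (\<Sum>z\<in>?X. of_bool (?deg z c))" for c
  proof -
    let ?D = "{z \<in> ?X. ?deg z c}" and ?f = "\<lambda>(a', a, b). map (b \<circ> inv a' \<circ> a) c"
    have "Qnd as bs c \<subseteq> ?f ` ?X"
    proof
      fix z assume "z \<in> Qnd as bs c"
      then obtain a' a b where "a' \<in> set As" "a \<in> set as" "b \<in> set bs" "z = map (b \<circ> inv a' \<circ> a) c"
        unfolding Qnd_def by blast
      then show "z \<in> ?f ` ?X"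
        by (intro image_eqI[of _ _ "(a', a, b)"]) auto
    qed
    then have fin: "finite (Qnd as bs c)" by (rule finite_surj[rotated]) simp
    have "Q as bs c \<subseteq> Qnd as bs c \<union> ?f ` ?D"
    proof
      fix z assume "z \<in> Q as bs c"
      then obtain a' a b where z: "a' \<in> set As" "a \<in> set as" "b \<in> set bs" "z = map (b \<circ> inv a' \<circ> a) c"
        by (auto simp: Q_def \<Phi>2_def P_def \<Phi>1_def)
      show "z \<in> Qnd as bs c \<union> ?f ` ?D"
      proof (cases "nondeg a' a b c")
        case True
        then show ?thesis using z unfolding Qnd_def by blast
      next
        case False
        then show ?thesis using z by (intro UnI2 image_eqI[of _ _ "(a', a, b)"]) auto
      qed
    qed
    then have "card (Q as bs c) \<le> card (Qnd as bs c \<union> ?f ` ?D)"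
      using fin by (intro card_mono) auto
    also have "\<dots> \<le> card (Qnd as bs c) + card (?f ` ?D)"
      by (rule card_Un_le)
    also have "\<dots> \<le> card (Qnd as bs c) + card ?D"
      by (intro add_mono card_image_le) auto
    also have "real (card (Qnd as bs c) + card ?D) = card (Qnd as bs c) + (\<Sum>z\<in>?X. of_bool (?deg z c))"
      by (simp add: of_bool_def sum.If_cases Int_def)
    finally show ?thesis by simp
  qed
  then have "(\<Sum>c\<in>\<Omega>. real (card (Q as bs c)))
      \<le> (\<Sum>c\<in>\<Omega>. real (card (Qnd as bs c)) + (\<Sum>z\<in>?X. of_bool (?deg z c)))"
    by (rule sum_mono)
  also have "\<dots> = (\<Sum>c\<in>\<Omega>. real (card (Qnd as bs c))) + (\<Sum>z\<in>?X. \<Sum>c\<in>\<Omega>. of_bool (?deg z c))"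
    unfolding sum.distrib by (subst sum.swap) simp
  also have "(\<Sum>z\<in>?X. \<Sum>c\<in>\<Omega>. of_bool (?deg z c)) \<le> (\<Sum>z\<in>?X. 4 * real n)"
    using perm As_perm by (intro sum_mono) (auto intro!: degenerate_le)
  also have "\<dots> = real K * (real (card (set as)) * real (card (set bs))) * (4 * real n)"
    by (simp add: card_cartesian_product card_set_As)
  also have "\<dots> \<le> real K * (real l * real l) * (4 * real n)"
    using card_length[of as] card_length[of bs] as bs
    by (intro mult_right_mono mult_left_mono mult_mono) (auto simp: perm_lists_def)
  finally show ?thesis by (simp add: mult_ac power2_eq_square)
qed

definition w :: "('a list \<Rightarrow> 'a list set) \<Rightarrow> ('a \<Rightarrow> 'a) \<Rightarrow> real" where
  "w R d = (\<Sum>c\<in>\<Omega>. of_bool (map d c \<in> R c))"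

definition W :: "('a list \<Rightarrow> 'a list set) \<Rightarrow> ('a \<Rightarrow> 'a) list \<Rightarrow> real" where
  "W R ds = (\<Sum>d\<leftarrow>ds. w R d)"

text \<open>A swap changes \<open>map d c\<close> for at most \<open>4 * n\<close> starts, each
  worth at most one hit. The bound ignores how sparse \<open>R\<close> is, which is why the density
  of the targets enters the exponent of the last stage.\<close>

lemma swap_lipschitz_W: "swap_lipschitz S l (4 * real n) (W R)"
  unfolding swap_lipschitz_def
proof (intro ballI allI impI)
  fix ds i x y assume *: "ds \<in> perm_lists S l" "i < l" "x \<in> S" "y \<in> S"
  let ?\<pi> = "ds ! i"
  have \<pi>: "?\<pi> permutes S" and len: "length ds = l" using * by (auto simp: perm_lists_def subset_iff)
  have "W R (ds[i := transpose x y \<circ> ?\<pi>]) - W R ds = w R (transpose x y \<circ> ?\<pi>) - w R ?\<pi>"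
    using * len by (simp add: W_def map_update sum_list_update_diff)
  also have "\<bar>\<dots>\<bar> \<le> (\<Sum>c\<in>\<Omega>. \<bar>of_bool (map (transpose x y \<circ> ?\<pi>) c \<in> R c) - of_bool (map ?\<pi> c \<in> R c)\<bar>)"
    unfolding w_def sum_subtractf[symmetric] by (rule sum_abs)
  also have "\<dots> \<le> (\<Sum>c\<in>\<Omega>. of_bool (set (map ?\<pi> c) \<inter> {x, y} \<noteq> {}))"
  proof (rule sum_mono)
    fix c
    show "\<bar>of_bool (map (transpose x y \<circ> ?\<pi>) c \<in> R c) - of_bool (map ?\<pi> c \<in> R c) :: real\<bar>
      \<le> of_bool (set (map ?\<pi> c) \<inter> {x, y} \<noteq> {})"
    proof (cases "set (map ?\<pi> c) \<inter> {x, y} = {}")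
      case True
      have eq: "map (transpose x y \<circ> ?\<pi>) c = map ?\<pi> c"
        using True by (auto simp: Transposition.transpose_def)
      show ?thesis unfolding eq by simp
    next
      case False
      then show ?thesis by (simp del: set_map map_map)
    qed
  qed
  also have "\<dots> \<le> 4 * real n" using * \<pi> card_pair_le by (intro touching_le) auto
  finally show "\<bar>W R (ds[i := transpose x y \<circ> ?\<pi>]) - W R ds\<bar> \<le> 4 * real n" .
qed

lemma average_W:
  assumes R: "\<And>c. c \<in> \<Omega> \<Longrightarrow> R c \<subseteq> \<Omega>"
  shows "average (perm_lists S l) (W R) = real l * (\<Sum>c\<in>\<Omega>. real (card (R c))) / card \<Omega>"
proof (induction l)
  case 0
  have "perm_lists S 0 = {[]}" by (auto simp: perm_lists_def)
  then show ?case by (simp add: average_def W_def)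
next
  case (Suc l)
  have w: "average (perms S) (w R) = (\<Sum>c\<in>\<Omega>. real (card (R c)) / card \<Omega>)"
    unfolding w_def average_sum using R by (intro sum.cong average_map_perm finS) auto
  have "average (perm_lists S (Suc l)) (W R) = average (perms S) (\<lambda>x. average (perm_lists S l) (\<lambda>xs. w R x + W R xs))"
    by (simp add: average_perm_lists_Suc[OF finS] W_def)
  also have "\<dots> = average (perms S) (w R) + average (perm_lists S l) (W R)"
    by (simp add: average_add average_const finite_perm_lists[OF finS] perm_lists_nonempty average_const_perms[OF finS])
  finally show ?case
    by (simp add: w Suc sum_divide_distrib[symmetric] add_divide_distrib algebra_simps)
qed

section \<open>Tail bounds for the three stages\<close>

definition Z1 :: "('a \<Rightarrow> 'a) list \<Rightarrow> real" where
  "Z1 as = (\<Sum>c\<in>\<Omega>. real (card (P as c)))"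

definition Z2 :: "('a \<Rightarrow> 'a) list \<Rightarrow> ('a \<Rightarrow> 'a) list \<Rightarrow> real" where
  "Z2 as bs = (\<Sum>c\<in>\<Omega>. real (card (Q as bs c)))"

definition Z3 :: "('a \<Rightarrow> 'a) list \<Rightarrow> ('a \<Rightarrow> 'a) list \<Rightarrow> real" where
  "Z3 as bs = (\<Sum>c\<in>\<Omega>. real (card (Qnd as bs c)))"

text \<open>Here and in the second stage the deviation is the fraction \<tau> of the main term,
  equal to \<open>\<tau> * l * n / 4\<close> Lipschitz constants, so \<open>K\<close> cancels from
  the exponent.\<close>

lemma stage1:
  fixes \<tau> :: real
  assumes l: "l > 0" and \<tau>: "0 < \<tau>" "\<tau> \<le> 1"
  shows "card {as \<in> perm_lists S l. Z1 as \<le> (real (card \<Omega>) * K * l - (real K * l)\<^sup>2) - \<tau> * K * l * (real n)\<^sup>2}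
     \<le> fact n ^ l * exp (- (\<tau>\<^sup>2 * l * n / 256))"
proof -
  let ?L = "4 * real n * K"
  let ?t = "\<tau> * K * l * (real n)\<^sup>2"
  have Z: "Z1 = G1.Z" by (simp add: Z1_def G1.Z_def P_eq fun_eq_iff)
  have n: "n > 0" using n2 by simp
  have "real (card {as \<in> perm_lists S l. Z1 as \<le> (real (card \<Omega>) * K * l - (real K * l)\<^sup>2) - ?t})
    \<le> fact (card S) ^ l * exp (- (?t\<^sup>2 / (16 * real l * card S * ?L\<^sup>2)))"
  proof (rule perm_lists_lower_tail[OF finS])
    show "swap_lipschitz S l ?L Z1" unfolding Z by (rule G1.swap_lipschitz_Z)
    have "(\<Sum>c\<in>\<Omega>. real l * K - (real l * K)\<^sup>2 / card \<Omega>) = real (card \<Omega>) * K * l - (real K * l)\<^sup>2"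
      using card\<Omega>_pos by (simp add: field_simps power2_eq_square)
    then show "real (card \<Omega>) * K * l - (real K * l)\<^sup>2 \<le> average (perm_lists S l) Z1"
      using G1.average_Z_ge[of l] unfolding Z by simp
    have "\<tau> * (K * l * (real n)\<^sup>2) \<le> 16 * (K * l * (real n)\<^sup>2)"
      using \<tau> by (intro mult_right_mono) auto
    then show "?t \<le> 4 * real l * card S * ?L" by (simp add: cardS power2_eq_square mult_ac)
  qed (use \<tau> l K n cardS in auto)
  also have "?t\<^sup>2 / (16 * real l * card S * ?L\<^sup>2) = \<tau>\<^sup>2 * l * n / 256"
    using l n K by (simp add: cardS field_simps power2_eq_square)
  finally show ?thesis by (simp add: cardS)
qed

text \<open>\<open>as\<close> is fixed and \<open>random_growth\<close> is used with the sets
  \<open>P as c\<close>; the overlap term is estimated by the worst case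
  \<open>card (P as c) \<le> l * K\<close> at every start.\<close>

lemma stage2:
  fixes \<tau> :: real
  assumes as: "as \<in> perm_lists S l" and l: "l > 0" and \<tau>: "0 < \<tau>" "\<tau> \<le> 1"
  shows "card {bs \<in> perm_lists S l. Z2 as bs \<le> (l * Z1 as - (real K * (real l)\<^sup>2)\<^sup>2) - \<tau> * K * (real l)\<^sup>2 * (real n)\<^sup>2}
     \<le> fact n ^ l * exp (- (\<tau>\<^sup>2 * l * n / 256))"
proof -
  let ?L = "4 * real n * K * l"
  let ?t = "\<tau> * K * (real l)\<^sup>2 * (real n)\<^sup>2"
  interpret G2: random_growth S \<Omega> \<Omega> "\<Phi>2 as" "\<lambda>c. card (P as c)" ?L
    by (rule random_growth2[OF as])
  have Z: "Z2 as = G2.Z" by (simp add: Z2_def G2.Z_def Q_def G2.U_def fun_eq_iff)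
  have n: "n > 0" using n2 by simp
  have "real (card {bs \<in> perm_lists S l. Z2 as bs \<le> (l * Z1 as - (real K * (real l)\<^sup>2)\<^sup>2) - ?t})
    \<le> fact (card S) ^ l * exp (- (?t\<^sup>2 / (16 * real l * card S * ?L\<^sup>2)))"
  proof (rule perm_lists_lower_tail[OF finS])
    show "swap_lipschitz S l ?L (Z2 as)" unfolding Z by (rule G2.swap_lipschitz_Z)
    have "(\<Sum>c\<in>\<Omega>. real l * card (P as c) - (real K * (real l)\<^sup>2)\<^sup>2 / card \<Omega>)
      \<le> (\<Sum>c\<in>\<Omega>. real l * card (P as c) - (real l * card (P as c))\<^sup>2 / card \<Omega>)"
    proof (intro sum_mono diff_left_mono divide_right_mono power_mono)
      fix c assume "c \<in> \<Omega>"
      then have "real (card (P as c)) \<le> real (l * K)" unfolding P_eq of_nat_le_iff by (rule G1.card_U_le[OF as])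
      then have "real l * card (P as c) \<le> real l * (real l * K)" by (intro mult_left_mono) auto
      then show "real l * card (P as c) \<le> real K * (real l)\<^sup>2" by (simp add: power2_eq_square mult_ac)
    qed auto
    also have "(\<Sum>c\<in>\<Omega>. real l * card (P as c) - (real K * (real l)\<^sup>2)\<^sup>2 / card \<Omega>)
       = l * Z1 as - (real K * (real l)\<^sup>2)\<^sup>2"
      using card\<Omega>_pos by (simp add: sum_subtractf Z1_def sum_distrib_left)
    finally show "l * Z1 as - (real K * (real l)\<^sup>2)\<^sup>2 \<le> average (perm_lists S l) (Z2 as)"
      using G2.average_Z_ge[of l] unfolding Z by simp
    have "\<tau> * (K * (real l)\<^sup>2 * (real n)\<^sup>2) \<le> 16 * (K * (real l)\<^sup>2 * (real n)\<^sup>2)"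
      using \<tau> by (intro mult_right_mono) auto
    then show "?t \<le> 4 * real l * card S * ?L" by (simp add: cardS power2_eq_square mult_ac)
  qed (use \<tau> l K n cardS in auto)
  also have "?t\<^sup>2 / (16 * real l * card S * ?L\<^sup>2) = \<tau>\<^sup>2 * l * n / 256"
    using l n K by (simp add: cardS field_simps power2_eq_square)
  finally show ?thesis by (simp add: cardS)
qed

lemma Qnd_sub:
  assumes "as \<in> perm_lists S l" "bs \<in> perm_lists S l" "c \<in> \<Omega>"
  shows "Qnd as bs c \<subseteq> \<Omega>"
proof
  fix z assume "z \<in> Qnd as bs c"
  then obtain a' a b where z: "a' \<in> set As" "a \<in> set as" "b \<in> set bs" "z = map (b \<circ> inv a' \<circ> a) c"
    by (auto simp: Qnd_def)
  then have "b \<circ> inv a' \<circ> a permutes S"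
    using assms As_perm by (intro permutes_compose permutes_inv) (auto simp: perm_lists_def)
  then show "z \<in> \<Omega>" unfolding z(4) using assms(3) by (rule map_perm_dlists)
qed

text \<open>The deviation is \<open>\<tau> * K * l^3 / (4 * n) = \<tau> * \<rho> * l * n / 4\<close>
  Lipschitz constants, a factor \<rho> less than before. With \<open>\<rho> \<le> 1\<close> it stays
  in the range where the Gaussian bound of \<open>perm_lists_lower_tail\<close> holds.\<close>

lemma stage3:
  fixes \<tau> \<rho> :: real
  assumes as: "as \<in> perm_lists S l" and bs: "bs \<in> perm_lists S l" and l: "l > 0" and \<tau>: "0 < \<tau>" "\<tau> \<le> 1"
    and \<rho>: "\<rho> = K * (real l)\<^sup>2 / (real n)\<^sup>2" "\<rho> \<le> 1"
  shows "card {ds \<in> perm_lists S l. W (Qnd as bs) ds \<le> l * Z3 as bs / card \<Omega> - \<tau> * K * real l ^ 3}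
     \<le> fact n ^ l * exp (- (\<tau>\<^sup>2 * \<rho>\<^sup>2 * l * n / 256))"
proof -
  let ?L = "4 * real n"
  let ?t = "\<tau> * K * real l ^ 3"
  have n: "n > 0" using n2 by simp
  have "real (card {ds \<in> perm_lists S l. W (Qnd as bs) ds \<le> l * Z3 as bs / card \<Omega> - ?t})
    \<le> fact (card S) ^ l * exp (- (?t\<^sup>2 / (16 * real l * card S * ?L\<^sup>2)))"
  proof (rule perm_lists_lower_tail[OF finS _ swap_lipschitz_W])
    show "l * Z3 as bs / card \<Omega> \<le> average (perm_lists S l) (W (Qnd as bs))"
      using average_W[of "Qnd as bs" l] Qnd_sub[OF as bs] by (simp add: Z3_def)
    have "K * (real l)\<^sup>2 = \<rho> * (real n)\<^sup>2" using \<rho>(1) n by simp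
    also have "\<dots> \<le> 1 * (real n)\<^sup>2" using \<rho>(2) by (intro mult_right_mono) auto
    finally have "K * (real l)\<^sup>2 \<le> (real n)\<^sup>2" by simp
    then have "\<tau> * (K * (real l)\<^sup>2) \<le> 1 * (real n)\<^sup>2" using \<tau> by (intro mult_mono) auto
    also have "\<dots> \<le> 16 * (real n)\<^sup>2" by simp
    finally have "\<tau> * (K * (real l)\<^sup>2) * l \<le> 16 * (real n)\<^sup>2 * l" by (rule mult_right_mono) simp
    then show "?t \<le> 4 * real l * card S * ?L" by (simp add: cardS power2_eq_square power3_eq_cube mult_ac)
  qed (use \<tau> l K n cardS in auto)
  also have "?t\<^sup>2 / (16 * real l * card S * ?L\<^sup>2) = \<tau>\<^sup>2 * \<rho>\<^sup>2 * l * n / 256"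
    using l n by (simp add: cardS \<rho>(1) field_simps power2_eq_square power3_eq_cube)
  finally show ?thesis by (simp add: cardS)
qed

text \<open>Seven losses of \<tau>: \<open>card \<Omega>\<close> against \<open>n\<^sup>2\<close>,
  overlap and deviation in the first stage, overlap and deviation in the second, degenerate triples,
  deviation in the third. \<open>4 \<le> \<tau> * n\<close> pays for \<open>card \<Omega>\<close>
  and the degenerate triples, the bound on \<open>K * l\<close> for the first overlap,
  \<open>\<rho> \<le> \<tau>\<close> for the second. One exceptional set per stage, fibred over the
  earlier choices, gives the factor 3.\<close>

theorem few_bad_triples:
  fixes \<tau> \<rho> :: real
  assumes l: "l > 0" and \<tau>: "0 < \<tau>" "\<tau> \<le> 1"
    and \<rho>: "\<rho> = K * (real l)\<^sup>2 / (real n)\<^sup>2" "\<rho> \<le> \<tau>"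
    and n\<tau>: "4 \<le> \<tau> * n" and Kl: "real K * l \<le> \<tau> * (real n)\<^sup>2"
  shows "card {(as, bs, ds) \<in> perm_lists S l \<times> perm_lists S l \<times> perm_lists S l.
       W (Qnd as bs) ds \<le> (1 - 7 * \<tau>) * K * real l ^ 3}
     \<le> 3 * fact n ^ (3 * l) * exp (- (\<tau>\<^sup>2 * \<rho>\<^sup>2 * l * n / 256))"
proof -
  define A where "A = perm_lists S l"
  define F :: real where "F = fact n ^ l"
  define e where "e = exp (- (\<tau>\<^sup>2 * \<rho>\<^sup>2 * l * n / 256))"
  define B1 where "B1 = {as \<in> A. Z1 as \<le> (real (card \<Omega>) * K * l - (real K * l)\<^sup>2) - \<tau> * K * l * (real n)\<^sup>2}"
  define B2 where "B2 as = {bs \<in> A. Z2 as bs \<le> (l * Z1 as - (real K * (real l)\<^sup>2)\<^sup>2) - \<tau> * K * (real l)\<^sup>2 * (real n)\<^sup>2}" for as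
  define B3 where "B3 as bs = {ds \<in> A. W (Qnd as bs) ds \<le> l * Z3 as bs / card \<Omega> - \<tau> * K * real l ^ 3}" for as bs
  have finA: "finite A" and cA: "real (card A) = F"
    using finS by (simp_all add: A_def finite_perm_lists card_perm_lists cardS F_def)
  have F: "F \<ge> 0" by (simp add: F_def)
  have n: "real n > 0" using n2 by simp
  have \<rho>0: "\<rho> \<ge> 0" "\<rho> \<le> 1" using \<rho> \<tau> by (auto simp: divide_nonneg_nonneg)
  have e: "exp (- (\<tau>\<^sup>2 * l * n / 256)) \<le> e"
  proof -
    have "\<rho>\<^sup>2 \<le> 1" using \<rho>0 by (simp add: power_le_one)
    then have "(\<tau>\<^sup>2 * l * n) * \<rho>\<^sup>2 \<le> (\<tau>\<^sup>2 * l * n) * 1" by (intro mult_left_mono) auto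
    then show ?thesis by (simp add: e_def mult_ac)
  qed
  have c1: "card B1 \<le> F * e"
    unfolding B1_def A_def F_def using e
    by (intro order.trans[OF stage1[OF l \<tau>]] mult_left_mono) auto
  have c2: "card (B2 as) \<le> F * e" if "as \<in> A" for as
    unfolding B2_def A_def F_def using e that l \<tau>
    by (intro order.trans[OF stage2] mult_left_mono) (auto simp: A_def)
  have c3: "card (B3 as bs) \<le> F * e" if "as \<in> A" "bs \<in> A" for as bs
    unfolding B3_def A_def F_def e_def using that l \<tau> \<rho>(1) \<rho>0
    by (intro stage3) (auto simp: A_def)
  have good: "(1 - 7 * \<tau>) * K * real l ^ 3 < W (Qnd as bs) ds"
    if as: "as \<in> A" "as \<notin> B1" and bs: "bs \<in> A" "bs \<notin> B2 as" and ds: "ds \<in> A" "ds \<notin> B3 as bs" for as bs ds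
  proof -
    define M where "M = real K * (real l)\<^sup>2 * (real n)\<^sup>2"
    have M: "M > 0" using K l n by (simp add: M_def)
    have t1: "\<tau> * (real n)\<^sup>2 \<ge> 4 * n" using n\<tau> mult_right_mono[of 4 "\<tau> * n" n] by (simp add: power2_eq_square mult_ac)
    have "real (card \<Omega>) \<ge> (real n)\<^sup>2 * (1 - \<tau>)"
      unfolding card\<Omega> using t1 by (simp add: power2_eq_square algebra_simps)
    then have "real (card \<Omega>) * (K * l) \<ge> (real n)\<^sup>2 * (1 - \<tau>) * (K * l)" by (intro mult_right_mono) auto
    moreover have "(real K * l) * (K * l) \<le> \<tau> * (real n)\<^sup>2 * (K * l)" using Kl by (intro mult_right_mono) auto
    moreover have "Z1 as > (real (card \<Omega>) * K * l - (real K * l)\<^sup>2) - \<tau> * K * l * (real n)\<^sup>2"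
      using as by (auto simp: B1_def)
    ultimately have "Z1 as > (1 - 3 * \<tau>) * (K * l * (real n)\<^sup>2)"
      by (simp add: power2_eq_square algebra_simps)
    then have "l * Z1 as > l * ((1 - 3 * \<tau>) * (K * l * (real n)\<^sup>2))" using l by simp
    then have z1: "l * Z1 as > (1 - 3 * \<tau>) * M" by (simp add: M_def power2_eq_square mult_ac)
    have "real K * (real l)\<^sup>2 = \<rho> * (real n)\<^sup>2" using \<rho>(1) n by simp
    also have "\<dots> \<le> \<tau> * (real n)\<^sup>2" using \<rho>(2) by (intro mult_right_mono) auto
    finally have "real K * (real l)\<^sup>2 \<le> \<tau> * (real n)\<^sup>2" .
    then have "real K * (real l)\<^sup>2 * (real K * (real l)\<^sup>2) \<le> \<tau> * (real n)\<^sup>2 * (real K * (real l)\<^sup>2)"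
      by (intro mult_right_mono) auto
    then have "(real K * (real l)\<^sup>2)\<^sup>2 \<le> \<tau> * M" by (simp add: M_def power2_eq_square mult_ac)
    moreover have "Z2 as bs > (l * Z1 as - (real K * (real l)\<^sup>2)\<^sup>2) - \<tau> * M"
      using bs by (auto simp: B2_def M_def mult_ac)
    ultimately have z2: "Z2 as bs > (1 - 5 * \<tau>) * M" using z1 by (simp add: algebra_simps)
    have "4 * n * (K * (real l)\<^sup>2) \<le> \<tau> * (real n)\<^sup>2 * (K * (real l)\<^sup>2)" using t1 by (intro mult_right_mono) auto
    then have "4 * real n * K * (real l)\<^sup>2 \<le> \<tau> * M" by (simp add: M_def mult_ac)
    then have z3: "Z3 as bs > (1 - 6 * \<tau>) * M"
      using Q_le_Qnd[of as l bs] as bs z2 by (simp add: A_def Z2_def Z3_def algebra_simps)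
    have Z3: "Z3 as bs \<ge> 0" by (simp add: Z3_def sum_nonneg)
    have "real (card \<Omega>) \<le> (real n)\<^sup>2" unfolding card\<Omega> by (simp add: power2_eq_square algebra_simps)
    then have "l * Z3 as bs / card \<Omega> \<ge> l * Z3 as bs / (real n)\<^sup>2"
      using card\<Omega>_pos Z3 n by (intro divide_left_mono mult_pos_pos) auto
    moreover have "l * Z3 as bs / (real n)\<^sup>2 > l * ((1 - 6 * \<tau>) * M) / (real n)\<^sup>2"
      using z3 l n by (intro divide_strict_right_mono mult_strict_left_mono) auto
    moreover have "l * ((1 - 6 * \<tau>) * M) / (real n)\<^sup>2 = (1 - 6 * \<tau>) * (K * real l ^ 3)"
      using n by (simp add: M_def power2_eq_square power3_eq_cube)
    moreover have "W (Qnd as bs) ds > l * Z3 as bs / card \<Omega> - \<tau> * K * real l ^ 3"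
      using ds by (auto simp: B3_def)
    ultimately show ?thesis by (simp add: algebra_simps)
  qed
  have "{(as, bs, ds) \<in> A \<times> A \<times> A. W (Qnd as bs) ds \<le> (1 - 7 * \<tau>) * K * real l ^ 3}
    \<subseteq> B1 \<times> A \<times> A \<union> (SIGMA as:A. B2 as \<times> A) \<union> (SIGMA as:A. SIGMA bs:A. B3 as bs)"
    using good by (force simp: not_le)
  then have "card {(as, bs, ds) \<in> A \<times> A \<times> A. W (Qnd as bs) ds \<le> (1 - 7 * \<tau>) * K * real l ^ 3}
    \<le> card (B1 \<times> A \<times> A \<union> (SIGMA as:A. B2 as \<times> A) \<union> (SIGMA as:A. SIGMA bs:A. B3 as bs))"
    using finA by (intro card_mono) (auto simp: B1_def B2_def B3_def)
  also have "\<dots> \<le> card (B1 \<times> A \<times> A) + card (SIGMA as:A. B2 as \<times> A) + card (SIGMA as:A. SIGMA bs:A. B3 as bs)"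
    by (intro order.trans[OF card_Un_le] add_mono card_Un_le) auto
  also have "real \<dots> = card B1 * F * F + (\<Sum>as\<in>A. card (B2 as) * F) + (\<Sum>as\<in>A. \<Sum>bs\<in>A. real (card (B3 as bs)))"
    using finA by (simp add: card_cartesian_product card_SigmaI B2_def B3_def cA)
  also have "\<dots> \<le> F * e * F * F + (\<Sum>as\<in>A. F * e * F) + (\<Sum>as\<in>A. \<Sum>bs\<in>A. F * e)"
    using c1 c2 c3 F by (intro add_mono sum_mono mult_right_mono) auto
  also have "\<dots> = 3 * F ^ 3 * e" by (simp add: cA power3_eq_cube)
  also have "F ^ 3 = fact n ^ (3 * l)" by (simp add: F_def power_mult mult.commute[of 3])
  finally show ?thesis by (simp add: A_def e_def)
qed

end

section \<open>Latin rectangles\<close>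

text \<open>Bregman's bound \<open>(k!)^(n/k)\<close> for a \<open>k\<close>-regular 0/1 matrix of
  order \<open>n\<close>.\<close>

abbreviation bregman_factor :: "nat \<Rightarrow> nat \<Rightarrow> real" where
  "bregman_factor n k \<equiv> exp (n * (ln (fact k) / real k))"

definition rectangles :: "nat \<Rightarrow> nat \<Rightarrow> (nat \<Rightarrow> nat) list set" where
  "rectangles n j = {xs \<in> perm_lists {1..n} j. \<forall>i k. i < k \<and> k < j \<longrightarrow> (\<forall>c\<in>{1..n}. (xs ! i) c \<noteq> (xs ! k) c)}"

definition extensions :: "nat \<Rightarrow> (nat \<Rightarrow> nat) list \<Rightarrow> (nat \<Rightarrow> nat) set" where
  "extensions n xs = {\<pi> \<in> perms {1..n}. \<forall>x\<in>set xs. \<forall>c\<in>{1..n}. \<pi> c \<noteq> x c}"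

abbreviation free_symbols :: "nat \<Rightarrow> (nat \<Rightarrow> nat) list \<Rightarrow> nat \<Rightarrow> nat set" where
  "free_symbols n xs c \<equiv> {1..n} - (\<lambda>x. x c) ` set xs"

lemma finite_rectangles: "finite (rectangles n j)"
  unfolding rectangles_def by (rule finite_subset[OF Collect_restrict finite_perm_lists]) simp

lemma finite_extensions: "finite (extensions n xs)"
  unfolding extensions_def by (rule finite_subset[OF Collect_restrict finite_permutations]) simp

lemma rectangles_Suc: "rectangles n (Suc j) = (\<lambda>(xs, \<pi>). xs @ [\<pi>]) ` (SIGMA xs:rectangles n j. extensions n xs)"
proof (intro equalityI subsetI)
  fix ys assume ys: "ys \<in> rectangles n (Suc j)"
  then have len: "length ys = Suc j" by (simp add: rectangles_def perm_lists_def)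
  then obtain xs \<pi> where eq: "ys = xs @ [\<pi>]" by (metis append_butlast_last_id length_0_conv nat.distinct(1))
  have lx: "length xs = j" using len eq by simp
  have dis: "(ys ! i) c \<noteq> (ys ! k) c" if "i < k" "k < Suc j" "c \<in> {1..n}" for i k c
    using ys that by (auto simp: rectangles_def)
  have "xs \<in> rectangles n j"
    unfolding rectangles_def
  proof (intro CollectI conjI allI impI ballI)
    show "xs \<in> perm_lists {1..n} j" using ys lx eq by (auto simp: rectangles_def perm_lists_def)
    fix i k c assume "i < k \<and> k < j" "c \<in> {1..n}"
    then show "(xs ! i) c \<noteq> (xs ! k) c" using dis[of i k c] lx by (simp add: eq nth_append)
  qed
  moreover have "\<pi> \<in> extensions n xs"
    unfolding extensions_def
  proof (intro CollectI conjI ballI)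
    show "\<pi> permutes {1..n}" using ys eq by (auto simp: rectangles_def perm_lists_def)
    fix x c assume "x \<in> set xs" "c \<in> {1..n}"
    then obtain i where "i < j" "x = xs ! i" using lx by (auto simp: in_set_conv_nth)
    then show "\<pi> c \<noteq> x c" using dis[of i j c] lx \<open>c \<in> {1..n}\<close> by (simp add: eq nth_append)
  qed
  ultimately show "ys \<in> (\<lambda>(xs, \<pi>). xs @ [\<pi>]) ` (SIGMA xs:rectangles n j. extensions n xs)"
    using eq by (intro image_eqI[of _ _ "(xs, \<pi>)"]) auto
next
  fix ys assume "ys \<in> (\<lambda>(xs, \<pi>). xs @ [\<pi>]) ` (SIGMA xs:rectangles n j. extensions n xs)"
  then obtain xs \<pi> where eq: "ys = xs @ [\<pi>]" and xs: "xs \<in> rectangles n j" and \<pi>: "\<pi> \<in> extensions n xs" by auto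
  have lx: "length xs = j" using xs by (simp add: rectangles_def perm_lists_def)
  show "ys \<in> rectangles n (Suc j)"
    unfolding rectangles_def
  proof (intro CollectI conjI allI impI ballI)
    show "ys \<in> perm_lists {1..n} (Suc j)"
      using xs \<pi> by (auto simp: eq rectangles_def perm_lists_def extensions_def)
    fix i k c assume ik: "i < k \<and> k < Suc j" and c: "c \<in> {1..n}"
    show "(ys ! i) c \<noteq> (ys ! k) c"
    proof (cases "k = j")
      case True
      then have "xs ! i \<in> set xs" using ik lx by simp
      then have "\<pi> c \<noteq> (xs ! i) c" using \<pi> c by (auto simp: extensions_def)
      then show ?thesis using True ik lx by (simp add: eq nth_append)
    next
      case False
      then show ?thesis using ik c xs lx by (auto simp: eq nth_append rectangles_def)
    qed
  qed
qed

lemma card_extensions_eq: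
  "card (extensions n xs) = card (perfect_matchings {1..n} {1..n} (free_symbols n xs))"
proof -
  let ?N = "{1..n}" and ?f = "\<lambda>\<pi>. restrict \<pi> {1..n}" and ?g = "\<lambda>\<sigma> c. if c \<in> {1..n} then \<sigma> c else c"
  have "bij_betw ?f (extensions n xs) (perfect_matchings ?N ?N (free_symbols n xs))"
  proof (rule bij_betw_byWitness[where f' = ?g])
  show "\<forall>\<pi>\<in>extensions n xs. ?g (?f \<pi>) = \<pi>"
    by (auto simp: extensions_def fun_eq_iff permutes_def)
  show "\<forall>\<sigma>\<in>perfect_matchings ?N ?N (free_symbols n xs). ?f (?g \<sigma>) = \<sigma>"
    by (auto simp: perfect_matchings_def extensional_def fun_eq_iff)
  show "?f ` extensions n xs \<subseteq> perfect_matchings ?N ?N (free_symbols n xs)"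
  proof (rule image_subsetI)
    fix \<pi> assume "\<pi> \<in> extensions n xs"
    then have \<pi>: "\<pi> permutes ?N" "\<And>x c. x \<in> set xs \<Longrightarrow> c \<in> ?N \<Longrightarrow> \<pi> c \<noteq> x c" by (auto simp: extensions_def)
    have "bij_betw (?f \<pi>) ?N ?N"
      using permutes_imp_bij[OF \<pi>(1)] by (subst bij_betw_cong[of _ _ \<pi>]) auto
    moreover have "?f \<pi> c \<in> free_symbols n xs c" if c: "c \<in> ?N" for c
    proof -
      have "\<pi> c \<in> ?N" using permutes_in_image[OF \<pi>(1)] c by blast
      then show ?thesis using \<pi>(2)[OF _ c] c by auto
    qed
    ultimately show "?f \<pi> \<in> perfect_matchings ?N ?N (free_symbols n xs)"
      unfolding perfect_matchings_def by blast
  qed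
  show "?g ` perfect_matchings ?N ?N (free_symbols n xs) \<subseteq> extensions n xs"
  proof (rule image_subsetI)
    fix \<sigma> assume "\<sigma> \<in> perfect_matchings ?N ?N (free_symbols n xs)"
    then have \<sigma>: "bij_betw \<sigma> ?N ?N" "\<And>c. c \<in> ?N \<Longrightarrow> \<sigma> c \<notin> (\<lambda>x. x c) ` set xs"
      unfolding perfect_matchings_def by blast+
    have "bij_betw (?g \<sigma>) ?N ?N" using \<sigma>(1) by (subst bij_betw_cong[of _ _ \<sigma>]) auto
    then have "?g \<sigma> permutes ?N" by (rule bij_imp_permutes) auto
    moreover have "?g \<sigma> c \<noteq> x c" if "x \<in> set xs" "c \<in> ?N" for x c using \<sigma>(2)[OF that(2)] that by auto
    ultimately show "?g \<sigma> \<in> extensions n xs" unfolding extensions_def by blast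
  qed
  qed
  then show ?thesis by (rule bij_betw_same_card)
qed

text \<open>Each row uses one symbol per column and one column per symbol, and disagreement makes
  these different for different rows. So the graph of admissible cells is regular on both sides, as
  both permanent bounds require.\<close>

lemma rectangle_degrees:
  assumes xs: "xs \<in> rectangles n j" and s: "s \<in> {1..n}"
  shows "card (free_symbols n xs s) = n - j"
    and "card {c \<in> {1..n}. s \<in> free_symbols n xs c} = n - j"
proof -
  have len: "length xs = j" using xs by (simp add: rectangles_def perm_lists_def)
  have perm: "xs ! i permutes {1..n}" if "i < j" for i
    using xs that by (auto simp: rectangles_def perm_lists_def subset_iff)
  have dis: "i = k" if "i < j" "k < j" "c \<in> {1..n}" "(xs ! i) c = (xs ! k) c" for i k c
  proof -
    have "(xs ! i) c \<noteq> (xs ! k) c" if "i < k" "k < j" for i k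
      using xs that \<open>c \<in> {1..n}\<close> by (auto simp: rectangles_def)
    then show ?thesis using that by (metis linorder_neqE_nat)
  qed
  have set_xs: "set xs = (!) xs ` {..<j}" using len by (auto simp: set_conv_nth)
  have "card ((\<lambda>i. (xs ! i) s) ` {..<j}) = j"
    using dis s by (subst card_image) (auto intro!: inj_onI)
  moreover have "(\<lambda>i. (xs ! i) s) ` {..<j} \<subseteq> {1..n}"
    using perm permutes_in_image s by fastforce
  moreover have "(\<lambda>x. x s) ` set xs = (\<lambda>i. (xs ! i) s) ` {..<j}" unfolding set_xs image_image ..
  ultimately show "card (free_symbols n xs s) = n - j"
    by (simp add: card_Diff_subset finite_subset)
  let ?h = "\<lambda>i. inv (xs ! i) s"
  have h: "?h i \<in> {1..n}" "(xs ! i) (?h i) = s" if "i < j" for i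
    using permutes_in_image[OF permutes_inv[OF perm[OF that]]] s permutes_inverses[OF perm[OF that]] by auto
  have "inj_on ?h {..<j}"
    using h dis by (intro inj_onI) (metis lessThan_iff)
  then have "card (?h ` {..<j}) = j" by (simp add: card_image)
  moreover have "?h ` {..<j} \<subseteq> {1..n}" using h by auto
  moreover have "{c \<in> {1..n}. s \<in> free_symbols n xs c} = {1..n} - ?h ` {..<j}"
  proof -
    have "s \<in> (\<lambda>x. x c) ` set xs \<longleftrightarrow> c \<in> ?h ` {..<j}" for c
    proof -
      have "(xs ! i) c = s \<longleftrightarrow> c = ?h i" if "i < j" for i
        using h(2)[OF that] permutes_inverses(2)[OF perm[OF that], of c] by metis
      then have "(\<exists>i<j. s = (xs ! i) c) \<longleftrightarrow> (\<exists>i<j. c = ?h i)" by metis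
      then show ?thesis unfolding set_xs image_image by (simp add: image_iff Bex_def)
    qed
    then show ?thesis using s by auto
  qed
  ultimately show "card {c \<in> {1..n}. s \<in> free_symbols n xs c} = n - j"
    by (simp add: card_Diff_subset finite_subset)
qed

lemma card_extensions_ge:
  assumes xs: "xs \<in> rectangles n j" and j: "j < n"
  shows "(real (n - j) / exp 1) ^ n \<le> card (extensions n xs)"
proof -
  have "(real (n - j) / exp 1) ^ n \<le> card (perfect_matchings {1..n} {1..n} (free_symbols n xs))"
    using rectangle_degrees[OF xs] j by (intro regular_matchings_ge) (auto simp: Int_absorb2)
  then show ?thesis using j by (simp add: card_extensions_eq of_nat_diff)
qed

lemma card_extensions_le:
  assumes xs: "xs \<in> rectangles n j"
  shows "card (extensions n xs) \<le> bregman_factor n (n - j)"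
proof (cases "extensions n xs = {}")
  case False
  let ?M = "perfect_matchings {1..n} {1..n} (free_symbols n xs)"
  have pos: "card (extensions n xs) > 0" using False by (simp add: card_gt_0_iff finite_extensions)
  then have "?M \<noteq> {}" unfolding card_extensions_eq by auto
  then have "ln (card ?M) \<le> (\<Sum>c\<in>{1..n}. ln (fact (card (free_symbols n xs c \<inter> {1..n})))
       / card (free_symbols n xs c \<inter> {1..n}))"
    by (intro bregman) auto
  also have "\<dots> = (\<Sum>c\<in>{1..n}. ln (fact (n - j)) / real (n - j))"
    using rectangle_degrees(1)[OF xs] by (intro sum.cong) (auto simp: Int_absorb2)
  finally have "ln (card (extensions n xs)) \<le> n * (ln (fact (n - j)) / real (n - j))"
    by (simp add: card_extensions_eq)
  then have "exp (ln (card (extensions n xs))) \<le> bregman_factor n (n - j)" by simp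
  then show ?thesis using pos by simp
qed simp

section \<open>Counting Latin rectangles and their completions\<close>

lemma card_rectangles_ge:
  assumes "j \<le> n"
  shows "(\<Prod>i<j. (real (n - i) / exp 1) ^ n) \<le> card (rectangles n j)"
  using assms
proof (induction j)
  case 0
  have "rectangles n 0 = {[]}" by (auto simp: rectangles_def perm_lists_def)
  then show ?case by simp
next
  case (Suc j)
  have "(\<Prod>i<Suc j. (real (n - i) / exp 1) ^ n) = (\<Prod>i<j. (real (n - i) / exp 1) ^ n) * (real (n - j) / exp 1) ^ n" by simp
  also have "\<dots> \<le> card (rectangles n j) * (real (n - j) / exp 1) ^ n"
    using Suc by (intro mult_right_mono zero_le_power divide_nonneg_nonneg) auto
  also have "\<dots> = (\<Sum>xs\<in>rectangles n j. (real (n - j) / exp 1) ^ n)" by simp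
  also have "\<dots> \<le> (\<Sum>xs\<in>rectangles n j. real (card (extensions n xs)))"
    using Suc by (intro sum_mono card_extensions_ge) auto
  also have "\<dots> = card (SIGMA xs:rectangles n j. extensions n xs)"
    using finite_rectangles finite_extensions by simp
  also have "\<dots> = card (rectangles n (Suc j))"
    unfolding rectangles_Suc by (subst card_image) (auto simp: inj_on_def)
  finally show ?case .
qed

abbreviation completions :: "nat \<Rightarrow> nat \<Rightarrow> nat \<Rightarrow> (nat \<Rightarrow> nat) list set \<Rightarrow> (nat \<Rightarrow> nat) list set" where
  "completions n m j R \<equiv> {xs \<in> rectangles n j. take m xs \<in> R}"

text \<open>Bregman is spent only on the rows from \<open>m\<close> on, so the choice of the first
  rows enters as \<open>card R\<close> itself; this is what makes the estimate a bound on a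
  density.\<close>

lemma card_completions_le:
  assumes R: "R \<subseteq> rectangles n m" and j: "m \<le> j"
  shows "card (completions n m j R)
     \<le> card R * (\<Prod>i=m..<j. bregman_factor n (n - i))"
  using j
proof (induction j rule: dec_induct)
  case base
  have "completions n m m R \<subseteq> R" by (auto simp: rectangles_def perm_lists_def)
  then show ?case using finite_subset[OF R finite_rectangles] by (simp add: card_mono)
next
  case (step j)
  let ?X = "completions n m j R" and ?U = "bregman_factor n (n - j)"
  have "completions n m (Suc j) R \<subseteq> (\<lambda>(xs, \<pi>). xs @ [\<pi>]) ` (SIGMA xs:?X. extensions n xs)"
    unfolding rectangles_Suc using step.hyps by (auto simp: rectangles_def perm_lists_def)
  then have "card (completions n m (Suc j) R) \<le> card (SIGMA xs:?X. extensions n xs)"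
    using finite_rectangles finite_extensions by (intro surj_card_le) auto
  also have "real \<dots> = (\<Sum>xs\<in>?X. real (card (extensions n xs)))"
    using finite_rectangles finite_extensions by simp
  also have "\<dots> \<le> (\<Sum>xs\<in>?X. ?U)" by (intro sum_mono card_extensions_le) auto
  also have "\<dots> = card ?X * ?U" by simp
  also have "\<dots> \<le> (card R * (\<Prod>i=m..<j. bregman_factor n (n - i))) * ?U"
    by (intro mult_right_mono step.IH) auto
  finally show ?case using step.hyps by (simp add: mult.assoc)
qed

section \<open>Cuboctahedra in Latin squares\<close>

text \<open>Padding by the identity outside \<open>{1..n}\<close> makes each row a permutation in
  the sense of \<open>permutes\<close>. Lists count from 0, so row \<open>r\<close> sits at position
  \<open>r - 1\<close>.\<close>

definition rows :: "nat \<Rightarrow> (nat \<Rightarrow> nat \<Rightarrow> nat) \<Rightarrow> (nat \<Rightarrow> nat) list" where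
  "rows n L = map (\<lambda>r c. if c \<in> {1..n} then L r c else c) [1..<Suc n]"

lemma length_rows [simp]: "length (rows n L) = n"
  by (simp add: rows_def del: upt_Suc)

lemma nth_rows: "i < n \<Longrightarrow> (rows n L ! i) c = (if c \<in> {1..n} then L (Suc i) c else c)"
  by (simp add: rows_def del: upt_Suc)

abbreviation arrays :: "nat \<Rightarrow> (nat \<Rightarrow> nat \<Rightarrow> nat) set" where
  "arrays n \<equiv> {1..n} \<rightarrow>\<^sub>E ({1..n} \<rightarrow>\<^sub>E {1..n})"

lemma latin_squaresI:
  assumes "L \<in> arrays n"
    and "\<And>r s. r \<in> {1..n} \<Longrightarrow> s \<in> {1..n} \<Longrightarrow> \<exists>!c. c \<in> {1..n} \<and> L r c = s"
    and "\<And>c s. c \<in> {1..n} \<Longrightarrow> s \<in> {1..n} \<Longrightarrow> \<exists>!r. r \<in> {1..n} \<and> L r c = s"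
  shows "L \<in> latin_squares n"
  unfolding latin_squares_def using assms by (intro CollectI conjI ballI)

lemma latin_squaresD:
  assumes "L \<in> latin_squares n"
  shows "L \<in> arrays n"
    and "\<And>r s. r \<in> {1..n} \<Longrightarrow> s \<in> {1..n} \<Longrightarrow> \<exists>!c. c \<in> {1..n} \<and> L r c = s"
    and "\<And>c s. c \<in> {1..n} \<Longrightarrow> s \<in> {1..n} \<Longrightarrow> \<exists>!r. r \<in> {1..n} \<and> L r c = s"
  using assms unfolding latin_squares_def by simp_all

lemma latin_row_bij:
  assumes "L \<in> latin_squares n" "r \<in> {1..n}"
  shows "bij_betw (L r) {1..n} {1..n}"
proof -
  have ex: "\<exists>!c. c \<in> {1..n} \<and> L r c = s" if "s \<in> {1..n}" for s
    using assms that by (auto simp: latin_squares_def)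
  have mem: "L r c \<in> {1..n}" if "c \<in> {1..n}" for c
  proof -
    have "L \<in> arrays n" using assms(1) by (simp add: latin_squares_def)
    from PiE_mem[OF PiE_mem[OF this assms(2)] that] show ?thesis .
  qed
  have "inj_on (L r) {1..n}"
  proof (rule inj_onI)
    fix c d assume cd: "c \<in> {1..n}" "d \<in> {1..n}" "L r c = L r d"
    then show "c = d" using ex[OF mem[OF cd(1)]] by metis
  qed
  moreover have "L r ` {1..n} = {1..n}"
  proof (intro equalityI subsetI)
    fix s assume "s \<in> {1..n}"
    from ex1_implies_ex[OF ex[OF this]] obtain c where "c \<in> {1..n}" "L r c = s" by auto
    then show "s \<in> L r ` {1..n}" by auto
  qed (use mem in auto)
  ultimately show ?thesis by (simp add: bij_betw_def)
qed

lemma latin_col_inj: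
  assumes "L \<in> latin_squares n" "r \<in> {1..n}" "r' \<in> {1..n}" "c \<in> {1..n}" "L r c = L r' c"
  shows "r = r'"
proof -
  have "L r c \<in> {1..n}" using bij_betwE[OF latin_row_bij[OF assms(1,2)]] assms(4) by blast
  then have "\<exists>!q. q \<in> {1..n} \<and> L q c = L r c" using assms(1,4) by (auto simp: latin_squares_def)
  then show ?thesis using assms by metis
qed

lemma rows_in_rectangles:
  assumes L: "L \<in> latin_squares n"
  shows "rows n L \<in> rectangles n n"
  unfolding rectangles_def perm_lists_def
proof (intro CollectI conjI allI impI ballI subsetI)
  fix \<pi> assume "\<pi> \<in> set (rows n L)"
  then obtain i where i: "i < n" "\<pi> = rows n L ! i" by (auto simp: in_set_conv_nth)
  have eq: "\<pi> = (\<lambda>c. if c \<in> {1..n} then L (Suc i) c else c)" using nth_rows[OF i(1)] i(2) by auto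
  have "bij_betw \<pi> {1..n} {1..n}"
    using latin_row_bij[OF L, of "Suc i"] i unfolding eq by (subst bij_betw_cong[of _ _ "L (Suc i)"]) auto
  then show "\<pi> permutes {1..n}" by (rule bij_imp_permutes) (auto simp: eq)
next
  fix i k c assume "i < k \<and> k < n" "c \<in> {1..n}"
  then show "(rows n L ! i) c \<noteq> (rows n L ! k) c"
    using latin_col_inj[OF L, of "Suc i" "Suc k" c] by (auto simp: nth_rows)
qed simp

lemma inj_on_rows: "inj_on (rows n) (latin_squares n)"
proof (rule inj_onI)
  fix L L' assume L: "L \<in> latin_squares n" "L' \<in> latin_squares n" and eq: "rows n L = rows n L'"
  have ext: "L \<in> arrays n" "L' \<in> arrays n"
    using L by (auto simp: latin_squares_def)
  show "L = L'"
  proof (rule PiE_ext[OF ext])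
    fix r assume r: "r \<in> {1..n}"
    show "L r = L' r"
    proof (rule PiE_ext[of _ "{1..n}" "\<lambda>_. {1..n}"])
      show "L r \<in> {1..n} \<rightarrow>\<^sub>E {1..n}" "L' r \<in> {1..n} \<rightarrow>\<^sub>E {1..n}" using PiE_mem[OF ext(1) r] PiE_mem[OF ext(2) r] by auto
      fix c assume c: "c \<in> {1..n}"
      show "L r c = L' r c"
      proof -
        have "r - 1 < n" "Suc (r - 1) = r" using r by auto
        then show ?thesis
          using arg_cong[OF eq, of "\<lambda>xs. (xs ! (r - 1)) c"] c nth_rows[of "r - 1" n L c] nth_rows[of "r - 1" n L' c]
          by (simp only: if_True)
      qed
    qed
  qed
qed

lemma rectangles_subset_rows: "rectangles n n \<subseteq> rows n ` latin_squares n"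
proof
  fix xs assume xs: "xs \<in> rectangles n n"
  define L where "L = (\<lambda>r\<in>{1..n}. \<lambda>c\<in>{1..n}. (xs ! (r - 1)) c)"
  have len: "length xs = n" using xs by (simp add: rectangles_def perm_lists_def)
  have perm: "xs ! i permutes {1..n}" if "i < n" for i
    using xs that by (auto simp: rectangles_def perm_lists_def subset_iff)
  have dis: "i = k" if "i < n" "k < n" "c \<in> {1..n}" "(xs ! i) c = (xs ! k) c" for i k c
  proof -
    have "(xs ! i) c \<noteq> (xs ! k) c" if "i < k" "k < n" for i k
      using xs that \<open>c \<in> {1..n}\<close> by (auto simp: rectangles_def)
    then show ?thesis using that by (metis linorder_neqE_nat)
  qed
  have L: "L r c = (xs ! (r - 1)) c" if "r \<in> {1..n}" "c \<in> {1..n}" for r c using that by (simp add: L_def)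
  have mem: "(xs ! (r - 1)) c \<in> {1..n}" if "r \<in> {1..n}" "c \<in> {1..n}" for r c
    using permutes_in_image[OF perm[of "r - 1"], of c] that by auto
  have "L \<in> arrays n"
    using mem unfolding L_def by (intro restrict_PiE_iff[THEN iffD2] ballI) (simp add: restrict_PiE_iff)
  moreover have "\<exists>!c. c \<in> {1..n} \<and> L r c = s" if r: "r \<in> {1..n}" and s: "s \<in> {1..n}" for r s
  proof (rule ex1I[of _ "inv (xs ! (r - 1)) s"])
    have p: "xs ! (r - 1) permutes {1..n}" using perm r by auto
    have m: "inv (xs ! (r - 1)) s \<in> {1..n}" using permutes_in_image[OF permutes_inv[OF p]] s by blast
    then show "inv (xs ! (r - 1)) s \<in> {1..n} \<and> L r (inv (xs ! (r - 1)) s) = s"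
      using L[OF r m] permutes_inverses[OF p] by auto
    fix c assume "c \<in> {1..n} \<and> L r c = s"
    then show "c = inv (xs ! (r - 1)) s" using L[OF r, of c] permutes_inverses[OF p] by auto
  qed
  moreover have "\<exists>!r. r \<in> {1..n} \<and> L r c = s" if c: "c \<in> {1..n}" and s: "s \<in> {1..n}" for c s
  proof -
    let ?f = "\<lambda>r. L r c"
    have inj: "inj_on ?f {1..n}"
    proof (rule inj_onI)
      fix r r' assume rr: "r \<in> {1..n}" "r' \<in> {1..n}" "L r c = L r' c"
      then have "(xs ! (r - 1)) c = (xs ! (r' - 1)) c" using L[OF rr(1) c] L[OF rr(2) c] by simp
      moreover have "r - 1 < n" "r' - 1 < n" using rr by auto
      ultimately have "r - 1 = r' - 1" using dis c by blast
      then show "r = r'" using rr by auto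
    qed
    have "?f ` {1..n} \<subseteq> {1..n}"
    proof (rule image_subsetI)
      fix r assume "r \<in> {1..n}"
      then show "L r c \<in> {1..n}" using L[OF _ c] mem[OF _ c] by simp
    qed
    then have "?f ` {1..n} = {1..n}" using inj by (rule endo_inj_surj[OF finite_atLeastAtMost])
    then have "s \<in> ?f ` {1..n}" using s by simp
    then obtain r where r: "r \<in> {1..n}" "L r c = s" by auto
    show ?thesis
    proof (rule ex1I[of _ r])
      fix q assume "q \<in> {1..n} \<and> L q c = s"
      then show "q = r" using r inj by (auto dest: inj_onD)
    qed (use r in simp)
  qed
  ultimately have "L \<in> latin_squares n" by (rule latin_squaresI)
  moreover have "rows n L = xs"
  proof (rule nth_equalityI)
    fix i assume i: "i < length (rows n L)"
    show "rows n L ! i = xs ! i"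
    proof
      fix c show "(rows n L ! i) c = (xs ! i) c"
        using i L[of "Suc i" c] perm[of i] by (auto simp: nth_rows permutes_def)
    qed
  qed (simp add: len)
  ultimately show "xs \<in> rows n ` latin_squares n" by (intro image_eqI[of _ _ L]) auto
qed

lemma card_latin_squares: "card (latin_squares n) = card (rectangles n n)"
proof -
  have "rows n ` latin_squares n = rectangles n n"
    using rows_in_rectangles rectangles_subset_rows by blast
  then show ?thesis using card_image[OF inj_on_rows] by metis
qed

section \<open>Random relabelling of rows\<close>

lemma latin_comp_perm:
  assumes L: "L \<in> latin_squares n" and \<sigma>: "\<sigma> permutes {1..n}"
  shows "L \<circ> \<sigma> \<in> latin_squares n"
proof -
  have in\<sigma>: "\<sigma> r \<in> {1..n} \<longleftrightarrow> r \<in> {1..n}" for r by (rule permutes_in_image[OF \<sigma>])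
  have ext: "L \<in> arrays n" using L by (auto simp: latin_squares_def)
  have "L \<circ> \<sigma> \<in> arrays n"
  proof (rule PiE_I)
    fix r show "(L \<circ> \<sigma>) r \<in> {1..n} \<rightarrow>\<^sub>E {1..n}" if "r \<in> {1..n}"
      unfolding o_apply using that in\<sigma> by (intro PiE_mem[OF ext]) blast
    show "(L \<circ> \<sigma>) r = undefined" if "r \<notin> {1..n}"
      unfolding o_apply using that in\<sigma> by (intro PiE_arb[OF ext]) blast
  qed
  moreover have "\<exists>!c. c \<in> {1..n} \<and> (L \<circ> \<sigma>) r c = s" if "r \<in> {1..n}" "s \<in> {1..n}" for r s
  proof -
    have "\<sigma> r \<in> {1..n}" using that in\<sigma> by blast
    then show ?thesis unfolding o_apply using latin_squaresD(2)[OF L] that by blast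
  qed
  moreover have "\<exists>!r. r \<in> {1..n} \<and> (L \<circ> \<sigma>) r c = s" if "c \<in> {1..n}" "s \<in> {1..n}" for c s
  proof -
    note ex = latin_squaresD(3)[OF L that]
    from ex1_implies_ex[OF ex] obtain r where r: "r \<in> {1..n}" "L r c = s" by auto
    show ?thesis
    proof (rule ex1I[of _ "inv \<sigma> r"])
      show "inv \<sigma> r \<in> {1..n} \<and> (L \<circ> \<sigma>) (inv \<sigma> r) c = s"
        using r permutes_inverses(1)[OF \<sigma>] permutes_in_image[OF permutes_inv[OF \<sigma>], of r] by simp
      fix q assume q: "q \<in> {1..n} \<and> (L \<circ> \<sigma>) q c = s"
      then have "\<sigma> q \<in> {1..n} \<and> L (\<sigma> q) c = s" using in\<sigma>[of q] by simp
      then have "\<sigma> q = r" using ex r by metis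
      then show "q = inv \<sigma> r" using permutes_inverses(2)[OF \<sigma>] by metis
    qed
  qed
  ultimately show ?thesis by (rule latin_squaresI)
qed

fun row_list :: "row_col_pairs \<Rightarrow> nat list" where
  "row_list ((r1, r2), (r1', r2'), _) = [r1, r2, r1', r2']"

definition cubo_in :: "nat \<Rightarrow> nat list set \<Rightarrow> (nat \<Rightarrow> nat \<Rightarrow> nat) \<Rightarrow> row_col_pairs set" where
  "cubo_in n B L = {q \<in> cuboctahedra n L. nondegenerate L q \<and> row_list q \<in> B}"

lemma finite_cubo_in: "finite (cubo_in n B L)"
  unfolding cubo_in_def by (rule finite_subset[OF Collect_restrict finite_cuboctahedra])

fun map_rows :: "(nat \<Rightarrow> nat) \<Rightarrow> row_col_pairs \<Rightarrow> row_col_pairs" where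
  "map_rows \<sigma> ((r1, r2), (r1', r2'), cs) = ((\<sigma> r1, \<sigma> r2), (\<sigma> r1', \<sigma> r2'), cs)"

lemma card_cubo_in_comp:
  assumes \<sigma>: "\<sigma> permutes {1..n}"
  shows "card (cubo_in n B (L \<circ> inv \<sigma>)) = card {q \<in> cuboctahedra n L. nondegenerate L q \<and> map \<sigma> (row_list q) \<in> B}"
proof (rule bij_betw_same_card)
  let ?Y = "{q \<in> cuboctahedra n L. nondegenerate L q \<and> map \<sigma> (row_list q) \<in> B}"
  note inv = permutes_inverses[OF \<sigma>]
  have in\<sigma>: "\<sigma> r \<in> {1..n} \<longleftrightarrow> r \<in> {1..n}" "inv \<sigma> r \<in> {1..n} \<longleftrightarrow> r \<in> {1..n}" for r
    using permutes_in_image[OF \<sigma>] permutes_in_image[OF permutes_inv[OF \<sigma>]] by auto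
  have inj: "inv \<sigma> a = inv \<sigma> b \<longleftrightarrow> a = b" "\<sigma> a = \<sigma> b \<longleftrightarrow> a = b" for a b using inv by metis+
  show "bij_betw (map_rows (inv \<sigma>)) (cubo_in n B (L \<circ> inv \<sigma>))
     ?Y"
  proof (rule bij_betw_byWitness[where f' = "map_rows \<sigma>"])
    show "\<forall>q\<in>cubo_in n B (L \<circ> inv \<sigma>). map_rows \<sigma> (map_rows (inv \<sigma>) q) = q" using inv by auto
    show "\<forall>q\<in>?Y. map_rows (inv \<sigma>) (map_rows \<sigma> q) = q"
      using inv by auto
    show "map_rows (inv \<sigma>) ` cubo_in n B (L \<circ> inv \<sigma>)
      \<subseteq> ?Y"
      using inv in\<sigma> inj by (auto simp: cubo_in_def cuboctahedra_def simp del: atLeastAtMost_iff)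
    show "map_rows \<sigma> ` ?Y
      \<subseteq> cubo_in n B (L \<circ> inv \<sigma>)"
      using inv in\<sigma> inj by (auto simp: cubo_in_def cuboctahedra_def simp del: atLeastAtMost_iff)
  qed
qed

text \<open>A nondegenerate cuboctahedron occupies four distinct rows, and a random relabelling
  carries them to a uniform 4-tuple of distinct rows.\<close>

lemma average_cubo_in:
  assumes B: "B \<subseteq> dlists {1..n} 4"
  shows "average (perms {1..n}) (\<lambda>\<sigma>. card (cubo_in n B (L \<circ> inv \<sigma>)))
     = X_H n L * (card B / card (dlists {1..n} 4))"
proof -
  let ?ND = "{q \<in> cuboctahedra n L. nondegenerate L q}"
  have fin: "finite ?ND" by (rule finite_subset[OF Collect_restrict finite_cuboctahedra])
  have dl: "row_list q \<in> dlists {1..n} 4" if "q \<in> ?ND" for q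
    using that by (auto simp: cuboctahedra_def dlists_def)
  have "average (perms {1..n}) (\<lambda>\<sigma>. card (cubo_in n B (L \<circ> inv \<sigma>)))
      = average (perms {1..n}) (\<lambda>\<sigma>. \<Sum>q\<in>?ND. of_bool (map \<sigma> (row_list q) \<in> B))"
  proof (rule average_cong)
    fix \<sigma> assume "\<sigma> \<in> perms {1..n}"
    then have "card (cubo_in n B (L \<circ> inv \<sigma>)) = card {q \<in> ?ND. map \<sigma> (row_list q) \<in> B}"
      by (subst card_cubo_in_comp) (auto intro!: arg_cong[where f = card])
    also have "real \<dots> = (\<Sum>q\<in>?ND. of_bool (map \<sigma> (row_list q) \<in> B))"
      using fin by (simp add: of_bool_def sum.If_cases Int_def)
    finally show "real (card (cubo_in n B (L \<circ> inv \<sigma>))) = (\<Sum>q\<in>?ND. of_bool (map \<sigma> (row_list q) \<in> B))" .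
  qed
  also have "\<dots> = (\<Sum>q\<in>?ND. card B / card (dlists {1..n} 4))"
    unfolding average_sum using dl B by (intro sum.cong average_map_perm) auto
  also have "\<dots> = X_H n L * (card B / card (dlists {1..n} 4))" by (simp add: X_H_def)
  finally show ?thesis .
qed

text \<open>Markov's inequality over the relabellings, then double counting: a square with few
  cuboctahedra falls below \<open>T\<close> inside \<open>B\<close> for a definite fraction of the
  relabellings, and each single relabelling is injective on Latin squares.\<close>

lemma few_cubo_transfer:
  fixes X T :: real
  assumes B: "B \<subseteq> dlists {1..n} 4" and T: "T > 0"
    and \<B>: "\<B> = {L \<in> latin_squares n. real (X_H n L) \<le> X}"
  shows "card \<B> * (1 - X * (card B / card (dlists {1..n} 4)) / T)
     \<le> card {L \<in> latin_squares n. card (cubo_in n B L) < T}"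
proof -
  let ?p = "card B / card (dlists {1..n} 4)" and ?P = "perms {1..n}"
  let ?few = "{L \<in> latin_squares n. card (cubo_in n B L) < T}"
  have fin: "finite \<B>" unfolding \<B> by (rule finite_subset[OF Collect_restrict finite_latin_squares])
  have "1 - X * ?p / T \<le> average ?P (\<lambda>\<sigma>. of_bool (card (cubo_in n B (L \<circ> inv \<sigma>)) < T))" if L: "L \<in> \<B>" for L
  proof -
    have "1 - X_H n L * ?p / T = average ?P (\<lambda>\<sigma>. 1 - card (cubo_in n B (L \<circ> inv \<sigma>)) * (1 / T))"
      by (simp only: average_diff average_multc average_cubo_in[OF B] average_const_perms[OF finite_atLeastAtMost]) simp
    also have "\<dots> \<le> average ?P (\<lambda>\<sigma>. of_bool (card (cubo_in n B (L \<circ> inv \<sigma>)) < T))"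
      using T by (intro average_mono) (auto simp: field_simps split: split_of_bool)
    finally have "1 - X_H n L * ?p / T \<le> average ?P (\<lambda>\<sigma>. of_bool (card (cubo_in n B (L \<circ> inv \<sigma>)) < T))" .
    moreover have "X_H n L * ?p / T \<le> X * ?p / T"
      using L T by (intro divide_right_mono mult_right_mono) (auto simp: \<B>)
    ultimately show ?thesis by linarith
  qed
  then have "(\<Sum>L\<in>\<B>. 1 - X * ?p / T) \<le> (\<Sum>L\<in>\<B>. average ?P (\<lambda>\<sigma>. of_bool (card (cubo_in n B (L \<circ> inv \<sigma>)) < T)))"
    by (rule sum_mono)
  also have "\<dots> = average ?P (\<lambda>\<sigma>. \<Sum>L\<in>\<B>. of_bool (card (cubo_in n B (L \<circ> inv \<sigma>)) < T))"
    by (rule average_sum[symmetric])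
  also have "\<dots> \<le> average ?P (\<lambda>_. card ?few)"
  proof (rule average_mono)
    fix \<sigma> assume "\<sigma> \<in> ?P"
    then have \<sigma>: "\<sigma> permutes {1..n}" by simp
    let ?G = "{L \<in> \<B>. card (cubo_in n B (L \<circ> inv \<sigma>)) < T}"
    have "(\<Sum>L\<in>\<B>. of_bool (card (cubo_in n B (L \<circ> inv \<sigma>)) < T)) = real (card ?G)"
      using fin by (simp add: of_bool_def sum.If_cases Int_def)
    also have "\<dots> \<le> card ?few"
    proof (intro of_nat_mono card_inj_on_le[where f = "\<lambda>L. L \<circ> inv \<sigma>"])
      show "inj_on (\<lambda>L. L \<circ> inv \<sigma>) ?G"
      proof (rule inj_onI)
        fix L L' assume "L \<circ> inv \<sigma> = L' \<circ> inv \<sigma>"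
        then have "L \<circ> inv \<sigma> \<circ> \<sigma> = L' \<circ> inv \<sigma> \<circ> \<sigma>" by simp
        then show "L = L'" by (simp add: comp_assoc permutes_inv_o[OF \<sigma>])
      qed
      show "(\<lambda>L. L \<circ> inv \<sigma>) ` ?G \<subseteq> ?few"
        using latin_comp_perm[OF _ permutes_inv[OF \<sigma>]] by (auto simp: \<B>)
      show "finite ?few" by (rule finite_subset[OF Collect_restrict finite_latin_squares])
    qed
    finally show "(\<Sum>L\<in>\<B>. of_bool (card (cubo_in n B (L \<circ> inv \<sigma>)) < T)) \<le> real (card ?few)" .
  qed
  also have "\<dots> = card ?few" by (rule average_const_perms) simp
  finally show ?thesis by simp
qed

section \<open>The four blocks of rows\<close>

definition blocks :: "nat \<Rightarrow> nat \<Rightarrow> nat list set" where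
  "blocks K l = {[r1, r2, r1', r2'] | r1 r2 r1' r2'. r1' \<in> {1..K} \<and> r1 \<in> {K+1..K+l}
     \<and> r2' \<in> {K+l+1..K+2*l} \<and> r2 \<in> {K+2*l+1..K+3*l}}"

lemma blocks_subset: "K + 3 * l \<le> n \<Longrightarrow> blocks K l \<subseteq> dlists {1..n} 4"
  by (auto simp: blocks_def dlists_def)

lemma card_blocks_le: "card (blocks K l) \<le> K * l ^ 3"
proof -
  let ?P = "{K+1..K+l} \<times> {K+2*l+1..K+3*l} \<times> {1..K} \<times> {K+l+1..K+2*l}"
  have "blocks K l \<subseteq> (\<lambda>(r1, r2, r1', r2'). [r1, r2, r1', r2']) ` ?P"
  proof
    fix z assume "z \<in> blocks K l"
    then obtain r1 r2 r1' r2' where "z = [r1, r2, r1', r2']" "(r1, r2, r1', r2') \<in> ?P"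
      unfolding blocks_def by blast
    then show "z \<in> (\<lambda>(r1, r2, r1', r2'). [r1, r2, r1', r2']) ` ?P"
      by (intro image_eqI[of _ _ "(r1, r2, r1', r2')"]) auto
  qed
  then have "card (blocks K l) \<le> card ?P" by (rule surj_card_le[rotated]) simp
  also have "card ?P = K * l ^ 3" by (simp add: card_cartesian_product power3_eq_cube)
  finally show ?thesis .
qed

lemma rectangles_disagree:
  assumes "xs \<in> rectangles n j" "i < j" "k < j" "i \<noteq> k" "c \<in> {1..n}"
  shows "(xs ! i) c \<noteq> (xs ! k) c"
proof -
  have "(xs ! i) c \<noteq> (xs ! k) c" if "i < k" "k < j" for i k
    using assms(1,5) that by (auto simp: rectangles_def)
  then show ?thesis using assms(2-4) by (metis linorder_neqE_nat)
qed

lemma family_rectangle: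
  assumes "As \<in> rectangles n K" "n \<ge> 2" "K > 0"
  shows "family {1..n} As n K"
proof
  show "length As = K" using assms by (simp add: rectangles_def perm_lists_def)
  show "a permutes {1..n}" if "a \<in> set As" for a using assms that by (auto simp: rectangles_def perm_lists_def)
  show "(As ! i) x \<noteq> (As ! j) x" if "i < j" "j < K" "x \<in> {1..n}" for i j x
    using assms that by (intro rectangles_disagree) auto
qed (use assms in auto)

lemma take_rectangle:
  assumes "xs \<in> rectangles n j" "m \<le> j"
  shows "take m xs \<in> rectangles n m"
  using assms set_take_subset[of m xs] by (fastforce simp: rectangles_def perm_lists_def)

definition slice :: "nat \<Rightarrow> nat \<Rightarrow> 'a list \<Rightarrow> 'a list" where
  "slice k l xs = take l (drop k xs)"

lemma length_slice: "k + l \<le> length xs \<Longrightarrow> length (slice k l xs) = l"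
  by (simp add: slice_def)

lemma nth_slice: "k + l \<le> length xs \<Longrightarrow> i < l \<Longrightarrow> slice k l xs ! i = xs ! (k + i)"
  by (simp add: slice_def)

lemma slice_take: "k + l \<le> m \<Longrightarrow> slice k l (take m xs) = slice k l xs"
  by (simp add: slice_def drop_take min_def)

lemma in_set_slice:
  assumes "x \<in> set (slice k l xs)" "k + l \<le> length xs"
  obtains i where "i < l" "x = xs ! (k + i)"
  using assms by (metis in_set_conv_nth length_slice nth_slice)

text \<open>Rows \<open>r\<^sub>1', r\<^sub>1, r\<^sub>2', r\<^sub>2\<close> are drawn from four consecutive blocks of lengths \<open>K, l, l, l\<close>.\<close>

definition block_count :: "nat \<Rightarrow> nat \<Rightarrow> nat \<Rightarrow> (nat \<Rightarrow> nat) list \<Rightarrow> real" where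
  "block_count n K l xs = family.W {1..n}
     (family.Qnd (take K xs) (slice K l xs) (slice (K + l) l xs)) (slice (K + 2 * l) l xs)"

text \<open>A hit is a row \<open>d\<close> with columns \<open>(c1, c2)\<close> that has some
  witness \<open>(a', a, b)\<close>; rows \<open>a, d, a', b\<close> in the roles
  \<open>r1, r2, r1', r2'\<close> and the columns \<open>e1, e2\<close> complete it to a
  cuboctahedron. One witness suffices: \<open>g\<close> recovers the hit from the cuboctahedron, so
  distinct hits give distinct cuboctahedra.\<close>

lemma block_count_le_cubo:
  assumes L: "L \<in> latin_squares n" and m: "K + 3 * l \<le> n" and n: "n \<ge> 2" and K: "K > 0"
  shows "block_count n K l (rows n L) \<le> card (cubo_in n (blocks K l) L)"
proof -
  define xs where "xs = rows n L"
  define As where "As = take K xs"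
  define as where "as = slice K l xs"
  define bs where "bs = slice (K + l) l xs"
  define ds where "ds = slice (K + 2 * l) l xs"
  let ?N = "{1..n}"
  have xs: "xs \<in> rectangles n n" unfolding xs_def using L by (rule rows_in_rectangles)
  have len: "length xs = n" by (simp add: xs_def)
  interpret family ?N As n K
    unfolding As_def using take_rectangle[OF xs] m n K by (intro family_rectangle) auto
  have nth: "(xs ! i) c = L (Suc i) c" if "i < n" "c \<in> ?N" for i c
    using that by (simp add: xs_def nth_rows)
  have perm: "xs ! i permutes ?N" if "i < n" for i
    using xs that len by (auto simp: rectangles_def perm_lists_def subset_iff)
  define D where "D = {(i, c) \<in> {..<l} \<times> \<Omega>. map (ds ! i) c \<in> Qnd as bs c}"
  define g :: "row_col_pairs \<Rightarrow> nat \<times> nat list"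
    where "g = (\<lambda>((r1, r2), (r1', r2'), (c1, c2), cs). (r2 - (K + 2 * l + 1), [c1, c2]))"
  have "D \<subseteq> g ` cubo_in n (blocks K l) L"
  proof
    fix z assume "z \<in> D"
    then obtain i c where z: "z = (i, c)" and i: "i < l" and c: "c \<in> \<Omega>" and Q: "map (ds ! i) c \<in> Qnd as bs c"
      by (auto simp: D_def)
    obtain c1 c2 where c12: "c = [c1, c2]" "c1 \<in> ?N" "c2 \<in> ?N" "c1 \<noteq> c2"
      using c by (auto simp: dlists_def numeral_2_eq_2 length_Suc_conv)
    obtain a' a b where ab: "a' \<in> set As" "a \<in> set as" "b \<in> set bs" "nondeg a' a b c"
      "map (ds ! i) c = map (b \<circ> inv a' \<circ> a) c"
      using Q unfolding Qnd_def by blast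
    obtain i1' where i1': "i1' < K" "a' = xs ! i1'"
      using ab(1) m len by (auto simp: As_def in_set_conv_nth)
    obtain i1 where i1: "i1 < l" "a = xs ! (K + i1)"
      using in_set_slice[OF ab(2)[unfolded as_def]] m len by auto
    obtain i2' where i2': "i2' < l" "b = xs ! (K + l + i2')"
      using in_set_slice[OF ab(3)[unfolded bs_def]] m len by auto
    define d where "d = ds ! i"
    have d: "d = xs ! (K + 2 * l + i)" unfolding d_def ds_def using i m len by (intro nth_slice) auto
    have a'p: "a' permutes ?N" and ap: "a permutes ?N" and bp: "b permutes ?N"
      using perm i1' i1 i2' m by auto
    define e1 where "e1 = inv a' (a c1)"
    define e2 where "e2 = inv a' (a c2)"
    have e: "e1 \<in> ?N" "e2 \<in> ?N" "a' e1 = a c1" "a' e2 = a c2"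
      using c12 permutes_in_image[OF permutes_inv[OF a'p]] permutes_in_image[OF ap] permutes_inverses(1)[OF a'p]
      unfolding e1_def e2_def by blast+
    have de: "d c1 = b e1" "d c2 = b e2" using ab(5) c12(1) by (auto simp: d_def e1_def e2_def)
    have nd: "e1 \<noteq> c2" "e2 \<noteq> c1" "b e1 \<noteq> a c2" "b e2 \<noteq> a c1"
      using ab(4) c12(1) by (auto simp: nondeg_def e1_def e2_def)
    have inj: "a c1 \<noteq> a c2" "d c1 \<noteq> d c2"
      using permutes_inj[OF ap] permutes_inj[OF perm[of "K + 2 * l + i"]] c12(4) i m d by (auto dest: injD)
    have ad: "a u \<noteq> d u" if "u \<in> ?N" for u
      unfolding d i1(2) using i i1 m that by (intro rectangles_disagree[OF xs]) auto
    have aa: "a u \<noteq> a' u" if "u \<in> ?N" for u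
      unfolding i1'(2) i1(2) using i1' i1 m that by (intro rectangles_disagree[OF xs]) auto
    have ne: "e1 \<noteq> c1" "e2 \<noteq> c2" using aa[OF c12(2)] aa[OF c12(3)] e by auto
    have e12: "e1 \<noteq> e2" using inj(1) e by metis
    define r1 where "r1 = Suc (K + i1)"
    define r2 where "r2 = Suc (K + 2 * l + i)"
    define r1' where "r1' = Suc i1'"
    define r2' where "r2' = Suc (K + l + i2')"
    have L1: "L r1 u = a u" and L2: "L r2 u = d u" and L1': "L r1' u = a' u" and L2': "L r2' u = b u" if "u \<in> ?N" for u
      using nth[OF _ that] i i1 i1' i2' m
      by (auto simp: r1_def r2_def r1'_def r2'_def d)
    define q where "q = ((r1, r2), (r1', r2'), (c1, c2), (e1, e2))"
    have Lq: "L r1 c1 = a c1" "L r1 c2 = a c2" "L r2 c1 = d c1" "L r2 c2 = d c2"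
      "L r1' e1 = a c1" "L r1' e2 = a c2" "L r2' e1 = d c1" "L r2' e2 = d c2"
      using L1 L2 L1' L2' c12 e de by auto
    have rng: "r1 \<in> {K+1..K+l}" "r2 \<in> {K+2*l+1..K+3*l}" "r1' \<in> {1..K}" "r2' \<in> {K+l+1..K+2*l}"
      using i i1 i1' i2' by (auto simp: r1_def r2_def r1'_def r2'_def)
    have "q \<in> cuboctahedra n L"
      unfolding cuboctahedra_def q_def using rng m c12 e Lq by auto
    \<comment> \<open>Rows differ because the blocks are disjoint; columns by \<open>ne\<close>,
      \<open>nd(1,2)\<close>, \<open>e12\<close>; symbols by \<open>inj\<close>, \<open>ad\<close>,
      \<open>nd(3,4)\<close>.\<close>
    moreover have "nondegenerate L q"
      using rng c12(4) ne nd(1,2) e12 inj ad[OF c12(2)] ad[OF c12(3)] nd(3,4) de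
      by (auto simp: q_def Lq)
    moreover have "row_list q \<in> blocks K l" using rng by (auto simp: q_def blocks_def)
    moreover have "g q = z" by (simp add: g_def q_def z c12(1) r2_def)
    ultimately show "z \<in> g ` cubo_in n (blocks K l) L" unfolding cubo_in_def by blast
  qed
  then have "card D \<le> card (cubo_in n (blocks K l) L)" by (rule surj_card_le[OF finite_cubo_in])
  moreover have "W (Qnd as bs) ds = real (card D)"
  proof -
    have "length ds = l" unfolding ds_def using m len by (intro length_slice) auto
    then have "W (Qnd as bs) ds = (\<Sum>i<l. \<Sum>c\<in>\<Omega>. of_bool (map (ds ! i) c \<in> Qnd as bs c))"
      unfolding W_def w_def sum_list_sum_nth by (auto intro!: sum.cong simp: atLeast0LessThan)
    also have "\<dots> = (\<Sum>z\<in>{..<l} \<times> \<Omega>. of_bool (z \<in> D))"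
      unfolding sum.cartesian_product by (intro sum.cong) (auto simp: D_def)
    also have "\<dots> = card D"
    proof -
      have "{..<l} \<times> \<Omega> \<inter> D = D" by (auto simp: D_def)
      then show ?thesis using fin\<Omega> by (simp add: of_bool_def sum.If_cases)
    qed
    finally show ?thesis .
  qed
  ultimately show ?thesis by (simp add: block_count_def xs_def As_def as_def bs_def ds_def)
qed

text \<open>Cutting into the four slices is injective. Disagreement is kept only within the first
  block, where \<open>family\<close> needs it, and is discarded for the rest, so that the other
  three blocks range over independent permutations.\<close>

lemma few_bad_rectangles:
  fixes \<tau> \<rho> :: real
  assumes n: "n \<ge> 2" and K: "K > 0" and l: "l > 0" and \<tau>: "0 < \<tau>" "\<tau> \<le> 1"
    and \<rho>: "\<rho> = K * (real l)\<^sup>2 / (real n)\<^sup>2" "\<rho> \<le> \<tau>"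
    and n\<tau>: "4 \<le> \<tau> * n" and Kl: "real K * l \<le> \<tau> * (real n)\<^sup>2"
  shows "card {xs \<in> rectangles n (K + 3 * l). block_count n K l xs \<le> (1 - 7 * \<tau>) * K * real l ^ 3}
     \<le> 3 * fact n ^ (K + 3 * l) * exp (- (\<tau>\<^sup>2 * \<rho>\<^sup>2 * l * n / 256))"
proof -
  let ?m = "K + 3 * l" and ?A = "perm_lists {1..n} l" and ?e = "exp (- (\<tau>\<^sup>2 * \<rho>\<^sup>2 * l * n / 256))"
  let ?R = "{xs \<in> rectangles n ?m. block_count n K l xs \<le> (1 - 7 * \<tau>) * K * real l ^ 3}"
  define Bd where "Bd As = {(as, bs, ds) \<in> ?A \<times> ?A \<times> ?A. family.W {1..n} (family.Qnd As as bs) ds \<le> (1 - 7 * \<tau>) * K * real l ^ 3}" for As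
  define h where "h xs = (take K xs, slice K l xs, slice (K + l) l xs, slice (K + 2 * l) l xs)" for xs :: "(nat \<Rightarrow> nat) list"
  have finA: "finite ?A" by (simp add: finite_perm_lists)
  have finBd: "finite (Bd As)" for As
    unfolding Bd_def by (rule finite_subset[of _ "?A \<times> ?A \<times> ?A"]) (use finA in auto)
  have "card ?R \<le> card (SIGMA As:rectangles n K. Bd As)"
  proof (rule card_inj_on_le)
    show "inj_on h ?R"
    proof (rule inj_onI)
      fix xs ys assume xy: "xs \<in> ?R" "ys \<in> ?R" "h xs = h ys"
      have rec: "zs = take K zs @ slice K l zs @ slice (K + l) l zs @ slice (K + 2 * l) l zs" if "length zs = ?m" for zs :: "(nat \<Rightarrow> nat) list"
      proof -
        have "zs = take K zs @ take l (drop K zs) @ take l (drop l (drop K zs)) @ drop l (drop l (drop K zs))"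
          by (metis append_take_drop_id)
        moreover have "take l (drop l (drop l (drop K zs))) = drop l (drop l (drop K zs))" using that by simp
        ultimately show ?thesis by (simp add: slice_def mult_2 add_ac)
      qed
      have "length xs = ?m" "length ys = ?m" using xy by (auto simp: rectangles_def perm_lists_def)
      then show "xs = ys" using rec[of xs] rec[of ys] xy(3) by (simp add: h_def)
    qed
    show "h ` ?R \<subseteq> (SIGMA As:rectangles n K. Bd As)"
    proof (rule image_subsetI)
      fix xs assume xs: "xs \<in> ?R"
      then have len: "length xs = ?m" and pl: "set xs \<subseteq> perms {1..n}" by (auto simp: rectangles_def perm_lists_def)
      have sl: "slice k l xs \<in> ?A" if "k + l \<le> ?m" for k
      proof -
        have "set (slice k l xs) \<subseteq> set xs" unfolding slice_def by (meson set_take_subset set_drop_subset subset_trans)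
        then show ?thesis using pl that len by (auto simp: perm_lists_def length_slice)
      qed
      have "take K xs \<in> rectangles n K" using xs by (intro take_rectangle[of _ _ ?m]) auto
      moreover have "(slice K l xs, slice (K + l) l xs, slice (K + 2 * l) l xs) \<in> Bd (take K xs)"
        using xs sl[of K] sl[of "K + l"] sl[of "K + 2 * l"] by (auto simp: Bd_def block_count_def)
      ultimately show "h xs \<in> (SIGMA As:rectangles n K. Bd As)" by (simp add: h_def)
    qed
    show "finite (SIGMA As:rectangles n K. Bd As)" using finite_rectangles finBd by auto
  qed
  also have "real (card (SIGMA As:rectangles n K. Bd As)) = (\<Sum>As\<in>rectangles n K. real (card (Bd As)))"
    using finite_rectangles finBd by simp
  also have "\<dots> \<le> (\<Sum>As\<in>rectangles n K. 3 * fact n ^ (3 * l) * ?e)"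
  proof (rule sum_mono)
    fix As assume "As \<in> rectangles n K"
    then interpret family "{1..n}" As n K using n K by (rule family_rectangle)
    show "real (card (Bd As)) \<le> 3 * fact n ^ (3 * l) * ?e"
      unfolding Bd_def by (rule few_bad_triples[OF l \<tau> \<rho> n\<tau> Kl])
  qed
  also have "\<dots> = card (rectangles n K) * (3 * fact n ^ (3 * l) * ?e)" by simp
  also have "\<dots> \<le> fact n ^ K * (3 * fact n ^ (3 * l) * ?e)"
  proof (rule mult_right_mono)
    have "card (rectangles n K) \<le> card (perm_lists {1..n} K)"
      by (intro card_mono finite_perm_lists) (auto simp: rectangles_def)
    then have "card (rectangles n K) \<le> fact n ^ K" by (simp add: card_perm_lists)
    from of_nat_mono[OF this] show "real (card (rectangles n K)) \<le> fact n ^ K" by simp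
  qed simp
  finally show ?thesis by (simp add: power_add mult_ac)
qed

section \<open>Factorial estimates and the density of the first rows\<close>

lemma fact_le_exp:
  assumes "k \<ge> 1"
  shows "fact k \<le> exp 1 * real k * (k / exp 1) ^ k"
  using assms
proof (induction k rule: dec_induct)
  case base
  then show ?case by simp
next
  case (step k)
  have k: "real k > 0" using step by simp
  \<comment> \<open>The induction step rests on \<open>(1 + 1/k)^(k+1) \<ge> e\<close>, that is,
    \<open>ln (1 + 1/k) \<ge> 1 / (k+1)\<close>.\<close>
  have "1 / (1 + real k) = 1 - 1 / ((1 + real k) / k)" using k by (simp add: field_simps)
  also have "\<dots> \<le> ln ((1 + real k) / k)"
    using ln_le_minus_one[of "1 / ((1 + real k) / k)"] k by (simp add: ln_div)
  finally have "1 \<le> (1 + real k) * ln ((1 + real k) / k)" using k by (simp add: field_simps)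
  then have "exp 1 \<le> exp (real (Suc k) * ln ((1 + real k) / k))" by simp
  also have "\<dots> = ((1 + real k) / k) ^ Suc k" using k by (subst exp_of_nat_mult) simp
  finally have e: "exp 1 * real k ^ Suc k \<le> (1 + real k) ^ Suc k" using k by (simp add: power_divide field_simps)
  have "fact (Suc k) = (1 + real k) * fact k" by simp
  also have "\<dots> \<le> (1 + real k) * (exp 1 * real k * (k / exp 1) ^ k)"
    using step.IH by (intro mult_left_mono) auto
  also have "\<dots> = (1 + real k) * (exp 1 * real k ^ Suc k) / exp 1 ^ k"
    by (simp add: power_divide)
  also have "\<dots> \<le> (1 + real k) * (1 + real k) ^ Suc k / exp 1 ^ k"
    using e by (intro divide_right_mono mult_left_mono) auto
  also have "\<dots> = exp 1 * real (Suc k) * (Suc k / exp 1) ^ Suc k" by (simp add: power_divide)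
  finally show ?case .
qed

text \<open>Compares the upper bound for a permanent with the lower bound \<open>(k / e)^n\<close>.
  Over all \<open>k\<close> the correction exponents form a harmonic sum of order
  \<open>n * (ln n)\<^sup>2\<close>, negligible against \<open>n\<^sup>2\<close>.\<close>

lemma bregman_factor_le:
  assumes "1 \<le> k" "k \<le> n"
  shows "bregman_factor n k \<le> (k / exp 1) ^ n * exp (n * ((1 + ln n) / k))"
proof -
  have k: "real k > 0" using assms by simp
  have "ln (fact k) \<le> ln (exp 1 * real k * (k / exp 1) ^ k)"
    using fact_le_exp[OF assms(1)] k by (intro ln_mono) auto
  also have "\<dots> = 1 + ln k + k * (ln k - 1)"
    using k by (simp add: ln_mult ln_realpow ln_div)
  also have "\<dots> \<le> 1 + ln n + k * (ln k - 1)" using assms by simp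
  finally have "ln (fact k) / k \<le> (1 + ln n + k * (ln k - 1)) / k" by (intro divide_right_mono) auto
  also have "\<dots> = (ln k - 1) + (1 + ln n) / k" using k by (simp add: add_divide_distrib)
  finally have "n * (ln (fact k) / k) \<le> n * ((ln k - 1) + (1 + ln n) / k)"
    by (intro mult_left_mono) auto
  then have "n * (ln (fact k) / k) \<le> n * (ln k - 1) + n * ((1 + ln n) / k)"
    by (simp only: distrib_left)
  then have "exp (n * (ln (fact k) / k)) \<le> exp (n * (ln k - 1)) * exp (n * ((1 + ln n) / k))"
    by (simp flip: exp_add)
  also have "exp (n * (ln k - 1)) = (k / exp 1) ^ n"
    using k by (subst exp_of_nat_mult) (simp add: exp_diff)
  finally show ?thesis .
qed

text \<open>A free row against a row extending \<open>i\<close> given ones: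
  \<open>n / (n - i) \<le> exp (i / (n - i))\<close>, and \<open>n / (n - i) \<le> 2\<close> because
  \<open>2 * i \<le> n\<close>, so the \<open>n\<close>-th power is at most
  \<open>exp (2 * i)\<close>.\<close>

lemma fact_ratio_le:
  assumes "2 * i \<le> n" "n \<ge> 1"
  shows "fact n \<le> (real (n - i) / exp 1) ^ n * exp (1 + ln n + 2 * real i)"
proof -
  have n: "real n > 0" and ni: "real (n - i) > 0" using assms by auto
  have r: "real (n - i) = real n - real i" using assms by (simp add: of_nat_diff)
  have "real n / real (n - i) = 1 + i / real (n - i)" using ni by (simp add: r field_simps)
  also have "\<dots> \<le> exp (i / real (n - i))" by (rule exp_ge_add_one_self)
  finally have "real n / real (n - i) \<le> exp (i / real (n - i))" .
  then have "(real n / real (n - i)) ^ n \<le> exp (i / real (n - i)) ^ n" using ni by (intro power_mono) auto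
  also have "\<dots> = exp (n * (i / real (n - i)))" by (rule exp_of_nat_mult[symmetric])
  also have "\<dots> \<le> exp (2 * real i)"
  proof -
    have "real n * i \<le> 2 * real (n - i) * i" using assms by (intro mult_right_mono) (auto simp: r)
    then show ?thesis using ni by (simp add: field_simps)
  qed
  finally have q: "(real n / real (n - i)) ^ n \<le> exp (2 * real i)" .
  have "fact n \<le> exp 1 * real n * (n / exp 1) ^ n" using assms by (intro fact_le_exp) auto
  also have "\<dots> = exp 1 * real n * ((real (n - i) / exp 1) ^ n * (real n / real (n - i)) ^ n)"
    using ni by (simp add: power_divide)
  also have "\<dots> \<le> exp 1 * real n * ((real (n - i) / exp 1) ^ n * exp (2 * real i))"
    using q by (intro mult_left_mono) auto
  also have "\<dots> = (real (n - i) / exp 1) ^ n * exp (1 + ln n + 2 * real i)"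
    using n by (simp add: exp_add)
  finally show ?thesis .
qed

text \<open>The law of the first \<open>m\<close> rows of a uniform Latin square has density at most
  \<open>exp (m (1 + ln n) + 2 m\<^sup>2 + n (1 + ln n)\<^sup>2)\<close> with respect to \<open>m\<close> independent uniform permutations.\<close>

lemma rectangle_density:
  assumes R: "R \<subseteq> rectangles n m" and m: "2 * m \<le> n" and n: "n \<ge> 1"
  shows "real (card (completions n m n R)) * fact n ^ m
     \<le> real (card R) * card (rectangles n n) * exp (m * (1 + ln n) + 2 * (real m)\<^sup>2 + n * (1 + ln n)\<^sup>2)"
proof -
  \<comment> \<open>The lower bound for the number of ways to add a row to \<open>i\<close> given
    ones. Bregman's factors are compared with it for the rows from \<open>m\<close> on, the factors
    \<open>n!\<close> for the first \<open>m\<close>; the two parts then multiply to the lower bound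
    for all squares.\<close>
  define v where "v i = (real (n - i) / exp 1) ^ n" for i
  have v: "v i \<ge> 0" for i by (simp add: v_def)
  have ln: "ln (real n) \<ge> 0" using n by simp
  have "(\<Prod>i=m..<n. bregman_factor n (n - i))
      \<le> (\<Prod>i=m..<n. v i * exp (n * ((1 + ln n) / real (n - i))))"
    unfolding v_def by (intro prod_mono conjI bregman_factor_le) auto
  also have "\<dots> = (\<Prod>i=m..<n. v i) * exp (\<Sum>i=m..<n. n * ((1 + ln n) / real (n - i)))"
    by (simp add: prod.distrib exp_sum)
  also have "(\<Sum>i=m..<n. n * ((1 + ln n) / real (n - i))) \<le> n * (1 + ln n)\<^sup>2"
  proof -
    have "(\<Sum>i=m..<n. 1 / real (n - i)) \<le> (\<Sum>i<n. 1 / real (n - i))"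
      by (intro sum_mono2) auto
    also have "\<dots> = (\<Sum>k=1..n. 1 / real k)"
      by (rule sum.reindex_bij_witness[of _ "\<lambda>k. n - k" "\<lambda>i. n - i"]) auto
    also have "\<dots> = harm n" by (simp add: harm_def divide_inverse)
    also have "\<dots> \<le> 1 + ln n" using euler_mascheroni_sequence_decreasing[of 1 n] n by (simp add: harm_expand)
    finally have "n * (1 + ln n) * (\<Sum>i=m..<n. 1 / real (n - i)) \<le> n * (1 + ln n) * (1 + ln n)"
      using ln by (intro mult_left_mono) auto
    then show ?thesis by (simp add: sum_distrib_left power2_eq_square mult_ac)
  qed
  finally have U: "(\<Prod>i=m..<n. bregman_factor n (n - i)) \<le> (\<Prod>i=m..<n. v i) * exp (n * (1 + ln n)\<^sup>2)"
    by (simp add: prod_nonneg v mult_left_mono)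
  have "fact n ^ m = (\<Prod>i<m. fact n :: real)" by simp
  also have "\<dots> \<le> (\<Prod>i<m. v i * exp (1 + ln n + 2 * real m))"
  proof (intro prod_mono conjI)
    fix i assume i: "i \<in> {..<m}"
    have "fact n \<le> v i * exp (1 + ln n + 2 * real i)" unfolding v_def using i m n by (intro fact_ratio_le) auto
    also have "\<dots> \<le> v i * exp (1 + ln n + 2 * real m)" using i v by (intro mult_left_mono) auto
    finally show "fact n \<le> v i * exp (1 + ln n + 2 * real m)" .
  qed auto
  also have "\<dots> = (\<Prod>i<m. v i) * exp (m * (1 + ln n) + 2 * (real m)\<^sup>2)"
    by (simp add: prod.distrib exp_of_nat_mult[symmetric] algebra_simps power2_eq_square)
  finally have V: "fact n ^ m \<le> (\<Prod>i<m. v i) * exp (m * (1 + ln n) + 2 * (real m)\<^sup>2)" .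
  have "real (card (completions n m n R)) * fact n ^ m
     \<le> (card R * ((\<Prod>i=m..<n. v i) * exp (n * (1 + ln n)\<^sup>2))) * ((\<Prod>i<m. v i) * exp (m * (1 + ln n) + 2 * (real m)\<^sup>2))"
  proof (intro mult_mono V)
    show "real (card (completions n m n R)) \<le> card R * ((\<Prod>i=m..<n. v i) * exp (n * (1 + ln n)\<^sup>2))"
      using m by (intro order.trans[OF card_completions_le[OF R]] mult_left_mono U) auto
  qed (auto intro!: mult_nonneg_nonneg prod_nonneg v)
  also have "\<dots> = card R * ((\<Prod>i<m. v i) * (\<Prod>i=m..<n. v i)) * exp (m * (1 + ln n) + 2 * (real m)\<^sup>2 + n * (1 + ln n)\<^sup>2)"
    by (simp add: exp_add mult_ac)
  also have "(\<Prod>i<m. v i) * (\<Prod>i=m..<n. v i) = (\<Prod>i<n. v i)"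
    using prod.atLeastLessThan_concat[of 0 m n v] m by (simp add: atLeast0LessThan)
  also have "card R * (\<Prod>i<n. v i) * exp (m * (1 + ln n) + 2 * (real m)\<^sup>2 + n * (1 + ln n)\<^sup>2)
     \<le> real (card R) * card (rectangles n n) * exp (m * (1 + ln n) + 2 * (real m)\<^sup>2 + n * (1 + ln n)\<^sup>2)"
    unfolding v_def by (intro mult_right_mono mult_left_mono card_rectangles_ge) auto
  finally show ?thesis .
qed

section \<open>Choice of constants and conclusion\<close>

lemma card_dlists_4_ge:
  assumes "n \<ge> 4"
  shows "(real n - 3) ^ 4 \<le> card (dlists {1..n} 4)"
proof -
  have "card (dlists {1..n} 4) = \<Prod>{n - 4 + 1..n}"
    unfolding dlists_def using card_lists_distinct_length_eq[of "{1..n}" 4] assms by simp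
  moreover have "(\<Prod>k\<in>{n - 4 + 1..n}. n - 3) \<le> \<Prod>{n - 4 + 1..n}"
    using assms by (intro prod_mono) auto
  moreover have "(\<Prod>k\<in>{n - 4 + 1..n}. n - 3) = (n - 3) ^ 4" using assms by simp
  ultimately have "(n - 3) ^ 4 \<le> card (dlists {1..n} 4)" by simp
  then have "real ((n - 3) ^ 4) \<le> card (dlists {1..n} 4)" by (rule of_nat_mono)
  then show ?thesis using assms by (simp add: of_nat_diff)
qed

abbreviation rare_squares :: "nat \<Rightarrow> real \<Rightarrow> (nat \<Rightarrow> nat \<Rightarrow> nat) set" where
  "rare_squares n \<delta> \<equiv> {L \<in> latin_squares n. real (X_H n L) \<le> (1 - \<delta>) * real n ^ 4}"

text \<open>The threshold \<open>T = (1 - \<delta> / 2) * K * l^3\<close> separates two behaviours: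
  relabelled rare squares have at most about \<open>(1 - \<delta>) * K * l^3\<close> cuboctahedra in
  the blocks on average, while independent rows exceed \<open>T\<close> outside a small set;
  \<open>\<tau> = \<delta> / 14\<close> makes the loss \<open>7 * \<tau>\<close> equal to
  \<open>\<delta> / 2\<close>. Replacing \<open>n^4\<close> by the number of 4-tuples costs a factor
  \<open>1 + \<delta> / 4\<close>, and Markov still leaves the fraction
  \<open>\<delta> / 4\<close>.\<close>

lemma few_cuboctahedra_count:
  fixes \<delta> \<tau> \<rho> :: real
  assumes \<delta>: "0 < \<delta>" "\<delta> \<le> 1" and \<tau>: "\<tau> = \<delta> / 14"
    and n: "n \<ge> 4" and K: "K > 0" and l: "l > 0"
    and \<rho>: "\<rho> = K * (real l)\<^sup>2 / (real n)\<^sup>2" "\<rho> \<le> \<tau>"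
    and n\<tau>: "4 \<le> \<tau> * n" and Kl: "real K * l \<le> \<tau> * (real n)\<^sup>2"
    and m: "m = K + 3 * l" "2 * m \<le> n" and n4: "real n ^ 4 \<le> (1 + \<delta> / 4) * (real n - 3) ^ 4"
  shows "card (rare_squares n \<delta>) * (\<delta> / 4)
     \<le> 3 * card (latin_squares n)
        * exp (- (\<tau>\<^sup>2 * \<rho>\<^sup>2 * l * n / 256) + (m * (1 + ln n) + 2 * (real m)\<^sup>2 + n * (1 + ln n)\<^sup>2))"
proof -
  define \<B> where "\<B> = rare_squares n \<delta>"
  define T where "T = (1 - 7 * \<tau>) * K * real l ^ 3"
  define d where "d = real (card (dlists {1..n} 4))"
  define R where "R = {xs \<in> rectangles n m. block_count n K l xs \<le> T}"
  define E where "E = exp (- (\<tau>\<^sup>2 * \<rho>\<^sup>2 * l * n / 256))"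
  define F where "F = exp (m * (1 + ln n) + 2 * (real m)\<^sup>2 + n * (1 + ln n)\<^sup>2)"
  have \<tau>': "0 < \<tau>" "\<tau> \<le> 1" using \<delta> \<tau> by auto
  have KL: "real K * real l ^ 3 > 0" using K l by simp
  have T_eq: "T = (1 - \<delta> / 2) * (K * real l ^ 3)" by (simp add: T_def \<tau>)
  have T: "T > 0" unfolding T_eq by (rule mult_pos_pos[OF _ KL]) (use \<delta> in simp)
  have d4: "(real n - 3) ^ 4 \<le> d" unfolding d_def using n by (rule card_dlists_4_ge)
  moreover have "(real n - 3) ^ 4 > 0" using n by (intro zero_less_power) auto
  ultimately have d: "d > 0" by linarith
  have nd: "real n ^ 4 \<le> (1 + \<delta> / 4) * d"
    using n4 mult_left_mono[OF d4, of "1 + \<delta> / 4"] \<delta> by linarith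
  have ge: "\<delta> / 4 \<le> 1 - (1 - \<delta>) * real n ^ 4 * (card (blocks K l) / d) / T"
  proof -
    have "(1 - \<delta>) * real n ^ 4 * (card (blocks K l) / d) / T
        \<le> (1 - \<delta>) * ((1 + \<delta> / 4) * d) * ((K * real l ^ 3) / d) / T"
      using \<delta> d T nd card_blocks_le[of K l]
      by (intro divide_right_mono mult_mono mult_left_mono) (auto simp flip: of_nat_power of_nat_mult)
    also have "\<dots> = ((1 - \<delta>) * (1 + \<delta> / 4)) / (1 - \<delta> / 2)"
      using d K l by (simp add: T_eq)
    also have "\<dots> \<le> 1 - \<delta> / 4"
    proof -
      have "(1 - \<delta>) * (1 + \<delta> / 4) \<le> (1 - \<delta> / 4) * (1 - \<delta> / 2)"
        by (simp add: algebra_simps)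
      then show ?thesis using \<delta> by (subst pos_divide_le_eq) auto
    qed
    finally show ?thesis by linarith
  qed
  let ?few = "{L \<in> latin_squares n. card (cubo_in n (blocks K l) L) < T}"
  from ge have "card \<B> * (\<delta> / 4) \<le> card \<B> * (1 - (1 - \<delta>) * real n ^ 4 * (card (blocks K l) / d) / T)"
    by (intro mult_left_mono) auto
  also have "\<dots> \<le> card ?few"
    unfolding d_def using m by (intro few_cubo_transfer blocks_subset T \<B>_def) auto
  also have "\<dots> \<le> real (card (completions n m n R))"
  proof (intro of_nat_mono card_inj_on_le)
    show "inj_on (rows n) ?few"
      using inj_on_rows by (rule inj_on_subset) auto
    show "rows n ` ?few
      \<subseteq> completions n m n R"
    proof (rule image_subsetI)
      fix L assume "L \<in> ?few"
      then have L: "L \<in> latin_squares n" and few: "card (cubo_in n (blocks K l) L) < T" by auto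
      have rect: "rows n L \<in> rectangles n n" using L by (rule rows_in_rectangles)
      have "block_count n K l (take m (rows n L)) = block_count n K l (rows n L)"
        unfolding block_count_def using m by (simp add: slice_take min_def)
      also have "\<dots> \<le> card (cubo_in n (blocks K l) L)"
        using m n K by (intro block_count_le_cubo L) auto
      finally have "block_count n K l (take m (rows n L)) \<le> T" using few by linarith
      then show "rows n L \<in> completions n m n R"
        using rect take_rectangle[OF rect, of m] m by (auto simp: R_def)
    qed
    show "finite (completions n m n R)"
      by (rule finite_subset[OF Collect_restrict finite_rectangles])
  qed
  \<comment> \<open>\<open>E\<close> is the tail for independent permutations, \<open>F\<close> the
    density; the total number \<open>n!^m\<close> of lists of permutations cancels.\<close>
  also have "\<dots> \<le> 3 * card (latin_squares n) * (E * F)"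
  proof -
    have R: "R \<subseteq> rectangles n m" by (auto simp: R_def)
    have "card R \<le> 3 * fact n ^ m * E"
      unfolding R_def T_def E_def m(1) using n by (intro few_bad_rectangles K l \<tau>' \<rho> n\<tau> Kl) auto
    then have "real (card R) * card (rectangles n n) * F \<le> (3 * fact n ^ m * E) * card (rectangles n n) * F"
      by (intro mult_right_mono) (auto simp: F_def)
    with rectangle_density[OF R m(2)] n
    have "real (card (completions n m n R)) * fact n ^ m
        \<le> (3 * fact n ^ m * E) * card (rectangles n n) * F" unfolding F_def by linarith
    also have "\<dots> = (3 * card (rectangles n n) * (E * F)) * fact n ^ m" by (simp only: mult_ac)
    finally have "real (card (completions n m n R)) \<le> 3 * card (rectangles n n) * (E * F)"
      by (rule mult_right_le_imp_le) simp
    then show ?thesis by (simp add: card_latin_squares)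
  qed
  finally show ?thesis unfolding \<B>_def E_def F_def exp_add[symmetric] .
qed

lemma few_cuboctahedra_rare:
  fixes \<delta> :: real
  assumes \<delta>: "0 < \<delta>" "\<delta> \<le> 1"
  shows "\<exists>c>0. \<forall>\<^sub>F n in sequentially.
     card (rare_squares n \<delta>) \<le> card (latin_squares n) * exp (- c * (real n)\<^sup>2)"
proof -
  define \<tau> where "\<tau> = \<delta> / 14"
  \<comment> \<open>Makes the density cost \<open>2 * m\<^sup>2 \<le> 32 * \<eta> * l * n\<close> at
    most \<open>\<tau>^4 * l * n / 32768\<close>, half of the guaranteed gain
    \<open>\<tau>^4 * l * n / 16384\<close>.\<close>
  define \<eta> where "\<eta> = \<tau> ^ 4 / 1048576"
  \<comment> \<open>With \<open>l\<close> about \<open>\<eta> * n\<close> this gives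
    \<open>\<rho> \<le> \<tau>\<close>; rounding down \<open>K\<close> and \<open>l\<close> loses at
    most factors 2 and 4 in \<open>K * l\<^sup>2\<close>, whence
    \<open>\<rho> \<ge> \<tau> / 8\<close>.\<close>
  define K where "K = nat \<lfloor>\<tau> / \<eta>\<^sup>2\<rfloor>"
  \<comment> \<open>The other half of the gain is at least \<open>2 * c * n\<^sup>2\<close>, as
    \<open>l \<ge> \<eta> * n / 2\<close>. One \<open>c\<close> absorbs the logarithmic terms, the
    other remains.\<close>
  define c where "c = \<tau> ^ 4 * \<eta> / 131072"
  have \<tau>: "0 < \<tau>" "\<tau> \<le> 1 / 14" using \<delta> by (auto simp: \<tau>_def)
  have "\<tau> ^ 4 \<le> \<tau> ^ 1" using \<tau> by (intro power_decreasing) auto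
  then have \<eta>: "0 < \<eta>" "\<eta> \<le> \<tau> / 1048576" using \<tau> by (auto simp: \<eta>_def)
  have "\<eta>\<^sup>2 \<le> \<eta> * 1" unfolding power2_eq_square using \<eta> \<tau> by (intro mult_left_mono) auto
  then have "2 * \<eta>\<^sup>2 \<le> \<tau>" using \<eta> \<tau> by linarith
  then have big: "\<tau> / \<eta>\<^sup>2 \<ge> 2" using \<eta> by (simp add: field_simps)
  have floor: "real (nat \<lfloor>x\<rfloor>) \<le> x" "x / 2 \<le> real (nat \<lfloor>x\<rfloor>)" if "x \<ge> 2" for x :: real
    using that by linarith+
  have K_le: "real K \<le> \<tau> / \<eta>\<^sup>2" unfolding K_def by (rule floor(1)[OF big])
  have K_ge: "real K \<ge> \<tau> / \<eta>\<^sup>2 / 2" unfolding K_def by (rule floor(2)[OF big])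
  have K0: "K > 0" using K_ge big by (cases "K = 0") auto
  have c: "c > 0" using \<tau> \<eta> by (simp add: c_def)
  have "\<forall>\<^sub>F n in sequentially. n \<ge> (4::nat)" by (rule eventually_ge_at_top)
  moreover have "\<forall>\<^sub>F n in sequentially. 4 \<le> \<tau> * real n" "\<forall>\<^sub>F n in sequentially. real K \<le> \<tau> * real n"
      "\<forall>\<^sub>F n in sequentially. 2 * real K + 4 \<le> \<eta> * real n"
    using \<tau> \<eta> by real_asymp+
  moreover have "\<forall>\<^sub>F n in sequentially. real n ^ 4 \<le> (1 + \<delta> / 4) * (real n - 3) ^ 4"
    using \<delta> by real_asymp
  \<comment> \<open>Here \<open>4 * n\<close> stands for \<open>m\<close>, and
    \<open>12 / \<delta>\<close> cancels the factors 3 and \<open>\<delta> / 4\<close> of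
    \<open>few_cuboctahedra_count\<close>.\<close>
  moreover have "\<forall>\<^sub>F n in sequentially. 4 * real n * (1 + ln (real n)) + real n * (1 + ln (real n))\<^sup>2 + ln (12 / \<delta>) \<le> c * (real n)\<^sup>2"
    using c by real_asymp
  ultimately have "\<forall>\<^sub>F n in sequentially.
     card (rare_squares n \<delta>) \<le> card (latin_squares n) * exp (- c * (real n)\<^sup>2)"
  proof eventually_elim
    case (elim n)
    define l where "l = nat \<lfloor>\<eta> * n\<rfloor>"
    define \<rho> where "\<rho> = K * (real l)\<^sup>2 / (real n)\<^sup>2"
    define m where "m = K + 3 * l"
    have n: "real n > 0" using elim(1) by simp
    have "\<eta> * n \<ge> 2" using elim(4) by linarith
    from floor[OF this] have l_le: "real l \<le> \<eta> * n" and l_ge: "real l \<ge> \<eta> * n / 2" by (simp_all add: l_def)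
    have lK: "K \<le> l" using l_ge elim(4) by linarith
    have l0: "l > 0" using lK K0 by simp
    have \<eta>n: "\<eta> * n \<le> n / 8" using mult_right_mono[of \<eta> "1/8" n] \<eta> \<tau> by simp
    have ln: "real l \<le> n" using l_le \<eta>n n by linarith
    have m_le: "real m \<le> 4 * l" using lK by (simp add: m_def)
    have m2: "2 * m \<le> n" using m_le l_le \<eta>n by linarith
    have "K * (real l)\<^sup>2 \<le> (\<tau> / \<eta>\<^sup>2) * (\<eta> * n)\<^sup>2"
      using K_le l_le \<tau> by (intro mult_mono power_mono) auto
    then have \<rho>_le: "\<rho> \<le> \<tau>" using n \<eta> by (simp add: \<rho>_def power_mult_distrib field_simps)
    have "(\<tau> / \<eta>\<^sup>2 / 2) * (\<eta> * n / 2)\<^sup>2 \<le> K * (real l)\<^sup>2"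
      using K_ge l_ge \<tau> \<eta> by (intro mult_mono power_mono) auto
    then have \<rho>_ge: "\<tau> / 8 \<le> \<rho>" using n \<eta> by (simp add: \<rho>_def power_mult_distrib power_divide field_simps)
    have "real K * l \<le> (\<tau> * n) * n" using elim(3) ln n by (intro mult_mono) auto
    then have Kl: "real K * l \<le> \<tau> * (real n)\<^sup>2" by (simp add: power2_eq_square)
    have ln0: "ln (real n) \<ge> 0" using elim(1) by simp
    have "\<tau>\<^sup>2 * (\<tau> / 8)\<^sup>2 * (l * n) / 256 \<le> \<tau>\<^sup>2 * \<rho>\<^sup>2 * (l * n) / 256"
      using \<rho>_ge \<tau> by (intro divide_right_mono mult_right_mono mult_left_mono power_mono) auto
    then have E1: "\<tau> ^ 4 * (l * n) / 16384 \<le> \<tau>\<^sup>2 * \<rho>\<^sup>2 * l * n / 256"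
      by (simp add: power_divide power2_eq_square power4_eq_xxxx mult_ac)
    have "2 * (real m)\<^sup>2 \<le> 2 * (4 * real l)\<^sup>2" using m_le by (intro mult_left_mono power_mono) auto
    also have "\<dots> = 32 * (real l * l)" by (simp add: power2_eq_square)
    also have "\<dots> \<le> 32 * (real l * (\<eta> * n))" using l_le by (intro mult_left_mono) auto
    finally have E2: "2 * (real m)\<^sup>2 \<le> \<tau> ^ 4 * (l * n) / 32768" by (simp add: \<eta>_def mult_ac)
    have "(\<eta> * n / 2) * n \<le> real l * n" using l_ge by (rule mult_right_mono) simp
    then have "\<tau> ^ 4 * ((\<eta> * n / 2) * n) \<le> \<tau> ^ 4 * (real l * n)" by (rule mult_left_mono) simp
    then have E3: "2 * c * (real n)\<^sup>2 \<le> \<tau> ^ 4 * (l * n) / 32768" by (simp add: c_def power2_eq_square mult_ac)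
    have "m * (1 + ln n) \<le> 4 * real n * (1 + ln n)" using m_le ln ln0 by (intro mult_right_mono) auto
    then have expo: "- (\<tau>\<^sup>2 * \<rho>\<^sup>2 * l * n / 256) + (m * (1 + ln n) + 2 * (real m)\<^sup>2 + n * (1 + ln n)\<^sup>2)
       \<le> - c * (real n)\<^sup>2 - ln (12 / \<delta>)"
      using E1 E2 E3 elim(6) by (simp add: algebra_simps)
    define B where "B = real (card (rare_squares n \<delta>))"
    have "B * (\<delta> / 4) \<le> 3 * card (latin_squares n)
        * exp (- (\<tau>\<^sup>2 * \<rho>\<^sup>2 * l * n / 256) + (m * (1 + ln n) + 2 * (real m)\<^sup>2 + n * (1 + ln n)\<^sup>2))"
      unfolding B_def
      by (rule few_cuboctahedra_count[OF \<delta> \<tau>_def elim(1) K0 l0 \<rho>_def \<rho>_le elim(2) Kl m_def m2 elim(5)])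
    also have "\<dots> \<le> 3 * card (latin_squares n) * exp (- c * (real n)\<^sup>2 - ln (12 / \<delta>))"
      using expo by (intro mult_left_mono) auto
    also have "\<dots> = card (latin_squares n) * exp (- c * (real n)\<^sup>2) * (\<delta> / 4)"
      using \<delta> by (simp add: exp_diff)
    finally show ?case using \<delta> unfolding B_def by simp
  qed
  then show ?thesis using c by blast
qed

theorem theorem7p3:
  fixes \<delta> :: real
  assumes "\<delta> > 0"
  shows "\<exists>c>0. \<forall>\<^sub>F n in sequentially.
           measure_pmf.prob (pmf_of_set (latin_squares n))
             {L. real (X_H n L) \<le> (1 - \<delta>) * real n ^ 4}
           \<le> exp (- c * real n ^ 2)"
proof -
  \<comment> \<open>The counting argument takes \<delta> at most 1; lowering \<delta> only enlarges
    the event.\<close>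
  define \<delta>' where "\<delta>' = min \<delta> 1"
  have \<delta>': "0 < \<delta>'" "\<delta>' \<le> 1" "\<delta>' \<le> \<delta>" using assms by (auto simp: \<delta>'_def)
  obtain c where c: "c > 0" and ev: "\<forall>\<^sub>F n in sequentially.
     card (rare_squares n \<delta>') \<le> card (latin_squares n) * exp (- c * (real n)\<^sup>2)"
    using few_cuboctahedra_rare[OF \<delta>'(1,2)] by blast
  from ev have "\<forall>\<^sub>F n in sequentially.
      measure_pmf.prob (pmf_of_set (latin_squares n)) {L. real (X_H n L) \<le> (1 - \<delta>) * real n ^ 4}
        \<le> exp (- c * real n ^ 2)"
  proof eventually_elim
    case (elim n)
    let ?A = "latin_squares n"
    have pos: "real (card ?A) > 0"
      using finite_latin_squares latin_squares_nonempty by (simp add: card_gt_0_iff)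
    have "(1 - \<delta>) * real n ^ 4 \<le> (1 - \<delta>') * real n ^ 4" using \<delta>'(3) by (intro mult_right_mono) auto
    then have "card (?A \<inter> {L. real (X_H n L) \<le> (1 - \<delta>) * real n ^ 4})
        \<le> card (rare_squares n \<delta>')"
      by (intro card_mono finite_subset[OF Collect_restrict finite_latin_squares]) auto
    then have "real (card (?A \<inter> {L. real (X_H n L) \<le> (1 - \<delta>) * real n ^ 4})) \<le> card ?A * exp (- c * (real n)\<^sup>2)"
      using elim by linarith
    then show ?case
      using pos by (simp add: measure_pmf_of_set[OF latin_squares_nonempty finite_latin_squares] field_simps)
  qed
  then show ?thesis using c by blast
qed

end
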